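(* Let $E/k$ be a separable field extension of degree $d$, and let $\widehat E/k$ be its Galois closure. Let $\mathscr L$ be the set of overfields $L$ of $k$ such that $E/k$ is potentially Galois over $L$, let $\mathscr G$ be the set of complements of $\mathrm{Gal}(\widehat E/E)$ in $\mathrm{Gal}(\widehat E/k)$, and let $\mathbb G:\mathscr L\to\mathscr G$ be the map $L\mapsto \mathbb G(L)=\mathrm{res}(\mathrm{Gal}(EL/L))$, where $\mathrm{res}:\mathrm{Gal}(EL/L)\to\mathrm{Gal}(\widehat E/k)$ is restriction. Let $\mathscr L_{\mathrm m}\subset\mathscr L$ be the subset of minimal fields $L$ in $\mathscr L$ (for inclusion). (a) The restriction $\mathbb G:\mathscr L_{\mathrm m}\to\mathscr G$ of $\mathbb G$ to $\mathscr L_{\mathrm m}$ is a bijection whose inverse is the map $\mathbb L:\mathscr G\to\mathscr L_{\mathrm m}$ defined by $\mathbb L(G)=\widehat E^G$. (b) For each $L\in\mathscr L_{\mathrm m}$, we have $L\subset\widehat E$, $EL=\widehat E$, and the extension $E/k$ is potentially Galois over $L$ with group $\mathbb G(L)=\mathrm{Gal}(\widehat E/L)$. (c) For every $L\in\mathscr L$, there is a unique $L_0\in\mathscr L_{\mathrm m}$ such that $L_0\subset L$; and $L_0=\mathbb L(\mathbb G(L))$. The extension $EL/L$ is obtained from $EL_0/L_0$ by base change. Furthermore, $\mathbb G(L)=\mathbb G(L_0)$. Finally, if $L/k$ is Galois, so is $L_0/k$, and $\mathbb G(L)$ is normal in $\mathrm{Gal}(\widehat E/k)$.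
   Context: All fields are taken inside a fixed field $\Omega$ containing $\widehat E$ (overfields $L$ of $k$ are subfields of $\Omega$, not necessarily algebraic over $k$), so that composita $EL$ make sense. $E/k$ is potentially Galois over $L$ with group $G$ if $E\otimes_kL$ is a Galois field extension of $L$ with Galois group $G$; equivalently, $EL/L$ is Galois of degree $[E:k]$ with group $G$. In that case $\widehat E\subset EL$, and the restriction map $\mathrm{res}$ is injective with image a complement of $\mathrm{Gal}(\widehat E/E)$, so the map $\mathbb G$ is well defined. A subgroup $U$ is a complement of a subgroup $V$ in a group $\Gamma$ if every element of $\Gamma$ can be uniquely written as $uv$ with $u\in U$, $v\in V$. $\widehat E^G$ is the fixed field of $G$ in $\widehat E$. The sets $\mathscr L$, $\mathscr G$ may be empty. *)

theory Defs
  imports "HOL-Algebra.Algebra"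
begin

section \<open>Field extensions inside an ambient ring\<close>

text \<open>An extension F/K is a pair of subfields of an ambient ring R. For the fields of the
  theorem, R is the ambient field \<open>\<Omega>\<close>; for a tensor product T that happens to be a field, R and F
  are T itself and K is the image of the base field.\<close>

definition field_extension :: "('a, 'b) ring_scheme \<Rightarrow> 'a set \<Rightarrow> 'a set \<Rightarrow> bool" where
  "field_extension R K F \<longleftrightarrow> subfield K R \<and> subfield F R \<and> K \<subseteq> F"

definition algebraic_extension :: "('a, 'b) ring_scheme \<Rightarrow> 'a set \<Rightarrow> 'a set \<Rightarrow> bool" where
  "algebraic_extension R K F \<longleftrightarrow>
     field_extension R K F \<and> (\<forall>x\<in>F. ring.algebraic R K x)"

text \<open>Polynomials are coefficient lists with the leading coefficient first, so the list below is
  \<open>[n a\<^sub>n, \<dots>, 2 a\<^sub>2, a\<^sub>1]\<close>; it is normalized because leading entries may vanish.\<close>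

definition formal_derivative :: "('a, 'b) ring_scheme \<Rightarrow> 'a list \<Rightarrow> 'a list" where
  "formal_derivative R p =
     ring.normalize R (map (\<lambda>i. add_pow R i (ring.coeff R p i)) (rev [1..<length p]))"

definition separable_poly :: "('a, 'b) ring_scheme \<Rightarrow> 'a set \<Rightarrow> 'a list \<Rightarrow> bool" where
  "separable_poly R K p \<longleftrightarrow>
     p \<in> carrier (univ_poly R K) \<and>
     (\<forall>g \<in> carrier (univ_poly R K).
        g divides\<^bsub>univ_poly R K\<^esub> p \<and> g divides\<^bsub>univ_poly R K\<^esub> formal_derivative R p
          \<longrightarrow> g \<in> Units (univ_poly R K))"

definition separable_extension :: "('a, 'b) ring_scheme \<Rightarrow> 'a set \<Rightarrow> 'a set \<Rightarrow> bool" where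
  "separable_extension R K F \<longleftrightarrow>
     algebraic_extension R K F \<and> (\<forall>x\<in>F. separable_poly R K (ring.Irr R K x))"

text \<open>As in \<open>BijGroup\<close>, automorphisms of F are extensional functions (\<open>undefined\<close> off F), and the
  product is composition.\<close>

definition galois_group :: "('a, 'b) ring_scheme \<Rightarrow> 'a set \<Rightarrow> 'a set \<Rightarrow> ('a \<Rightarrow> 'a) monoid" where
  "galois_group R K F = (BijGroup F)
     \<lparr>carrier := {\<sigma> \<in> Bij F. \<sigma> \<in> ring_hom (R\<lparr>carrier := F\<rparr>) (R\<lparr>carrier := F\<rparr>)
                          \<and> (\<forall>x\<in>K. \<sigma> x = x)}\<rparr>"

definition fixed_field :: "'a set \<Rightarrow> ('a \<Rightarrow> 'a) set \<Rightarrow> 'a set" where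
  "fixed_field F G = {x \<in> F. \<forall>\<sigma>\<in>G. \<sigma> x = x}"

text \<open>Bourbaki's definition (Algebra V, par. 10), valid for algebraic extensions of arbitrary
  degree.\<close>

definition galois_extension :: "('a, 'b) ring_scheme \<Rightarrow> 'a set \<Rightarrow> 'a set \<Rightarrow> bool" where
  "galois_extension R K F \<longleftrightarrow>
     algebraic_extension R K F \<and> fixed_field F (carrier (galois_group R K F)) = K"

definition galois_closure :: "('a, 'b) ring_scheme \<Rightarrow> 'a set \<Rightarrow> 'a set \<Rightarrow> 'a set \<Rightarrow> bool" where
  "galois_closure R K E F \<longleftrightarrow>
     galois_extension R K F \<and> E \<subseteq> F \<and>
     (\<forall>F'. galois_extension R K F' \<and> E \<subseteq> F' \<and> F' \<subseteq> F \<longrightarrow> F' = F)"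

definition compositum :: "('a, 'b) ring_scheme \<Rightarrow> 'a set \<Rightarrow> 'a set \<Rightarrow> 'a set" where
  "compositum R E L = generate_field R (E \<union> L)"


section \<open>Tensor products\<close>

text \<open>The tensor product of A and B over K, for K a common subring of the commutative subrings
  A and B of R, is the monoid ring of the multiplicative monoid \<open>A \<times> B\<close> with integer coefficients
  modulo the ideal generated by the bilinearity relations. Here \<open>frag_of (a, b)\<close> is the generator
  attached to \<open>(a, b)\<close>, and the product extends
  \<open>(a, b) (a', b') = (a a', b b')\<close> biadditively.\<close>

definition pair_monoid_ring ::
    "('a, 'b) ring_scheme \<Rightarrow> 'a set \<Rightarrow> 'a set \<Rightarrow> (('a \<times> 'a) \<Rightarrow>\<^sub>0 int) ring" where
  "pair_monoid_ring R A B =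
     \<lparr>carrier = {c. Poly_Mapping.keys c \<subseteq> A \<times> B},
      monoid.mult = (\<lambda>c c'. frag_extend (\<lambda>p. frag_extend
                (\<lambda>q. frag_of (fst p \<otimes>\<^bsub>R\<^esub> fst q, snd p \<otimes>\<^bsub>R\<^esub> snd q)) c') c),
      one = frag_of (\<one>\<^bsub>R\<^esub>, \<one>\<^bsub>R\<^esub>),
      ring.zero = 0,
      ring.add = (+)\<rparr>"

definition tensor_relations ::
    "('a, 'b) ring_scheme \<Rightarrow> 'a set \<Rightarrow> 'a set \<Rightarrow> 'a set \<Rightarrow> (('a \<times> 'a) \<Rightarrow>\<^sub>0 int) set" where
  "tensor_relations R K A B =
     {frag_of (a \<oplus>\<^bsub>R\<^esub> a', b) - frag_of (a, b) - frag_of (a', b) | a a' b. a \<in> A \<and> a' \<in> A \<and> b \<in> B}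
   \<union> {frag_of (a, b \<oplus>\<^bsub>R\<^esub> b') - frag_of (a, b) - frag_of (a, b') | a b b'. a \<in> A \<and> b \<in> B \<and> b' \<in> B}
   \<union> {frag_of (a \<otimes>\<^bsub>R\<^esub> c, b) - frag_of (a, c \<otimes>\<^bsub>R\<^esub> b) | a b c. a \<in> A \<and> b \<in> B \<and> c \<in> K}"

definition tensor_ideal ::
    "('a, 'b) ring_scheme \<Rightarrow> 'a set \<Rightarrow> 'a set \<Rightarrow> 'a set \<Rightarrow> (('a \<times> 'a) \<Rightarrow>\<^sub>0 int) set" where
  "tensor_ideal R K A B = genideal (pair_monoid_ring R A B) (tensor_relations R K A B)"

definition tensor_ring ::
    "('a, 'b) ring_scheme \<Rightarrow> 'a set \<Rightarrow> 'a set \<Rightarrow> 'a set \<Rightarrow> (('a \<times> 'a) \<Rightarrow>\<^sub>0 int) set ring" where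
  "tensor_ring R K A B = pair_monoid_ring R A B Quot tensor_ideal R K A B"

definition pure_tensor ::
    "('a, 'b) ring_scheme \<Rightarrow> 'a set \<Rightarrow> 'a set \<Rightarrow> 'a set \<Rightarrow> 'a \<Rightarrow> 'a \<Rightarrow> (('a \<times> 'a) \<Rightarrow>\<^sub>0 int) set" where
  "pure_tensor R K A B a b = tensor_ideal R K A B +>\<^bsub>pair_monoid_ring R A B\<^esub> frag_of (a, b)"

definition tensor_base ::
    "('a, 'b) ring_scheme \<Rightarrow> 'a set \<Rightarrow> 'a set \<Rightarrow> 'a set \<Rightarrow> (('a \<times> 'a) \<Rightarrow>\<^sub>0 int) set set" where
  "tensor_base R K A B = pure_tensor R K A B \<one>\<^bsub>R\<^esub> ` B"

text \<open>M/L is obtained from F/K by base change: multiplication induces an isomorphism from the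
  tensor product of F and L over K onto M.\<close>

definition base_change ::
    "('a, 'b) ring_scheme \<Rightarrow> 'a set \<Rightarrow> 'a set \<Rightarrow> 'a set \<Rightarrow> 'a set \<Rightarrow> bool" where
  "base_change R K F L M \<longleftrightarrow>
     field_extension R K F \<and> field_extension R L M \<and> K \<subseteq> L \<and> F \<subseteq> M \<and>
     (\<exists>\<phi> \<in> ring_iso (tensor_ring R K F L) (R\<lparr>carrier := M\<rparr>).
        \<forall>x\<in>F. \<forall>y\<in>L. \<phi> (pure_tensor R K F L x y) = x \<otimes>\<^bsub>R\<^esub> y)"


section \<open>Potentially Galois extensions\<close>

definition potentially_galois ::
    "('a, 'b) ring_scheme \<Rightarrow> 'a set \<Rightarrow> 'a set \<Rightarrow> 'a set \<Rightarrow> bool" where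
  "potentially_galois R K E L \<longleftrightarrow>
     field (tensor_ring R K E L) \<and>
     galois_extension (tensor_ring R K E L) (tensor_base R K E L) (carrier (tensor_ring R K E L))"

definition potentially_galois_with_group ::
    "('a, 'b) ring_scheme \<Rightarrow> 'a set \<Rightarrow> 'a set \<Rightarrow> 'a set \<Rightarrow> ('g, 'h) monoid_scheme \<Rightarrow> bool" where
  "potentially_galois_with_group R K E L G \<longleftrightarrow>
     potentially_galois R K E L \<and>
     galois_group (tensor_ring R K E L) (tensor_base R K E L) (carrier (tensor_ring R K E L)) \<cong> G"

definition pot_galois_fields ::
    "('a, 'b) ring_scheme \<Rightarrow> 'a set \<Rightarrow> 'a set \<Rightarrow> 'a set set" where
  "pot_galois_fields R K E = {L. field_extension R K L \<and> potentially_galois R K E L}"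

definition min_pot_galois_fields ::
    "('a, 'b) ring_scheme \<Rightarrow> 'a set \<Rightarrow> 'a set \<Rightarrow> 'a set set" where
  "min_pot_galois_fields R K E =
     {L \<in> pot_galois_fields R K E. \<forall>L' \<in> pot_galois_fields R K E. L' \<subseteq> L \<longrightarrow> L' = L}"

definition complements :: "('g, 'h) monoid_scheme \<Rightarrow> 'g set \<Rightarrow> 'g set set" where
  "complements \<Gamma> V =
     {U. subgroup U \<Gamma> \<and> (\<forall>g \<in> carrier \<Gamma>. \<exists>!p. p \<in> U \<times> V \<and> g = fst p \<otimes>\<^bsub>\<Gamma>\<^esub> snd p)}"

definition galois_complements ::
    "('a, 'b) ring_scheme \<Rightarrow> 'a set \<Rightarrow> 'a set \<Rightarrow> 'a set \<Rightarrow> ('a \<Rightarrow> 'a) set set" where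
  "galois_complements R K E F =
     complements (galois_group R K F) (carrier (galois_group R E F))"

definition restricted_galois ::
    "('a, 'b) ring_scheme \<Rightarrow> 'a set \<Rightarrow> 'a set \<Rightarrow> 'a set \<Rightarrow> ('a \<Rightarrow> 'a) set" where
  "restricted_galois R E F L =
     (\<lambda>\<sigma>. restrict \<sigma> F) ` carrier (galois_group R L (compositum R E L))"

end

theory Submission
  imports Defs
begin

text \<open>Everything rests on one elementary fact: if a homomorphism \<open>\<rho>\<close> differs from each of
  finitely many others \<open>\<theta>\<close>, then there are \<open>c\<^sub>i, m\<^sub>i\<close> with \<open>\<Sum> c\<^sub>i \<rho>(m\<^sub>i) = 1\<close> and
  \<open>\<Sum> c\<^sub>i \<theta>(m\<^sub>i) = 0\<close> for all \<open>\<theta>\<close>. For a finite group \<open>G\<close> acting on \<open>F\<close> with fixed field \<open>K\<close> and a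
  subring \<open>D\<close> it yields \<open>a\<^sub>j \<in> F, b\<^sub>j \<in> D\<close> with \<open>y = \<Sum> Tr(a\<^sub>j y) b\<^sub>j\<close> for every \<open>y\<close> fixed by the
  stabilizer of \<open>D\<close>. This formula replaces bases and degree counts: it shows that every
  \<open>K\<close>-homomorphism on \<open>D\<close> comes from \<open>G\<close>, and that multiplication maps on tensor products are
  bijective. Write \<open>M\<close> for the Galois closure. A complement \<open>U\<close> of \<open>Gal(M/E)\<close> acts faithfully on \<open>E\<close> and realizes all conjugates of
  \<open>E\<close>, so \<open>E \<otimes> M\<^sup>U \<cong> M\<close>; conversely, if \<open>E \<otimes> L\<close> is a Galois field extension of \<open>L\<close>, its universal
  property extends each conjugation of \<open>E\<close> to an automorphism of \<open>EL/L\<close>, so that \<open>M \<subseteq> EL\<close> and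
  \<open>Gal(EL/L)\<close> restricts to a complement, with fixed field \<open>M \<inter> L\<close>.\<close>

section \<open>Sums over lists\<close>

text \<open>The field \<open>L\<close> may be transcendental over \<open>k\<close>, and
  \<open>\<Omega>\<close> is just some field containing everything, so conjugates of
  \<open>E\<close> are not taken from an algebraic closure: they are the images of \<open>E\<close>
  under \<open>Gal(M/k)\<close>. A homomorphism into \<open>\<Omega>\<close> with unknown image is
  confined to the right field afterwards, by identifying it with a group element. Finiteness has to
  be earned as well: the Galois closure is given by minimality only. Origin of the trace formula:
  let \<open>H\<close> be the stabilizer of \<open>D\<close>. Separating the identity from
  \<open>G - H\<close> on \<open>D\<close> gives \<open>c_j\<close>, \<open>m_j\<close> for which
  \<open>\<Sum> c_j \<theta>(m_j)\<close> is 1 on \<open>H\<close> and 0 off \<open>H\<close>;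
  passing to inverses, so is \<open>\<Sum> \<theta>(c_j) m_j\<close>. With \<open>z\<close> of
  \<open>H\<close>-trace 1, the choice \<open>a_j = c_j z\<close>, \<open>b_j = m_j\<close> works.
  Minimality in \<open>\<L>\<close> comes from group theory: one complement never properly contains
  another, while fixed fields reverse inclusion. Sums run over lists because a tensor is a sum of
  pairs with possible repetitions and no natural index set.\<close>

definition list_sum :: "('a, 'b) ring_scheme \<Rightarrow> ('c \<Rightarrow> 'a) \<Rightarrow> 'c list \<Rightarrow> 'a" where
  "list_sum R f xs = foldr (\<lambda>x s. f x \<oplus>\<^bsub>R\<^esub> s) xs \<zero>\<^bsub>R\<^esub>"

lemma list_sum_Nil [simp]: "list_sum R f [] = \<zero>\<^bsub>R\<^esub>"
  by (simp add: list_sum_def)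

lemma list_sum_Cons [simp]: "list_sum R f (x # xs) = f x \<oplus>\<^bsub>R\<^esub> list_sum R f xs"
  by (simp add: list_sum_def)

lemma list_sum_map [simp]: "list_sum R f (map g xs) = list_sum R (\<lambda>x. f (g x)) xs"
  by (induction xs) auto

lemma list_sum_cong: "(\<And>x. x \<in> set xs \<Longrightarrow> f x = g x) \<Longrightarrow> list_sum R f xs = list_sum R g xs"
  by (induction xs) auto

lemma list_sum_subring:
  assumes "subring D R" "\<And>x. x \<in> set xs \<Longrightarrow> f x \<in> D"
  shows "list_sum R f xs \<in> D"
  using assms(2) by (induction xs) (auto simp: subringE[OF assms(1)])

context ring begin

lemma list_sum_closed [simp, intro]:
  "(\<And>x. x \<in> set xs \<Longrightarrow> f x \<in> carrier R) \<Longrightarrow> list_sum R f xs \<in> carrier R"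
  by (rule list_sum_subring[OF carrier_is_subring])

lemma list_sum_append:
  assumes "\<And>x. x \<in> set (xs @ ys) \<Longrightarrow> f x \<in> carrier R"
  shows "list_sum R f (xs @ ys) = list_sum R f xs \<oplus> list_sum R f ys"
  using assms by (induction xs) (auto simp: a_assoc)

lemma list_sum_zero [simp]: "list_sum R (\<lambda>x. \<zero>) xs = \<zero>"
  by (induction xs) auto

lemma list_sum_add:
  assumes "\<And>x. x \<in> set xs \<Longrightarrow> f x \<in> carrier R" "\<And>x. x \<in> set xs \<Longrightarrow> g x \<in> carrier R"
  shows "list_sum R (\<lambda>x. f x \<oplus> g x) xs = list_sum R f xs \<oplus> list_sum R g xs"
  using assms by (induction xs) (auto simp: a_ac)

lemma list_sum_rdistr:
  assumes "\<And>x. x \<in> set xs \<Longrightarrow> f x \<in> carrier R" "c \<in> carrier R"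
  shows "c \<otimes> list_sum R f xs = list_sum R (\<lambda>x. c \<otimes> f x) xs"
  using assms by (induction xs) (auto simp: r_distr)

lemma list_sum_ldistr:
  assumes "\<And>x. x \<in> set xs \<Longrightarrow> f x \<in> carrier R" "c \<in> carrier R"
  shows "list_sum R f xs \<otimes> c = list_sum R (\<lambda>x. f x \<otimes> c) xs"
  using assms by (induction xs) (auto simp: l_distr)

lemma list_sum_swap:
  assumes "\<And>x y. x \<in> set xs \<Longrightarrow> y \<in> set ys \<Longrightarrow> f x y \<in> carrier R"
  shows "list_sum R (\<lambda>x. list_sum R (f x) ys) xs = list_sum R (\<lambda>y. list_sum R (\<lambda>x. f x y) xs) ys"
  using assms by (induction xs) (auto simp: list_sum_add)

lemma list_sum_finsum:
  assumes "\<And>x y. x \<in> set xs \<Longrightarrow> y \<in> A \<Longrightarrow> f x y \<in> carrier R"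
  shows "list_sum R (\<lambda>x. \<Oplus>y\<in>A. f x y) xs = (\<Oplus>y\<in>A. list_sum R (\<lambda>x. f x y) xs)"
  using assms by (induction xs) (auto simp: finsum_addf Pi_def)

end

lemma hom_list_sum:
  assumes "\<phi> \<in> ring_hom R S" "ring R" "ring S" "\<And>x. x \<in> set xs \<Longrightarrow> f x \<in> carrier R"
  shows "\<phi> (list_sum R f xs) = list_sum S (\<lambda>x. \<phi> (f x)) xs"
proof -
  interpret ring_hom_ring R S \<phi>
    using ring_hom_ringI2[OF assms(2,3,1)] .
  show ?thesis using assms(4) by (induction xs) auto
qed

lemma list_sum_carrier_update [simp]: "list_sum (R\<lparr>carrier := D\<rparr>) f xs = list_sum R f xs"
  by (simp add: list_sum_def)

section \<open>Homomorphisms between subrings\<close>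

lemma subring_homD:
  assumes "\<theta> \<in> ring_hom (R\<lparr>carrier := D\<rparr>) (R\<lparr>carrier := F\<rparr>)"
  shows "x \<in> D \<Longrightarrow> \<theta> x \<in> F"
    and "x \<in> D \<Longrightarrow> y \<in> D \<Longrightarrow> \<theta> (x \<otimes>\<^bsub>R\<^esub> y) = \<theta> x \<otimes>\<^bsub>R\<^esub> \<theta> y"
    and "x \<in> D \<Longrightarrow> y \<in> D \<Longrightarrow> \<theta> (x \<oplus>\<^bsub>R\<^esub> y) = \<theta> x \<oplus>\<^bsub>R\<^esub> \<theta> y"
    and "\<theta> \<one>\<^bsub>R\<^esub> = \<one>\<^bsub>R\<^esub>"
  using ring_hom_memE[OF assms] by auto

lemma subring_homI:
  assumes "\<And>x. x \<in> D \<Longrightarrow> \<theta> x \<in> F"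
    and "\<And>x y. x \<in> D \<Longrightarrow> y \<in> D \<Longrightarrow> \<theta> (x \<otimes>\<^bsub>R\<^esub> y) = \<theta> x \<otimes>\<^bsub>R\<^esub> \<theta> y"
    and "\<And>x y. x \<in> D \<Longrightarrow> y \<in> D \<Longrightarrow> \<theta> (x \<oplus>\<^bsub>R\<^esub> y) = \<theta> x \<oplus>\<^bsub>R\<^esub> \<theta> y"
    and "\<theta> \<one>\<^bsub>R\<^esub> = \<one>\<^bsub>R\<^esub>"
  shows "\<theta> \<in> ring_hom (R\<lparr>carrier := D\<rparr>) (R\<lparr>carrier := F\<rparr>)"
  using assms by (intro ring_hom_memI) auto

lemma subring_hom_mono:
  assumes "\<theta> \<in> ring_hom (R\<lparr>carrier := D\<rparr>) (R\<lparr>carrier := F\<rparr>)" "D' \<subseteq> D" "F \<subseteq> F'"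
  shows "\<theta> \<in> ring_hom (R\<lparr>carrier := D'\<rparr>) (R\<lparr>carrier := F'\<rparr>)"
  using assms by (intro subring_homI) (auto simp: subring_homD[OF assms(1)] subset_iff)

context ring begin

lemma subring_hom_ring:
  assumes "\<theta> \<in> ring_hom (R\<lparr>carrier := D\<rparr>) (R\<lparr>carrier := F\<rparr>)" "subring D R" "subring F R"
  shows "ring_hom_ring (R\<lparr>carrier := D\<rparr>) (R\<lparr>carrier := F\<rparr>) \<theta>"
  using assms by (intro ring_hom_ringI2 subring_is_ring)

lemma subring_hom_zero:
  assumes "\<theta> \<in> ring_hom (R\<lparr>carrier := D\<rparr>) (R\<lparr>carrier := F\<rparr>)" "subring D R" "subring F R"
  shows "\<theta> \<zero> = \<zero>"
proof -
  interpret h: ring_hom_ring "R\<lparr>carrier := D\<rparr>" "R\<lparr>carrier := F\<rparr>" \<theta>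
    using subring_hom_ring[OF assms] .
  show ?thesis using h.hom_zero by simp
qed

lemma subring_hom_list_sum:
  assumes "\<theta> \<in> ring_hom (R\<lparr>carrier := D\<rparr>) (R\<lparr>carrier := F\<rparr>)" "subring D R" "subring F R"
    and "\<And>x. x \<in> set xs \<Longrightarrow> f x \<in> D"
  shows "\<theta> (list_sum R f xs) = list_sum R (\<lambda>x. \<theta> (f x)) xs"
  using hom_list_sum[OF assms(1) subring_is_ring[OF assms(2)] subring_is_ring[OF assms(3)], of xs f] assms(4)
  by simp

text \<open>Membership of the sum in \<open>D\<close> is proved along with the equation because the
  induction step applies additivity of \<open>\<theta>\<close> to the partial sum.\<close>

lemma subring_hom_finsum:
  assumes "\<theta> \<in> ring_hom (R\<lparr>carrier := D\<rparr>) (R\<lparr>carrier := F\<rparr>)" "subring D R" "subring F R"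
    and "finite A" "\<And>x. x \<in> A \<Longrightarrow> f x \<in> D"
  shows "\<theta> (\<Oplus>x\<in>A. f x) = (\<Oplus>x\<in>A. \<theta> (f x)) \<and> (\<Oplus>x\<in>A. f x) \<in> D"
  using assms(4,5)
proof (induction A rule: finite_induct)
  case empty
  then show ?case using subring_hom_zero[OF assms(1-3)] subringE(2)[OF assms(2)] by simp
next
  case (insert a A)
  have [simp]: "f \<in> A \<rightarrow> carrier R" "f a \<in> carrier R" "\<theta> (f a) \<in> carrier R"
    "(\<lambda>x. \<theta> (f x)) \<in> A \<rightarrow> carrier R"
    using insert.prems subringE(1)[OF assms(2)] subringE(1)[OF assms(3)] subring_homD(1)[OF assms(1)]
    by auto
  show ?case
    using insert subring_homD(3)[OF assms(1)] subringE(7)[OF assms(2)]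
    by simp
qed

end

section \<open>Independence of finitely many homomorphisms\<close>

context field begin

text \<open>A constructive form of Dedekind independence, by induction on \<open>S\<close>. A list
  defines a functional sending \<open>\<phi>\<close> to \<open>\<Sum> c \<phi>(m)\<close>. To kill
  one more \<open>\<theta>\<close>, multiply the functional by the factor
  \<open>\<phi>(z) - \<theta>(z)\<close>, where \<open>z\<close> distinguishes
  \<open>\<theta>\<close> from \<open>\<rho>\<close>; zeros already obtained remain zeros.\<close>

lemma separating_combination:
  assumes "finite S" "subring D R" "subfield F R"
    and "\<rho> \<in> ring_hom (R\<lparr>carrier := D\<rparr>) (R\<lparr>carrier := F\<rparr>)"
    and "\<And>\<theta>. \<theta> \<in> S \<Longrightarrow> \<theta> \<in> ring_hom (R\<lparr>carrier := D\<rparr>) (R\<lparr>carrier := F\<rparr>)"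
    and "\<And>\<theta>. \<theta> \<in> S \<Longrightarrow> \<exists>x\<in>D. \<theta> x \<noteq> \<rho> x"
  shows "\<exists>xs. set xs \<subseteq> F \<times> D \<and> list_sum R (\<lambda>(c, m). c \<otimes> \<rho> m) xs = \<one> \<and>
              (\<forall>\<theta>\<in>S. list_sum R (\<lambda>(c, m). c \<otimes> \<theta> m) xs = \<zero>)"
  using assms(1,5,6)
proof (induction S rule: finite_induct)
  note F = subfieldE(1)[OF assms(3)] subfieldE(3)[OF assms(3)]
  case empty
  have "set [(\<one>, \<one>)] \<subseteq> F \<times> D \<and> list_sum R (\<lambda>(c, m). c \<otimes> \<rho> m) [(\<one>, \<one>)] = \<one>"
    using subringE(3)[OF F(1)] subringE(3)[OF assms(2)] subring_homD(4)[OF assms(4)] by simp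
  then show ?case by blast
next
  note Fs = subfieldE(1)[OF assms(3)] and Fc = subfieldE(3)[OF assms(3)]
  case (insert \<theta> S)
  note hom\<theta> = insert.prems(1)[of \<theta>, simplified]
  obtain xs where xs: "set xs \<subseteq> F \<times> D" "list_sum R (\<lambda>(c, m). c \<otimes> \<rho> m) xs = \<one>"
    "\<forall>\<theta>\<in>S. list_sum R (\<lambda>(c, m). c \<otimes> \<theta> m) xs = \<zero>"
    using insert by blast
  obtain z where z: "z \<in> D" "\<theta> z \<noteq> \<rho> z" using insert.prems(2) by blast
  have zF: "\<theta> z \<in> F" "\<rho> z \<in> F"
    using z(1) subring_homD(1)[OF hom\<theta>] subring_homD(1)[OF assms(4)] by auto
  \<comment> \<open>This scalar makes the new factor equal to 1 at \<open>\<rho>\<close>, so the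
    normalization survives.\<close>
  define a where "a = inv (\<rho> z \<ominus> \<theta> z)"
  have diffF: "\<rho> z \<ominus> \<theta> z \<in> F"
    using zF subringE(5,7)[OF Fs] by (simp add: minus_eq)
  have diff0: "\<rho> z \<ominus> \<theta> z \<noteq> \<zero>"
    using z(2) zF Fc by (metis r_right_minus_eq subsetD)
  have aF: "a \<in> F" and a1: "a \<otimes> (\<rho> z \<ominus> \<theta> z) = \<one>"
    using subfield_m_inv[OF assms(3), of "\<rho> z \<ominus> \<theta> z"] diffF diff0 unfolding a_def by auto
  \<comment> \<open>Since \<open>\<phi>(z) \<phi>(m) = \<phi>(z m)\<close>, multiplying by
    \<open>a (\<phi>(z) - \<theta>(z))\<close> is again given by a list: one copy with
    \<open>m\<close> replaced by \<open>z m\<close>, one copy scaled by the constant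
    \<open>- a \<theta>(z)\<close>.\<close>
  define ys where "ys = map (\<lambda>(c, m). (a \<otimes> c, z \<otimes> m)) xs @ map (\<lambda>(c, m). (\<ominus> (a \<otimes> \<theta> z) \<otimes> c, m)) xs"
  have ys: "set ys \<subseteq> F \<times> D"
    using xs(1) aF zF z(1) subringE(5,6)[OF Fs] subringE(6)[OF assms(2)]
    unfolding ys_def by (auto split: prod.splits)
  have eq: "list_sum R (\<lambda>(c, m). c \<otimes> \<phi> m) ys
      = a \<otimes> (\<phi> z \<ominus> \<theta> z) \<otimes> list_sum R (\<lambda>(c, m). c \<otimes> \<phi> m) xs"
    if "\<phi> \<in> ring_hom (R\<lparr>carrier := D\<rparr>) (R\<lparr>carrier := F\<rparr>)" for \<phi>
  proof -
    note hom = subring_homD[OF that]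
    have cl: "c \<in> carrier R" "\<phi> m \<in> carrier R" "m \<in> D" if "(c, m) \<in> set xs" for c m
      using that xs(1) Fc hom(1) by auto
    have cl': "a \<in> carrier R" "\<theta> z \<in> carrier R" "\<phi> z \<in> carrier R"
      using aF zF z(1) Fc hom(1) by auto
    have "list_sum R (\<lambda>(c, m). c \<otimes> \<phi> m) ys
        = list_sum R (\<lambda>(c, m). a \<otimes> c \<otimes> \<phi> (z \<otimes> m)) xs \<oplus>
          list_sum R (\<lambda>(c, m). \<ominus> (a \<otimes> \<theta> z) \<otimes> c \<otimes> \<phi> m) xs"
      unfolding ys_def using cl cl' hom z(1)
      by (subst list_sum_append) (auto simp: case_prod_unfold split: prod.splits)
    also have "\<dots> = list_sum R (\<lambda>(c, m). a \<otimes> (\<phi> z \<ominus> \<theta> z) \<otimes> (c \<otimes> \<phi> m)) xs"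
    proof -
      have "a \<otimes> (\<phi> z \<ominus> \<theta> z) \<otimes> (c \<otimes> \<phi> m) = a \<otimes> c \<otimes> \<phi> (z \<otimes> m) \<oplus> \<ominus> (a \<otimes> \<theta> z) \<otimes> c \<otimes> \<phi> m"
        if "(c, m) \<in> set xs" for c m
      proof -
        have "\<phi> (z \<otimes> m) = \<phi> z \<otimes> \<phi> m" using hom(2) z(1) cl(3)[OF that] by simp
        then show ?thesis using cl[OF that] cl' by algebra
      qed
      then have "list_sum R (\<lambda>(c, m). a \<otimes> (\<phi> z \<ominus> \<theta> z) \<otimes> (c \<otimes> \<phi> m)) xs =
          list_sum R (\<lambda>p. (case p of (c, m) \<Rightarrow> a \<otimes> c \<otimes> \<phi> (z \<otimes> m)) \<oplus>
                          (case p of (c, m) \<Rightarrow> \<ominus> (a \<otimes> \<theta> z) \<otimes> c \<otimes> \<phi> m)) xs"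
        by (intro list_sum_cong) auto
      also have "\<dots> = list_sum R (\<lambda>(c, m). a \<otimes> c \<otimes> \<phi> (z \<otimes> m)) xs \<oplus>
          list_sum R (\<lambda>(c, m). \<ominus> (a \<otimes> \<theta> z) \<otimes> c \<otimes> \<phi> m) xs"
        using cl cl' hom z(1) by (intro list_sum_add) auto
      finally show ?thesis by simp
    qed
    also have "\<dots> = a \<otimes> (\<phi> z \<ominus> \<theta> z) \<otimes> list_sum R (\<lambda>(c, m). c \<otimes> \<phi> m) xs"
      using cl cl' by (subst list_sum_rdistr) (auto simp: case_prod_unfold)
    finally show ?thesis .
  qed
  have "list_sum R (\<lambda>(c, m). c \<otimes> \<rho> m) ys = \<one>"
    using eq[OF assms(4)] xs(2) a1 by simp
  moreover have "list_sum R (\<lambda>(c, m). c \<otimes> \<tau> m) ys = \<zero>" if "\<tau> \<in> insert \<theta> S" for \<tau>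
  proof -
    have hom: "\<tau> \<in> ring_hom (R\<lparr>carrier := D\<rparr>) (R\<lparr>carrier := F\<rparr>)" using insert.prems(1) that .
    have cl: "a \<in> carrier R" "\<theta> z \<in> carrier R" "\<tau> z \<in> carrier R"
      using aF zF z(1) Fc subring_homD(1)[OF hom] by auto
    have "list_sum R (\<lambda>(c, m). c \<otimes> \<tau> m) xs \<in> carrier R"
      using xs(1) subring_homD(1)[OF hom] Fc by (intro list_sum_closed) auto
    moreover have "a \<otimes> (\<theta> z \<ominus> \<theta> z) = \<zero>"
      using cl by (simp add: r_right_minus_eq[THEN iffD2])
    ultimately show ?thesis
      using eq[OF hom] that xs(3) cl by (cases "\<tau> = \<theta>") (simp_all del: r_right_minus_eq)
  qed
  ultimately show ?case using ys by blast
qed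

end

section \<open>Groups of automorphisms\<close>

lemma galois_group_iff:
  "\<theta> \<in> carrier (galois_group R K F) \<longleftrightarrow>
     \<theta> \<in> extensional F \<and> bij_betw \<theta> F F \<and>
     \<theta> \<in> ring_hom (R\<lparr>carrier := F\<rparr>) (R\<lparr>carrier := F\<rparr>) \<and> (\<forall>x\<in>K. \<theta> x = x)"
  by (auto simp: galois_group_def Bij_def)

lemma galois_group_mult:
  assumes "\<theta> \<in> carrier (galois_group R K F)" "\<tau> \<in> carrier (galois_group R K F)"
  shows "\<theta> \<otimes>\<^bsub>galois_group R K F\<^esub> \<tau> = compose F \<theta> \<tau>"
  using assms by (simp add: galois_group_def BijGroup_def)

lemma galois_group_one: "\<one>\<^bsub>galois_group R K F\<^esub> = (\<lambda>x\<in>F. x)"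
  by (simp add: galois_group_def BijGroup_def)

lemma galois_group_ext:
  assumes "\<theta> \<in> carrier (galois_group R K F)" "\<tau> \<in> carrier (galois_group R K F)"
    and "\<And>x. x \<in> F \<Longrightarrow> \<theta> x = \<tau> x"
  shows "\<theta> = \<tau>"
  using assms by (auto simp: galois_group_iff intro: extensionalityI)

lemma galois_groupD:
  assumes "\<theta> \<in> carrier (galois_group R K F)"
  shows "x \<in> F \<Longrightarrow> \<theta> x \<in> F"
    and "x \<in> F \<Longrightarrow> y \<in> F \<Longrightarrow> \<theta> (x \<otimes>\<^bsub>R\<^esub> y) = \<theta> x \<otimes>\<^bsub>R\<^esub> \<theta> y"
    and "x \<in> F \<Longrightarrow> y \<in> F \<Longrightarrow> \<theta> (x \<oplus>\<^bsub>R\<^esub> y) = \<theta> x \<oplus>\<^bsub>R\<^esub> \<theta> y"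
    and "\<theta> \<one>\<^bsub>R\<^esub> = \<one>\<^bsub>R\<^esub>"
    and "x \<in> K \<Longrightarrow> \<theta> x = x"
    and "\<theta> \<in> ring_hom (R\<lparr>carrier := F\<rparr>) (R\<lparr>carrier := F\<rparr>)"
    and "\<theta> ` F = F" and "inj_on \<theta> F"
  using assms subring_homD[where \<theta> = \<theta> and R = R and D = F and F = F] unfolding galois_group_iff bij_betw_def by auto

lemma fixed_fieldI: "x \<in> F \<Longrightarrow> (\<And>\<theta>. \<theta> \<in> G \<Longrightarrow> \<theta> x = x) \<Longrightarrow> x \<in> fixed_field F G"
  unfolding fixed_field_def by blast

lemma fixed_fieldD: "x \<in> fixed_field F G \<Longrightarrow> x \<in> F" "x \<in> fixed_field F G \<Longrightarrow> \<theta> \<in> G \<Longrightarrow> \<theta> x = x"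
  unfolding fixed_field_def by blast+

lemma galois_group_anti_mono:
  "K \<subseteq> K' \<Longrightarrow> carrier (galois_group R K' F) \<subseteq> carrier (galois_group R K F)"
  unfolding subset_iff galois_group_iff by blast

context field begin

text \<open>Embedding into \<open>BijGroup F\<close> supplies the group axioms; only closure under
  composition and inversion of the homomorphism and fixing conditions is left to check.\<close>

lemma galois_group_subgroup:
  assumes "subring F R" "K \<subseteq> F"
  shows "subgroup (carrier (galois_group R K F)) (BijGroup F)"
proof -
  interpret B: group "BijGroup F" by (rule group_BijGroup)
  note F = subringE[OF assms(1)]
  show ?thesis
  proof (rule B.subgroupI)
    show "carrier (galois_group R K F) \<subseteq> carrier (BijGroup F)"
      by (auto simp: galois_group_def BijGroup_def)
    have "(\<lambda>x\<in>F. x) \<in> carrier (galois_group R K F)"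
      using assms(2) F id_Bij[of F] unfolding galois_group_def
      by (auto intro!: subring_homI)
    then show "carrier (galois_group R K F) \<noteq> {}" by auto
  next
    fix \<theta> assume \<theta>: "\<theta> \<in> carrier (galois_group R K F)"
    then have Bij: "\<theta> \<in> Bij F" by (simp add: galois_group_def)
    note h = galois_groupD[OF \<theta>]
    have inv: "inv\<^bsub>BijGroup F\<^esub> \<theta> = (\<lambda>x\<in>F. inv_into F \<theta> x)"
      using inv_BijGroup[OF Bij] .
    have 1: "(\<lambda>x\<in>F. inv_into F \<theta> x) \<in> Bij F" using restrict_inv_into_Bij[OF Bij] .
    have fix_id: "inv_into F \<theta> x = x" if "x \<in> F" "\<theta> x = x" for x
      using that h(8) by (metis inv_into_f_f)
    have "(\<lambda>x\<in>F. inv_into F \<theta> x) \<in> ring_hom (R\<lparr>carrier := F\<rparr>) (R\<lparr>carrier := F\<rparr>)"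
    proof (rule subring_homI)
      fix x y assume xy: "x \<in> F" "y \<in> F"
      then show "(\<lambda>x\<in>F. inv_into F \<theta> x) (x \<otimes> y)
          = (\<lambda>x\<in>F. inv_into F \<theta> x) x \<otimes> (\<lambda>x\<in>F. inv_into F \<theta> x) y"
        using F(6) Bij_inv_into_lemma[where g = "(\<otimes>)", OF h(2) Bij _ xy] by (simp add: Pi_def)
      show "(\<lambda>x\<in>F. inv_into F \<theta> x) (x \<oplus> y)
          = (\<lambda>x\<in>F. inv_into F \<theta> x) x \<oplus> (\<lambda>x\<in>F. inv_into F \<theta> x) y"
        using xy F(7) Bij_inv_into_lemma[where g = "(\<oplus>)", OF h(3) Bij _ xy] by (simp add: Pi_def)
    next
      show "(\<lambda>x\<in>F. inv_into F \<theta> x) \<one> = \<one>" using fix_id h(4) F(3) by simp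
    next
      fix x assume "x \<in> F" then show "(\<lambda>x\<in>F. inv_into F \<theta> x) x \<in> F"
        using Bij_inv_into_mem[OF Bij] by simp
    qed
    moreover have "\<forall>x\<in>K. (\<lambda>x\<in>F. inv_into F \<theta> x) x = x" using fix_id h(5) assms(2) by auto
    ultimately show "inv\<^bsub>BijGroup F\<^esub> \<theta> \<in> carrier (galois_group R K F)"
      unfolding inv using 1 by (simp add: galois_group_def)
  next
    fix \<theta> \<tau> assume \<theta>: "\<theta> \<in> carrier (galois_group R K F)" and \<tau>: "\<tau> \<in> carrier (galois_group R K F)"
    note h = galois_groupD[OF \<theta>] galois_groupD[OF \<tau>]
    have eq: "\<theta> \<otimes>\<^bsub>BijGroup F\<^esub> \<tau> = compose F \<theta> \<tau>"
      using \<theta> \<tau> by (simp add: galois_group_def BijGroup_def)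
    have Bij: "compose F \<theta> \<tau> \<in> Bij F"
      using \<theta> \<tau> by (simp add: galois_group_def compose_Bij)
    have "compose F \<theta> \<tau> \<in> ring_hom (R\<lparr>carrier := F\<rparr>) (R\<lparr>carrier := F\<rparr>)"
      using h F by (intro subring_homI) (auto simp: compose_def)
    moreover have "\<forall>x\<in>K. compose F \<theta> \<tau> x = x"
      using h(5,13) assms(2) by (auto simp: compose_def)
    ultimately show "\<theta> \<otimes>\<^bsub>BijGroup F\<^esub> \<tau> \<in> carrier (galois_group R K F)"
      using Bij unfolding eq by (simp add: galois_group_def)
  qed
qed

lemma group_galois_group:
  assumes "subring F R" "K \<subseteq> F"
  shows "group (galois_group R K F)"
proof -
  have "galois_group R K F = (BijGroup F)\<lparr>carrier := carrier (galois_group R K F)\<rparr>"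
    by (simp add: galois_group_def)
  then show ?thesis
    using subgroup.subgroup_is_group[OF galois_group_subgroup[OF assms] group_BijGroup] by metis
qed

lemma galois_group_inv_apply:
  assumes "subring F R" "K \<subseteq> F" "\<theta> \<in> carrier (galois_group R K F)" "x \<in> F"
  shows "\<theta> ((inv\<^bsub>galois_group R K F\<^esub> \<theta>) x) = x" "(inv\<^bsub>galois_group R K F\<^esub> \<theta>) (\<theta> x) = x"
proof -
  interpret G: group "galois_group R K F" using group_galois_group[OF assms(1,2)] .
  have i: "inv\<^bsub>galois_group R K F\<^esub> \<theta> \<in> carrier (galois_group R K F)" using assms(3) by simp
  show "\<theta> ((inv\<^bsub>galois_group R K F\<^esub> \<theta>) x) = x"
    using fun_cong[OF G.r_inv[OF assms(3)], of x] galois_group_mult[OF assms(3) i] assms(4)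
    by (simp add: galois_group_one compose_def)
  show "(inv\<^bsub>galois_group R K F\<^esub> \<theta>) (\<theta> x) = x"
    using fun_cong[OF G.l_inv[OF assms(3)], of x] galois_group_mult[OF i assms(3)] assms(4)
    by (simp add: galois_group_one compose_def)
qed

lemma hom_subfield_inv:
  assumes "\<theta> \<in> ring_hom (R\<lparr>carrier := D\<rparr>) (R\<lparr>carrier := F\<rparr>)" "subfield D R" "subfield F R"
    and "x \<in> D" "x \<noteq> \<zero>"
  shows "\<theta> x \<noteq> \<zero>" "\<theta> (inv x) = inv (\<theta> x)"
proof -
  note D = subfieldE[OF assms(2)] and F = subfieldE[OF assms(3)]
  note h = subring_homD[OF assms(1)]
  have i: "inv x \<in> D" "x \<otimes> inv x = \<one>" using subfield_m_inv[OF assms(2), of x] assms(4,5) by auto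
  have eq: "\<theta> x \<otimes> \<theta> (inv x) = \<one>" using h(2)[OF assms(4) i(1)] h(4) i(2) by simp
  have c: "\<theta> x \<in> carrier R" "\<theta> (inv x) \<in> carrier R" using h(1) assms(4) i(1) F(3) by auto
  show "\<theta> x \<noteq> \<zero>" using eq c by auto
  show "\<theta> (inv x) = inv (\<theta> x)" using eq c comm_inv_char by metis
qed

lemma fixed_field_subfield:
  assumes "subfield F R" "\<And>\<theta>. \<theta> \<in> G \<Longrightarrow> \<theta> \<in> ring_hom (R\<lparr>carrier := F\<rparr>) (R\<lparr>carrier := F\<rparr>)"
  shows "subfield (fixed_field F G) R"
proof (rule subfieldI')
  note F = subfieldE[OF assms(1)] and Fr = subringE[OF subfieldE(1)[OF assms(1)]]
  note h = subring_homD[OF assms(2)]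
  show "subring (fixed_field F G) R"
  proof (rule subringI)
    fix x assume x: "x \<in> fixed_field F G"
    have "\<theta> (\<ominus> x) = \<ominus> x" if t: "\<theta> \<in> G" for \<theta>
    proof -
      interpret h: ring_hom_ring "R\<lparr>carrier := F\<rparr>" "R\<lparr>carrier := F\<rparr>" \<theta>
        using subring_hom_ring[OF assms(2)[OF t] F(1) F(1)] .
      have xF: "x \<in> F" "\<theta> x = x" using x t by (auto simp: fixed_field_def)
      have "\<theta> (\<ominus> x) \<oplus> x = \<theta> (\<ominus> x \<oplus> x)"
        using h(3)[OF t, of "\<ominus> x" x] xF Fr(5) by simp
      also have "\<dots> = \<zero>" using xF F(3) subring_hom_zero[OF assms(2)[OF t] F(1) F(1)]
        by (simp add: l_neg subsetD)
      finally show ?thesis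
        using xF Fr(1,5) h(1)[OF t] by (metis (no_types, lifting) minus_equality subsetD)
    qed
    then show "\<ominus> x \<in> fixed_field F G" using x Fr(5) by (auto simp: fixed_field_def)
  next
    fix x y assume xy: "x \<in> fixed_field F G" "y \<in> fixed_field F G"
    have "\<theta> (x \<otimes> y) = x \<otimes> y \<and> \<theta> (x \<oplus> y) = x \<oplus> y" if "\<theta> \<in> G" for \<theta>
    proof -
      have "x \<in> F" "y \<in> F" "\<theta> x = x" "\<theta> y = y" using xy that unfolding fixed_field_def by blast+
      then show ?thesis using h(2,3)[OF that, of x y] by simp
    qed
    then show "x \<otimes> y \<in> fixed_field F G" "x \<oplus> y \<in> fixed_field F G"
      using xy Fr(6,7) by (auto simp: fixed_field_def)
  next
    show "\<one> \<in> fixed_field F G" using Fr(3) h(4) by (auto simp: fixed_field_def)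
    show "fixed_field F G \<subseteq> carrier R" using F(3) by (auto simp: fixed_field_def)
  qed
  fix x assume x: "x \<in> fixed_field F G - {\<zero>}"
  then have "x \<in> F - {\<zero>}" by (auto simp: fixed_field_def)
  then have xF: "x \<in> F" "x \<noteq> \<zero>" "inv x \<in> F" using subfield_m_inv[OF assms(1)] by auto
  have "\<theta> (inv x) = inv x" if t: "\<theta> \<in> G" for \<theta>
  proof -
    have "\<theta> x = x" using x t unfolding fixed_field_def by blast
    then show ?thesis
      using hom_subfield_inv(2)[OF assms(2)[OF t] assms(1) assms(1) xF(1,2)] by simp
  qed
  then show "inv x \<in> fixed_field F G" using xF(3) unfolding fixed_field_def by blast
qed

text \<open>Left multiplication by \<open>\<tau> \<in> H\<close> is an injective self-map of the
  finite set \<open>H\<close>, hence a permutation, so \<open>\<tau>\<close> only reorders the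
  summands.\<close>

lemma group_sum_fixed:
  assumes "subfield F R" "K \<subseteq> F" "subgroup H (galois_group R K F)" "finite H" "x \<in> F"
  shows "(\<Oplus>\<theta>\<in>H. \<theta> x) \<in> fixed_field F H"
proof -
  interpret G: group "galois_group R K F"
    using group_galois_group[OF subfieldE(1)[OF assms(1)] assms(2)] .
  note H = subgroup.mem_carrier[OF assms(3)]
  note F = subfieldE(1,3)[OF assms(1)]
  have HF: "\<theta> x \<in> F" if "\<theta> \<in> H" for \<theta> using galois_groupD(1)[OF H[OF that] assms(5)] .
  have "\<tau> (\<Oplus>\<theta>\<in>H. \<theta> x) = (\<Oplus>\<theta>\<in>H. \<theta> x)" if \<tau>: "\<tau> \<in> H" for \<tau>
  proof -
    let ?m = "\<lambda>\<theta>. \<tau> \<otimes>\<^bsub>galois_group R K F\<^esub> \<theta>"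
    have inj: "inj_on ?m H" using G.inj_on_cmult[OF H[OF \<tau>]] H by (meson inj_on_subset subsetI)
    have im: "?m ` H = H"
      using inj assms(4) \<tau> subgroup.m_closed[OF assms(3)]
      by (metis (no_types, lifting) card_image card_subset_eq image_subsetI)
    have "\<tau> (\<Oplus>\<theta>\<in>H. \<theta> x) = (\<Oplus>\<theta>\<in>H. \<tau> (\<theta> x))"
      using subring_hom_finsum[OF galois_groupD(6)[OF H[OF \<tau>]] F(1) F(1) assms(4)] HF by auto
    also have "\<dots> = (\<Oplus>\<theta>\<in>H. ?m \<theta> x)"
    proof (rule finsum_cong'[OF refl])
      have m: "?m \<theta> x = \<tau> (\<theta> x)" if "\<theta> \<in> H" for \<theta>
        using galois_group_mult[OF H[OF \<tau>] H[OF that]] assms(5) by (simp add: compose_def)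
      then show "\<tau> (\<theta> x) = ?m \<theta> x" if "\<theta> \<in> H" for \<theta> using that by simp
      show "(\<lambda>\<theta>. ?m \<theta> x) \<in> H \<rightarrow> carrier R"
        using m HF galois_groupD(1)[OF H[OF \<tau>]] F(2) by auto
    qed
    also have "\<dots> = (\<Oplus>\<theta>\<in>?m ` H. \<theta> x)"
      by (rule finsum_reindex[symmetric]) (use inj im HF F(2) in auto)
    finally show ?thesis using im by simp
  qed
  moreover have "(\<Oplus>\<theta>\<in>H. \<theta> x) \<in> F"
    using subring_hom_finsum[OF galois_groupD(6)[OF G.one_closed] F(1) F(1) assms(4)] HF by auto
  ultimately show ?thesis by (auto simp: fixed_field_def)
qed

end

section \<open>Finite groups of automorphisms\<close>

text \<open>Artin's setting: a finite group given together with its fixed field. That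
  \<open>G\<close> is then the whole Galois group is a consequence
  (\<open>group_eq_galois_group\<close>), so the locale can also be entered with a subgroup and its
  fixed field.\<close>

locale finite_galois = field R for R (structure) +
  fixes K F :: "'a set" and G :: "('a \<Rightarrow> 'a) set"
  assumes F: "subfield F R" and KF: "K \<subseteq> F"
    and G: "subgroup G (galois_group R K F)" and fin: "finite G"
    and fixed: "fixed_field F G = K"
begin

lemma F_ring: "subring F R" and F_carrier: "F \<subseteq> carrier R"
  using subfieldE(1,3)[OF F] .

lemma G_mem: "\<theta> \<in> G \<Longrightarrow> \<theta> \<in> carrier (galois_group R K F)"
  using subgroup.mem_carrier[OF G] .

lemma G_hom: "\<theta> \<in> G \<Longrightarrow> \<theta> \<in> ring_hom (R\<lparr>carrier := F\<rparr>) (R\<lparr>carrier := F\<rparr>)"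
  using galois_groupD(6)[OF G_mem] .

lemma G_closed: "\<theta> \<in> G \<Longrightarrow> x \<in> F \<Longrightarrow> \<theta> x \<in> F"
  using galois_groupD(1)[OF G_mem] .

lemma G_carrier: "\<theta> \<in> G \<Longrightarrow> x \<in> F \<Longrightarrow> \<theta> x \<in> carrier R"
  using G_closed F_carrier by blast

lemma id_in_G: "(\<lambda>x\<in>F. x) \<in> G"
  using subgroup.one_closed[OF G] by (simp add: galois_group_one)

lemma K_subfield: "subfield K R"
  using fixed_field_subfield[OF F G_hom, of G] fixed by simp

sublocale Gal: group "galois_group R K F"
  using group_galois_group[OF F_ring KF] .

section \<open>Traces and dual generators\<close>

definition trace :: "'a \<Rightarrow> 'a" where
  "trace x = (\<Oplus>\<theta>\<in>G. \<theta> x)"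

lemma trace_in_K: "x \<in> F \<Longrightarrow> trace x \<in> K"
  using group_sum_fixed[OF F KF G fin] fixed by (simp add: trace_def)

lemma G_mult:
  assumes "\<theta> \<in> G" "a \<in> F" "x \<in> F"
  shows "\<theta> (a \<otimes> x) = \<theta> a \<otimes> \<theta> x"
  using galois_groupD(2)[OF G_mem] assms by blast

text \<open>Exchanging sums turns the left side into
  \<open>\<Sum> \<theta>(a) (\<Sum> \<theta>(x) l)\<close> over \<open>\<theta> \<in> G\<close>,
  where every inner sum vanishes. The \<open>l\<close> may lie outside \<open>F\<close>, which
  allows coefficients from an arbitrary overfield.\<close>

lemma list_sum_trace:
  assumes "a \<in> F" "\<And>x l. (x, l) \<in> set xs \<Longrightarrow> x \<in> F \<and> l \<in> carrier R"
    and "\<And>\<theta>. \<theta> \<in> G \<Longrightarrow> list_sum R (\<lambda>(x, l). \<theta> x \<otimes> l) xs = \<zero>"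
  shows "list_sum R (\<lambda>(x, l). trace (a \<otimes> x) \<otimes> l) xs = \<zero>"
proof -
  have cl: "\<theta> a \<in> carrier R" "\<theta> x \<in> carrier R" "l \<in> carrier R" "x \<in> F"
    if "\<theta> \<in> G" "(x, l) \<in> set xs" for \<theta> x l
    using that assms(1,2) G_carrier by auto
  have "list_sum R (\<lambda>(x, l). trace (a \<otimes> x) \<otimes> l) xs
      = list_sum R (\<lambda>p. \<Oplus>\<theta>\<in>G. \<theta> a \<otimes> (\<theta> (fst p) \<otimes> snd p)) xs"
  proof (rule list_sum_cong, clarify)
    fix x l assume p: "(x, l) \<in> set xs"
    have "trace (a \<otimes> x) \<otimes> l = (\<Oplus>\<theta>\<in>G. \<theta> a \<otimes> \<theta> x) \<otimes> l"
      unfolding trace_def using p cl assms(1) G_mult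
      by (intro arg_cong2[where f = "(\<otimes>)"] finsum_cong') auto
    also have "\<dots> = (\<Oplus>\<theta>\<in>G. \<theta> a \<otimes> \<theta> x \<otimes> l)"
      using fin cl p assms(2) by (intro finsum_ldistr) auto
    also have "\<dots> = (\<Oplus>\<theta>\<in>G. \<theta> a \<otimes> (\<theta> x \<otimes> l))"
      using cl p by (intro finsum_cong') (auto simp: m_assoc)
    finally show "trace (a \<otimes> x) \<otimes> l = (\<Oplus>\<theta>\<in>G. \<theta> a \<otimes> (\<theta> (fst (x, l)) \<otimes> snd (x, l)))" by simp
  qed
  also have "\<dots> = (\<Oplus>\<theta>\<in>G. list_sum R (\<lambda>p. \<theta> a \<otimes> (\<theta> (fst p) \<otimes> snd p)) xs)"
    using cl by (intro list_sum_finsum) auto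
  also have "\<dots> = (\<Oplus>\<theta>\<in>G. \<zero>)"
  proof (intro finsum_cong' refl)
    fix \<theta> assume t: "\<theta> \<in> G"
    have "list_sum R (\<lambda>p. \<theta> a \<otimes> (\<theta> (fst p) \<otimes> snd p)) xs
        = \<theta> a \<otimes> list_sum R (\<lambda>p. \<theta> (fst p) \<otimes> snd p) xs"
      using cl[OF t] G_carrier[OF t assms(1)] by (intro list_sum_rdistr[symmetric]) auto
    then show "list_sum R (\<lambda>p. \<theta> a \<otimes> (\<theta> (fst p) \<otimes> snd p)) xs = \<zero>"
      using assms(3)[OF t] G_carrier[OF t assms(1)] by (simp add: case_prod_unfold)
  qed auto
  finally show ?thesis by simp
qed

text \<open>Independence shows that the \<open>H\<close>-trace is not identically zero, in any
  characteristic: for the list separating the identity from the rest of \<open>G\<close>, summing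
  \<open>c \<theta>(m)\<close> over the list and over \<open>H\<close> gives 1, whereas vanishing
  traces would give 0. A nonzero trace is fixed by \<open>H\<close>, so dividing by it inside the
  argument normalizes it to 1.\<close>

lemma trace_one_element:
  assumes "subgroup H (galois_group R K F)" "H \<subseteq> G"
  shows "\<exists>z\<in>F. (\<Oplus>\<theta>\<in>H. \<theta> z) = \<one>"
proof -
  let ?id = "\<lambda>x\<in>F. x"
  have finH: "finite H" using assms(2) fin finite_subset by blast
  have idH: "?id \<in> H" using subgroup.one_closed[OF assms(1)] by (simp add: galois_group_one)
  have H: "\<theta> \<in> G" if "\<theta> \<in> H" for \<theta> using assms(2) that by blast
  have ex: "\<exists>x\<in>F. \<theta> x \<noteq> ?id x" if "\<theta> \<in> G - {?id}" for \<theta>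
    using that galois_group_ext[OF G_mem G_mem[OF id_in_G], of \<theta>] by blast
  obtain xs where xs: "set xs \<subseteq> F \<times> F" "list_sum R (\<lambda>(c, m). c \<otimes> ?id m) xs = \<one>"
    "\<forall>\<theta>\<in>G - {?id}. list_sum R (\<lambda>(c, m). c \<otimes> \<theta> m) xs = \<zero>"
    using separating_combination[OF _ F_ring F G_hom[OF id_in_G], of "G - {?id}"] fin G_hom ex
    by auto
  let ?T = "\<lambda>m. \<Oplus>\<theta>\<in>H. \<theta> m"
  have TF: "?T m \<in> fixed_field F H" if "m \<in> F" for m
    using group_sum_fixed[OF F KF assms(1) finH that] .
  have "\<exists>m\<in>F. ?T m \<noteq> \<zero>"
  proof (rule ccontr)
    assume "\<not> (\<exists>m\<in>F. ?T m \<noteq> \<zero>)"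
    then have T0: "?T m = \<zero>" if "m \<in> F" for m using that by blast
    have cl: "c \<in> carrier R" "\<theta> m \<in> carrier R" "m \<in> F" if "(c, m) \<in> set xs" "\<theta> \<in> H" for c m \<theta>
      using that xs(1) F_carrier G_carrier[OF H] by auto
    have "\<zero> = list_sum R (\<lambda>p. fst p \<otimes> ?T (snd p)) xs"
    proof -
      have "list_sum R (\<lambda>p. fst p \<otimes> ?T (snd p)) xs = list_sum R (\<lambda>p. \<zero>) xs"
      proof (rule list_sum_cong)
        fix p assume "p \<in> set xs"
        then have "p \<in> F \<times> F" using xs(1) by blast
        then have "fst p \<in> carrier R" "snd p \<in> F" using F_carrier by auto
        then show "fst p \<otimes> ?T (snd p) = \<zero>" using T0[of "snd p"] by simp
      qed
      then show ?thesis by simp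
    qed
    also have "\<dots> = list_sum R (\<lambda>p. \<Oplus>\<theta>\<in>H. fst p \<otimes> \<theta> (snd p)) xs"
      using cl idH finH by (intro list_sum_cong finsum_rdistr) auto
    also have "\<dots> = (\<Oplus>\<theta>\<in>H. list_sum R (\<lambda>p. fst p \<otimes> \<theta> (snd p)) xs)"
      using cl by (intro list_sum_finsum) auto
    also have "\<dots> = (\<Oplus>\<theta>\<in>H. if ?id = \<theta> then \<one> else \<zero>)"
      using xs(2,3) assms(2) by (intro finsum_cong') (auto simp: case_prod_unfold)
    also have "\<dots> = \<one>"
      using finsum_singleton[OF idH finH, of "\<lambda>_. \<one>"] by simp
    finally show False by simp
  qed
  then obtain m where m: "m \<in> F" "?T m \<noteq> \<zero>" by blast
  have t: "?T m \<in> F" "\<And>\<theta>. \<theta> \<in> H \<Longrightarrow> \<theta> (?T m) = ?T m"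
    using TF[OF m(1)] unfolding fixed_field_def by blast+
  have i: "inv (?T m) \<in> F" "?T m \<otimes> inv (?T m) = \<one>" using subfield_m_inv[OF F, of "?T m"] t m by auto
  have it: "\<theta> (inv (?T m)) = inv (?T m)" if "\<theta> \<in> H" for \<theta>
    using hom_subfield_inv(2)[OF G_hom[OF H[OF that]] F F t(1) m(2)] t(2)[OF that] by simp
  have "(\<Oplus>\<theta>\<in>H. \<theta> (m \<otimes> inv (?T m))) = (\<Oplus>\<theta>\<in>H. \<theta> m \<otimes> inv (?T m))"
  proof (intro finsum_cong' refl)
    show "\<theta> (m \<otimes> inv (?T m)) = \<theta> m \<otimes> inv (?T m)" if "\<theta> \<in> H" for \<theta>
      using G_mult[OF H[OF that] m(1) i(1)] it[OF that] by simp
  qed (use G_carrier[OF H m(1)] i(1) F_carrier in auto)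
  also have "\<dots> = ?T m \<otimes> inv (?T m)"
    using finsum_ldistr[OF finH, of "inv (?T m)" "\<lambda>\<theta>. \<theta> m"] i(1) F_carrier G_carrier[OF H m(1)] by auto
  finally show ?thesis using i m(1) subringE(6)[OF F_ring m(1) i(1)] by metis
qed

text \<open>A pair of dual bases, except that neither side need be linearly independent.\<close>

lemma dual_generators:
  assumes D: "subring D R" "D \<subseteq> F"
  shows "\<exists>xs. set xs \<subseteq> F \<times> D \<and>
    (\<forall>y\<in>F. (\<forall>\<theta>\<in>G. (\<forall>x\<in>D. \<theta> x = x) \<longrightarrow> \<theta> y = y) \<longrightarrow>
       y = list_sum R (\<lambda>(a, b). trace (a \<otimes> y) \<otimes> b) xs)"
proof -
  define H where "H = {\<theta> \<in> G. \<forall>x\<in>D. \<theta> x = x}"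
  have HG: "H \<subseteq> G" by (auto simp: H_def)
  have finH: "finite H" using HG fin finite_subset by blast
  let ?id = "\<lambda>x\<in>F. x"
  have "subgroup H (galois_group R K F)"
  proof (rule Gal.subgroupI)
    show "H \<subseteq> carrier (galois_group R K F)" using HG G_mem by blast
    have "?id \<in> H" using id_in_G D(2) by (auto simp: H_def)
    then show "H \<noteq> {}" by blast
  next
    fix \<theta> assume t: "\<theta> \<in> H"
    then have tG: "\<theta> \<in> G" using HG by blast
    have "(inv\<^bsub>galois_group R K F\<^esub> \<theta>) x = x" if "x \<in> D" for x
      using galois_group_inv_apply(2)[OF F_ring KF G_mem[OF tG], of x] t that D(2)
      by (auto simp: H_def)
    then show "inv\<^bsub>galois_group R K F\<^esub> \<theta> \<in> H"
      using subgroup.m_inv_closed[OF G tG] by (auto simp: H_def)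
  next
    fix \<theta> \<tau> assume t: "\<theta> \<in> H" "\<tau> \<in> H"
    then have tG: "\<theta> \<in> G" "\<tau> \<in> G" using HG by blast+
    have "(\<theta> \<otimes>\<^bsub>galois_group R K F\<^esub> \<tau>) x = x" if "x \<in> D" for x
      using that t D(2) unfolding galois_group_mult[OF tG[THEN G_mem]]
      by (auto simp: H_def compose_def)
    then show "\<theta> \<otimes>\<^bsub>galois_group R K F\<^esub> \<tau> \<in> H"
      using subgroup.m_closed[OF G tG] by (auto simp: H_def)
  qed
  then obtain z where z: "z \<in> F" "(\<Oplus>\<theta>\<in>H. \<theta> z) = \<one>" using trace_one_element HG by blast
  have homD: "\<theta> \<in> ring_hom (R\<lparr>carrier := D\<rparr>) (R\<lparr>carrier := F\<rparr>)" if "\<theta> \<in> G" for \<theta>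
    using subring_hom_mono[OF G_hom[OF that] D(2)] by blast
  have "\<exists>x\<in>D. \<theta> x \<noteq> ?id x" if "\<theta> \<in> G - H" for \<theta>
    using that D(2) by (auto simp: H_def)
  then obtain xs where xs: "set xs \<subseteq> F \<times> D" "list_sum R (\<lambda>(c, m). c \<otimes> ?id m) xs = \<one>"
    "\<forall>\<theta>\<in>G - H. list_sum R (\<lambda>(c, m). c \<otimes> \<theta> m) xs = \<zero>"
    using separating_combination[OF _ D(1) F homD[OF id_in_G], of "G - H"] fin homD by auto
  have cl: "c \<in> F" "m \<in> D" "m \<in> F" "\<theta> m \<in> carrier R" "m \<in> carrier R" "\<theta> c \<in> carrier R"
    if "(c, m) \<in> set xs" "\<theta> \<in> G" for c m \<theta>
    using that xs(1) D(2) G_carrier F_carrier by auto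
  have sum_if: "list_sum R (\<lambda>(c, m). c \<otimes> \<theta> m) xs = (if \<theta> \<in> H then \<one> else \<zero>)" if t: "\<theta> \<in> G" for \<theta>
  proof (cases "\<theta> \<in> H")
    case True
    have "list_sum R (\<lambda>(c, m). c \<otimes> \<theta> m) xs = list_sum R (\<lambda>(c, m). c \<otimes> ?id m) xs"
    proof (rule list_sum_cong)
      fix p assume "p \<in> set xs"
      then have "p \<in> F \<times> D" using xs(1) by blast
      then obtain c m where "p = (c, m)" "m \<in> D" "m \<in> F" using D(2) by blast
      then show "(case p of (c, m) \<Rightarrow> c \<otimes> \<theta> m) = (case p of (c, m) \<Rightarrow> c \<otimes> ?id m)"
        using True by (simp add: H_def)
    qed
    then show ?thesis using True xs(2) by simp
  qed (use xs(3) t in auto)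
  \<comment> \<open>The automorphism moves from \<open>m\<close> to \<open>c\<close>: apply
    \<open>\<theta>\<close> to the identity \<open>sum_if\<close> for the inverse of
    \<open>\<theta>\<close>, which lies in \<open>H\<close> exactly when \<open>\<theta>\<close>
    does.\<close>
  have sum_if': "list_sum R (\<lambda>(c, m). \<theta> c \<otimes> m) xs = (if \<theta> \<in> H then \<one> else \<zero>)" if t: "\<theta> \<in> G" for \<theta>
  proof -
    let ?i = "inv\<^bsub>galois_group R K F\<^esub> \<theta>"
    have i: "?i \<in> G" using subgroup.m_inv_closed[OF G t] .
    have iH: "?i \<in> H \<longleftrightarrow> \<theta> \<in> H"
    proof -
      have "(\<forall>x\<in>D. ?i x = x) \<longleftrightarrow> (\<forall>x\<in>D. \<theta> x = x)"
        using galois_group_inv_apply[OF F_ring KF G_mem[OF t]] D(2) by (metis subsetD)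
      then show ?thesis using i t by (simp add: H_def)
    qed
    have "list_sum R (\<lambda>(c, m). \<theta> c \<otimes> m) xs = list_sum R (\<lambda>p. \<theta> (case p of (c, m) \<Rightarrow> c \<otimes> ?i m)) xs"
    proof (rule list_sum_cong, clarify)
      fix c m assume p: "(c, m) \<in> set xs"
      show "\<theta> c \<otimes> m = \<theta> (c \<otimes> ?i m)"
        using G_mult[OF t, of c "?i m"] cl[OF p t] G_closed[OF i]
          galois_group_inv_apply(1)[OF F_ring KF G_mem[OF t], of m] by simp
    qed
    also have "\<dots> = \<theta> (list_sum R (\<lambda>(c, m). c \<otimes> ?i m) xs)"
      using subringE(6)[OF F_ring] cl(1,3)[OF _ t] G_closed[OF i]
      by (intro subring_hom_list_sum[OF G_hom[OF t] F_ring F_ring, symmetric]) auto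
    also have "\<dots> = (if \<theta> \<in> H then \<one> else \<zero>)"
      using sum_if[OF i] iH galois_groupD(4)[OF G_mem[OF t]] subring_hom_zero[OF G_hom[OF t] F_ring F_ring]
      by simp
    finally show ?thesis .
  qed
  \<comment> \<open>The factor \<open>z\<close> of \<open>H\<close>-trace 1 is absorbed into the
    first components. Expanding the traces gives
    \<open>\<Sum> \<theta>(z y) (\<Sum> \<theta>(c) m)\<close> over \<open>G\<close>; the inner sum
    is the indicator of \<open>H\<close>, and since \<open>H\<close> fixes \<open>y\<close>, what
    remains is the \<open>H\<close>-trace of \<open>z\<close> times \<open>y\<close>.\<close>
  define ys where "ys = map (\<lambda>(c, m). (c \<otimes> z, m)) xs"
  have "set ys \<subseteq> F \<times> D"
    using xs(1) z(1) subringE(6)[OF F_ring] by (auto simp: ys_def)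
  moreover have "y = list_sum R (\<lambda>(a, b). trace (a \<otimes> y) \<otimes> b) ys"
    if y: "y \<in> F" "\<And>\<theta>. \<theta> \<in> G \<Longrightarrow> (\<forall>x\<in>D. \<theta> x = x) \<Longrightarrow> \<theta> y = y" for y
  proof -
    have zy: "z \<otimes> y \<in> F" using z(1) y(1) subringE(6)[OF F_ring] by simp
    have "list_sum R (\<lambda>(a, b). trace (a \<otimes> y) \<otimes> b) ys
        = list_sum R (\<lambda>p. \<Oplus>\<theta>\<in>G. \<theta> (z \<otimes> y) \<otimes> (\<theta> (fst p) \<otimes> snd p)) xs"
      unfolding ys_def list_sum_map
    proof (rule list_sum_cong, clarsimp)
      fix c m assume p: "(c, m) \<in> set xs"
      note c = cl[OF p] and zyc = G_carrier[OF _ zy]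
      have "c \<otimes> z \<otimes> y = c \<otimes> (z \<otimes> y)"
        using c(1)[OF id_in_G] z(1) y(1) F_carrier by (intro m_assoc) auto
      then have "trace (c \<otimes> z \<otimes> y) \<otimes> m = (\<Oplus>\<theta>\<in>G. \<theta> c \<otimes> \<theta> (z \<otimes> y)) \<otimes> m"
        unfolding trace_def using G_mult[OF _ _ zy] c zyc
        by (intro arg_cong2[where f = "(\<otimes>)"] finsum_cong') auto
      also have "\<dots> = (\<Oplus>\<theta>\<in>G. \<theta> c \<otimes> \<theta> (z \<otimes> y) \<otimes> m)"
        using fin c zyc c(5)[OF id_in_G] by (intro finsum_ldistr) auto
      also have "\<dots> = (\<Oplus>\<theta>\<in>G. \<theta> (z \<otimes> y) \<otimes> (\<theta> c \<otimes> m))"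
        using c zyc by (intro finsum_cong') (auto simp: m_ac)
      finally show "trace (c \<otimes> z \<otimes> y) \<otimes> m = (\<Oplus>\<theta>\<in>G. \<theta> (z \<otimes> y) \<otimes> (\<theta> c \<otimes> m))" .
    qed
    also have "\<dots> = (\<Oplus>\<theta>\<in>G. list_sum R (\<lambda>p. \<theta> (z \<otimes> y) \<otimes> (\<theta> (fst p) \<otimes> snd p)) xs)"
      using cl G_carrier[OF _ zy] by (intro list_sum_finsum) auto
    also have "\<dots> = (\<Oplus>\<theta>\<in>G. if \<theta> \<in> H then \<theta> (z \<otimes> y) else \<zero>)"
    proof (intro finsum_cong' refl)
      fix \<theta> assume t: "\<theta> \<in> G"
      have "list_sum R (\<lambda>p. \<theta> (z \<otimes> y) \<otimes> (\<theta> (fst p) \<otimes> snd p)) xs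
          = \<theta> (z \<otimes> y) \<otimes> list_sum R (\<lambda>p. \<theta> (fst p) \<otimes> snd p) xs"
        using cl[OF _ t] G_carrier[OF t zy] by (intro list_sum_rdistr[symmetric]) auto
      then show "list_sum R (\<lambda>p. \<theta> (z \<otimes> y) \<otimes> (\<theta> (fst p) \<otimes> snd p)) xs
          = (if \<theta> \<in> H then \<theta> (z \<otimes> y) else \<zero>)"
        using sum_if'[OF t] G_carrier[OF t zy] by (simp add: case_prod_unfold)
    qed (use G_carrier[OF _ zy] in auto)
    also have "\<dots> = (\<Oplus>\<theta>\<in>H. \<theta> (z \<otimes> y))"
      using HG fin G_carrier[OF _ zy]
      by (intro add.finprod_mono_neutral_cong_right) auto
    also have "\<dots> = (\<Oplus>\<theta>\<in>H. \<theta> z \<otimes> y)"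
    proof (intro finsum_cong' refl)
      show "\<theta> (z \<otimes> y) = \<theta> z \<otimes> y" if t: "\<theta> \<in> H" for \<theta>
      proof -
        have "\<theta> \<in> G" "\<forall>x\<in>D. \<theta> x = x" using t unfolding H_def by blast+
        then show ?thesis using G_mult[OF _ z(1) y(1), of \<theta>] y(2)[of \<theta>] by simp
      qed
    qed (use HG y(1) G_carrier[OF _ z(1)] F_carrier in auto)
    also have "\<dots> = (\<Oplus>\<theta>\<in>H. \<theta> z) \<otimes> y"
      using finH HG y(1) G_carrier[OF _ z(1)] F_carrier by (intro finsum_ldistr[symmetric]) auto
    also have "\<dots> = y" using z(2) y(1) F_carrier by auto
    finally show ?thesis by simp
  qed
  ultimately show ?thesis by blast
qed

text \<open>An element of \<open>D\<close> is trivially fixed by every \<open>\<theta>\<close> that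
  fixes \<open>D\<close> pointwise, so the formula applies to it.\<close>

lemma dual_generators_subring:
  assumes D: "subring D R" "D \<subseteq> F"
  shows "\<exists>ys. set ys \<subseteq> F \<times> D \<and>
    (\<forall>y\<in>D. y = list_sum R (\<lambda>q. trace (fst q \<otimes> y) \<otimes> snd q) ys)"
proof -
  obtain ys where ys: "set ys \<subseteq> F \<times> D"
    "\<forall>y\<in>F. (\<forall>\<theta>\<in>G. (\<forall>x\<in>D. \<theta> x = x) \<longrightarrow> \<theta> y = y) \<longrightarrow>
       y = list_sum R (\<lambda>(a, b). trace (a \<otimes> y) \<otimes> b) ys"
    using dual_generators[OF D] by blast
  have "y = list_sum R (\<lambda>q. trace (fst q \<otimes> y) \<otimes> snd q) ys" if "y \<in> D" for y
  proof -
    have "y \<in> F" "\<forall>\<theta>\<in>G. (\<forall>x\<in>D. \<theta> x = x) \<longrightarrow> \<theta> y = y" using that D(2) by blast+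
    then show ?thesis using ys(2) unfolding case_prod_unfold by blast
  qed
  then show ?thesis using ys(1) by blast
qed

text \<open>If \<open>\<tau>\<close> differed from every element of \<open>G\<close>, separate it:
  \<open>\<Sum> c \<tau>(m) = 1\<close> but \<open>\<Sum> c \<theta>(m) = 0\<close> on
  \<open>G\<close>. Writing \<open>m = \<Sum> Tr(a m) b\<close> and using that \<open>\<tau>\<close>
  fixes the traces, the first sum becomes \<open>\<Sum> \<tau>(b) (\<Sum> Tr(a m) c)\<close> over
  the dual generators, which is 0 by \<open>list_sum_trace\<close>. In particular
  \<open>\<tau>\<close> has values in \<open>F\<close>; this replaces any appeal to
  normality.\<close>

lemma hom_extends_to_group:
  assumes D: "subring D R" "D \<subseteq> F" "K \<subseteq> D"
    and \<tau>: "\<tau> \<in> ring_hom (R\<lparr>carrier := D\<rparr>) R" "\<And>x. x \<in> K \<Longrightarrow> \<tau> x = x"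
  shows "\<exists>\<theta>\<in>G. \<forall>x\<in>D. \<theta> x = \<tau> x"
proof (rule ccontr)
  assume "\<not> (\<exists>\<theta>\<in>G. \<forall>x\<in>D. \<theta> x = \<tau> x)"
  then have ne: "\<exists>x\<in>D. \<theta> x \<noteq> \<tau> x" if "\<theta> \<in> G" for \<theta> using that by blast
  \<comment> \<open>Nothing yet confines the values of \<open>\<tau>\<close> to \<open>F\<close>, so
    all of \<open>R\<close> serves as the target field for the separation.\<close>
  have hom\<tau>: "\<tau> \<in> ring_hom (R\<lparr>carrier := D\<rparr>) (R\<lparr>carrier := carrier R\<rparr>)" using \<tau>(1) by simp
  note h = subring_homD[OF hom\<tau>]
  have "\<theta> \<in> ring_hom (R\<lparr>carrier := D\<rparr>) (R\<lparr>carrier := carrier R\<rparr>)" if "\<theta> \<in> G" for \<theta>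
    using subring_hom_mono[OF G_hom[OF that] D(2) F_carrier] .
  then obtain xs where xs: "set xs \<subseteq> carrier R \<times> D" "list_sum R (\<lambda>(c, m). c \<otimes> \<tau> m) xs = \<one>"
    "\<forall>\<theta>\<in>G. list_sum R (\<lambda>(c, m). c \<otimes> \<theta> m) xs = \<zero>"
    using separating_combination[OF fin D(1) carrier_is_subfield hom\<tau>] ne by blast
  obtain ys where ys: "set ys \<subseteq> F \<times> D"
    "\<forall>y\<in>D. y = list_sum R (\<lambda>q. trace (fst q \<otimes> y) \<otimes> snd q) ys"
    using dual_generators_subring[OF D(1,2)] by blast
  have xcl: "fst p \<in> carrier R" "snd p \<in> D" if "p \<in> set xs" for p
    using that xs(1) by (auto simp: mem_Times_iff dest!: subsetD)
  have ycl: "fst q \<in> F" "snd q \<in> D" "\<tau> (snd q) \<in> carrier R" if "q \<in> set ys" for q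
    using that ys(1) h(1)[of "snd q"] by (auto simp: mem_Times_iff dest!: subsetD)
  have trK: "trace (a \<otimes> m) \<in> K" if "a \<in> F" "m \<in> D" for a m
    using trace_in_K subringE(6)[OF F_ring] that D(2) by blast
  then have tr: "trace (a \<otimes> m) \<in> carrier R" if "a \<in> F" "m \<in> D" for a m
    using that KF F_carrier by blast
  let ?t = "\<lambda>p q. trace (fst q \<otimes> snd p) \<otimes> fst p \<otimes> \<tau> (snd q)"
  have tcl: "?t p q \<in> carrier R" if "p \<in> set xs" "q \<in> set ys" for p q
    using xcl[OF that(1)] ycl[OF that(2)] tr[OF ycl(1)[OF that(2)] xcl(2)[OF that(1)]] by simp
  have "list_sum R (\<lambda>(c, m). c \<otimes> \<tau> m) xs = list_sum R (\<lambda>p. list_sum R (?t p) ys) xs"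
    unfolding case_prod_unfold
  proof (rule list_sum_cong)
    fix p assume p: "p \<in> set xs"
    note c = xcl[OF p]
    let ?s = "\<lambda>q. trace (fst q \<otimes> snd p)"
    have "\<tau> (snd p) = \<tau> (list_sum R (\<lambda>q. ?s q \<otimes> snd q) ys)"
      by (rule arg_cong[OF bspec[OF ys(2) c(2)]])
    also have "\<dots> = list_sum R (\<lambda>q. \<tau> (?s q \<otimes> snd q)) ys"
    proof (rule subring_hom_list_sum[OF hom\<tau> D(1) carrier_is_subring])
      fix q assume "q \<in> set ys"
      then show "?s q \<otimes> snd q \<in> D"
        using ycl[of q] trK[OF _ c(2), of "fst q"] D(3) subringE(6)[OF D(1)] by blast
    qed
    also have "\<dots> = list_sum R (\<lambda>q. ?s q \<otimes> \<tau> (snd q)) ys"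
    proof (rule list_sum_cong)
      fix q assume "q \<in> set ys"
      then have "?s q \<in> K" "snd q \<in> D" using ycl trK[OF _ c(2)] by auto
      then show "\<tau> (?s q \<otimes> snd q) = ?s q \<otimes> \<tau> (snd q)"
        using h(2)[of "?s q" "snd q"] \<tau>(2)[of "?s q"] D(3) by auto
    qed
    finally have "fst p \<otimes> \<tau> (snd p) = fst p \<otimes> list_sum R (\<lambda>q. ?s q \<otimes> \<tau> (snd q)) ys" by simp
    also have "\<dots> = list_sum R (\<lambda>q. fst p \<otimes> (?s q \<otimes> \<tau> (snd q))) ys"
      using c(1) ycl tr[OF _ c(2)] by (intro list_sum_rdistr) simp_all
    also have "\<dots> = list_sum R (?t p) ys"
    proof (rule list_sum_cong)
      fix q assume "q \<in> set ys"
      then have "?s q \<in> carrier R" "\<tau> (snd q) \<in> carrier R" using ycl tr[OF _ c(2)] by auto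
      then show "fst p \<otimes> (?s q \<otimes> \<tau> (snd q)) = ?t p q" using c(1) by algebra
    qed
    finally show "fst p \<otimes> \<tau> (snd p) = list_sum R (?t p) ys" .
  qed
  also have "\<dots> = list_sum R (\<lambda>q. list_sum R (\<lambda>p. ?t p q) xs) ys"
    using tcl by (rule list_sum_swap)
  also have "\<dots> = list_sum R (\<lambda>q. \<zero>) ys"
  proof (rule list_sum_cong)
    fix q assume q: "q \<in> set ys"
    note c = ycl[OF q]
    \<comment> \<open>The pairs are flipped: in \<open>xs\<close> the arbitrary scalar comes first,
      while \<open>list_sum_trace\<close> expects the element of \<open>F\<close> first.\<close>
    have "list_sum R (\<lambda>(x, l). trace (fst q \<otimes> x) \<otimes> l) (map (\<lambda>(c, m). (m, c)) xs) = \<zero>"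
    proof (rule list_sum_trace[OF c(1)])
      fix \<theta> assume t: "\<theta> \<in> G"
      have "list_sum R (\<lambda>p. \<theta> (snd p) \<otimes> fst p) xs = list_sum R (\<lambda>p. fst p \<otimes> \<theta> (snd p)) xs"
      proof (rule list_sum_cong)
        fix p assume "p \<in> set xs"
        then have "fst p \<in> carrier R" "\<theta> (snd p) \<in> carrier R" using xcl G_carrier[OF t] D(2) by blast+
        then show "\<theta> (snd p) \<otimes> fst p = fst p \<otimes> \<theta> (snd p)" by (rule m_comm[rotated])
      qed
      then show "list_sum R (\<lambda>(x, l). \<theta> x \<otimes> l) (map (\<lambda>(c, m). (m, c)) xs) = \<zero>"
        using xs(3) t by (simp add: case_prod_unfold)
    next
      fix x l assume "(x, l) \<in> set (map (\<lambda>(c, m). (m, c)) xs)"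
      then have "(l, x) \<in> set xs" by auto
      then show "x \<in> F \<and> l \<in> carrier R" using xcl[of "(l, x)"] D(2) by auto
    qed
    then have "list_sum R (\<lambda>p. trace (fst q \<otimes> snd p) \<otimes> fst p) xs \<otimes> \<tau> (snd q) = \<zero>"
      using c by (simp add: case_prod_unfold)
    moreover have "list_sum R (\<lambda>p. trace (fst q \<otimes> snd p) \<otimes> fst p) xs \<otimes> \<tau> (snd q)
        = list_sum R (\<lambda>p. ?t p q) xs"
      using c xcl tr[OF c(1)] by (intro list_sum_ldistr) simp_all
    ultimately show "list_sum R (\<lambda>p. ?t p q) xs = \<zero>" by simp
  qed
  finally show False using xs(2) by simp
qed

text \<open>Artin's theorem: an automorphism over \<open>K\<close> is a homomorphism on
  \<open>D = F\<close>, so it agrees with a member of \<open>G\<close>.\<close>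

lemma group_eq_galois_group: "G = carrier (galois_group R K F)"
proof
  show "carrier (galois_group R K F) \<subseteq> G"
  proof
    fix \<tau> assume t: "\<tau> \<in> carrier (galois_group R K F)"
    have "\<tau> \<in> ring_hom (R\<lparr>carrier := F\<rparr>) R"
      using subring_hom_mono[OF galois_groupD(6)[OF t] order_refl F_carrier] by simp
    then obtain \<theta> where "\<theta> \<in> G" "\<forall>x\<in>F. \<theta> x = \<tau> x"
      using hom_extends_to_group[OF F_ring order_refl KF] galois_groupD(5)[OF t] by blast
    then show "\<tau> \<in> G" using galois_group_ext[OF G_mem t] by metis
  qed
qed (use G_mem in blast)

end

section \<open>Tensor products\<close>

lemmas frag_induct = free_Abelian_group_induct [consumes 1, case_names zero diff one]

text \<open>The product of \<open>pair_monoid_ring\<close> nests one \<open>frag_extend\<close>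
  inside the function argument of another. Additivity in the second factor is therefore linearity of
  \<open>frag_extend\<close> in that function.\<close>

lemma frag_extend_fun_diff:
  fixes f g :: "'a \<Rightarrow> 'b \<Rightarrow>\<^sub>0 int"
  shows "frag_extend (\<lambda>x. f x - g x) c = frag_extend f c - frag_extend g c"
proof -
  have "frag_cmul n (a - b) = frag_cmul n a - frag_cmul n b" for n and a b :: "'b \<Rightarrow>\<^sub>0 int"
    using frag_cmul_distrib2[of n a "- b"] frag_cmul_cmul[of n "- 1" b] frag_cmul_cmul[of "- 1" n b]
    by simp
  then show ?thesis by (simp add: frag_extend_def sum_subtractf)
qed

lemma pair_monoid_ring_simps [simp]:
  "x \<in> carrier (pair_monoid_ring R A B) \<longleftrightarrow> Poly_Mapping.keys x \<subseteq> A \<times> B"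
  "x \<oplus>\<^bsub>pair_monoid_ring R A B\<^esub> y = x + y"
  "\<zero>\<^bsub>pair_monoid_ring R A B\<^esub> = 0"
  "\<one>\<^bsub>pair_monoid_ring R A B\<^esub> = frag_of (\<one>\<^bsub>R\<^esub>, \<one>\<^bsub>R\<^esub>)"
  by (simp_all add: pair_monoid_ring_def)

lemma pair_monoid_ring_mult:
  "frag_of (a, b) \<otimes>\<^bsub>pair_monoid_ring R A B\<^esub> frag_of (a', b') = frag_of (a \<otimes>\<^bsub>R\<^esub> a', b \<otimes>\<^bsub>R\<^esub> b')"
  "0 \<otimes>\<^bsub>pair_monoid_ring R A B\<^esub> z = 0"
  "z \<otimes>\<^bsub>pair_monoid_ring R A B\<^esub> 0 = 0"
  "(x - y) \<otimes>\<^bsub>pair_monoid_ring R A B\<^esub> z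
     = x \<otimes>\<^bsub>pair_monoid_ring R A B\<^esub> z - y \<otimes>\<^bsub>pair_monoid_ring R A B\<^esub> z"
  "z \<otimes>\<^bsub>pair_monoid_ring R A B\<^esub> (x - y)
     = z \<otimes>\<^bsub>pair_monoid_ring R A B\<^esub> x - z \<otimes>\<^bsub>pair_monoid_ring R A B\<^esub> y"
  "(x + y) \<otimes>\<^bsub>pair_monoid_ring R A B\<^esub> z
     = x \<otimes>\<^bsub>pair_monoid_ring R A B\<^esub> z + y \<otimes>\<^bsub>pair_monoid_ring R A B\<^esub> z"
proof -
  have [simp]: "frag_extend (\<lambda>p. 0) c = 0" for c :: "'a \<times> 'a \<Rightarrow>\<^sub>0 int"
    by (simp add: frag_extend_def)
  show "frag_of (a, b) \<otimes>\<^bsub>pair_monoid_ring R A B\<^esub> frag_of (a', b') = frag_of (a \<otimes>\<^bsub>R\<^esub> a', b \<otimes>\<^bsub>R\<^esub> b')"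
    "0 \<otimes>\<^bsub>pair_monoid_ring R A B\<^esub> z = 0" "z \<otimes>\<^bsub>pair_monoid_ring R A B\<^esub> 0 = 0"
    "(x - y) \<otimes>\<^bsub>pair_monoid_ring R A B\<^esub> z
     = x \<otimes>\<^bsub>pair_monoid_ring R A B\<^esub> z - y \<otimes>\<^bsub>pair_monoid_ring R A B\<^esub> z"
    "z \<otimes>\<^bsub>pair_monoid_ring R A B\<^esub> (x - y)
     = z \<otimes>\<^bsub>pair_monoid_ring R A B\<^esub> x - z \<otimes>\<^bsub>pair_monoid_ring R A B\<^esub> y"
    "(x + y) \<otimes>\<^bsub>pair_monoid_ring R A B\<^esub> z
     = x \<otimes>\<^bsub>pair_monoid_ring R A B\<^esub> z + y \<otimes>\<^bsub>pair_monoid_ring R A B\<^esub> z"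
    by (simp_all add: pair_monoid_ring_def frag_extend_diff frag_extend_add frag_extend_fun_diff)
qed

locale tensor = cring R for R (structure) +
  fixes K A B :: "'a set"
  assumes A: "subring A R" and B: "subring B R" and KA: "K \<subseteq> A" and KB: "K \<subseteq> B"
begin

abbreviation P where "P \<equiv> pair_monoid_ring R A B"
abbreviation T where "T \<equiv> tensor_ring R K A B"
abbreviation pt where "pt \<equiv> pure_tensor R K A B"

lemma A_carrier: "a \<in> A \<Longrightarrow> a \<in> carrier R" and B_carrier: "b \<in> B \<Longrightarrow> b \<in> carrier R"
  using subringE(1)[OF A] subringE(1)[OF B] by auto

lemmas A_closed = subringE(2,3,5-7)[OF A]
lemmas B_closed = subringE(2,3,5-7)[OF B]

text \<open>Multiplication is biadditive, so each multiplicative law reduces, by induction over the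
  free abelian group in every argument, to the same law for generators, that is, for the monoid
  \<open>A \<times> B\<close>.\<close>

lemma pair_monoid_ring_cring: "cring P"
proof (rule cringI)
  show "abelian_group P"
  proof (rule abelian_groupI)
    fix x assume "x \<in> carrier P"
    then have "- x \<in> carrier P \<and> - x \<oplus>\<^bsub>P\<^esub> x = \<zero>\<^bsub>P\<^esub>" by simp
    then show "\<exists>y\<in>carrier P. y \<oplus>\<^bsub>P\<^esub> x = \<zero>\<^bsub>P\<^esub>" by blast
  qed (auto simp: add_ac dest: subsetD[OF keys_add])
  have one: "\<one>\<^bsub>P\<^esub> \<in> carrier P" using A_closed(2) B_closed(2) by simp
  have closed: "x \<otimes>\<^bsub>P\<^esub> y \<in> carrier P" if x: "x \<in> carrier P" and y: "y \<in> carrier P" for x y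
  proof -
    have "Poly_Mapping.keys x \<subseteq> A \<times> B" "Poly_Mapping.keys y \<subseteq> A \<times> B" using x y by auto
    then have "Poly_Mapping.keys (x \<otimes>\<^bsub>P\<^esub> y) \<subseteq> A \<times> B"
    proof (induction x rule: frag_induct)
      case (diff x x')
      then show ?case unfolding pair_monoid_ring_mult by (meson keys_diff le_supI order_trans)
    next
      case (one p)
      show ?case using one(2)
      proof (induction y rule: frag_induct)
        case (diff x x')
        then show ?case unfolding pair_monoid_ring_mult by (meson keys_diff le_supI order_trans)
      next
        case (one q)
        then show ?case using \<open>p \<in> A \<times> B\<close> A_closed(4) B_closed(4)
          by (cases p, cases q) (simp add: pair_monoid_ring_mult)
      qed (simp add: pair_monoid_ring_mult)
    qed (simp add: pair_monoid_ring_mult)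
    then show ?thesis by simp
  qed
  have comm: "x \<otimes>\<^bsub>P\<^esub> y = y \<otimes>\<^bsub>P\<^esub> x" if x: "x \<in> carrier P" and y: "y \<in> carrier P" for x y
  proof -
    have "Poly_Mapping.keys x \<subseteq> A \<times> B" "Poly_Mapping.keys y \<subseteq> A \<times> B" using x y by auto
    then show ?thesis
    proof (induction x rule: frag_induct)
      case (one p)
      show ?case using one(2)
      proof (induction y rule: frag_induct)
        case (one q)
        then show ?case using \<open>p \<in> A \<times> B\<close> A_carrier B_carrier
          by (cases p, cases q) (simp add: pair_monoid_ring_mult m_comm)
      qed (simp_all add: pair_monoid_ring_mult)
    qed (simp_all add: pair_monoid_ring_mult)
  qed
  have assoc: "x \<otimes>\<^bsub>P\<^esub> y \<otimes>\<^bsub>P\<^esub> z = x \<otimes>\<^bsub>P\<^esub> (y \<otimes>\<^bsub>P\<^esub> z)"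
    if x: "x \<in> carrier P" and y: "y \<in> carrier P" and z: "z \<in> carrier P" for x y z
  proof -
    have "Poly_Mapping.keys x \<subseteq> A \<times> B" "Poly_Mapping.keys y \<subseteq> A \<times> B"
      "Poly_Mapping.keys z \<subseteq> A \<times> B" using x y z by auto
    then show ?thesis
    proof (induction x rule: frag_induct)
      case (one p)
      show ?case using one(2,3)
      proof (induction y rule: frag_induct)
        case (one q)
        show ?case using one(2)
        proof (induction z rule: frag_induct)
          case (one r)
          then show ?case using \<open>p \<in> A \<times> B\<close> \<open>q \<in> A \<times> B\<close> A_carrier B_carrier
            by (cases p, cases q, cases r) (simp add: pair_monoid_ring_mult m_assoc)
        qed (simp_all add: pair_monoid_ring_mult)
      qed (simp_all add: pair_monoid_ring_mult)
    qed (simp_all add: pair_monoid_ring_mult)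
  qed
  have l_one: "\<one>\<^bsub>P\<^esub> \<otimes>\<^bsub>P\<^esub> x = x" if x: "x \<in> carrier P" for x
  proof -
    have "Poly_Mapping.keys x \<subseteq> A \<times> B" using x by auto
    then show ?thesis
    proof (induction x rule: frag_induct)
      case (one p)
      then show ?case using A_carrier B_carrier by (cases p) (simp add: pair_monoid_ring_mult)
    qed (simp_all add: pair_monoid_ring_mult)
  qed
  show "comm_monoid P"
    by (rule comm_monoidI) (fact closed one assoc l_one comm)+
  show "(x \<oplus>\<^bsub>P\<^esub> y) \<otimes>\<^bsub>P\<^esub> z = x \<otimes>\<^bsub>P\<^esub> z \<oplus>\<^bsub>P\<^esub> y \<otimes>\<^bsub>P\<^esub> z" for x y z
    by (simp add: pair_monoid_ring_mult)
qed

sublocale P: cring P by (rule pair_monoid_ring_cring)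

lemma P_uminus: "x \<in> carrier P \<Longrightarrow> \<ominus>\<^bsub>P\<^esub> x = - x"
  by (rule P.minus_equality) auto

lemma tensor_relations_carrier: "tensor_relations R K A B \<subseteq> carrier P"
proof -
  have d: "x \<in> carrier P \<Longrightarrow> y \<in> carrier P \<Longrightarrow> x - y \<in> carrier P" for x y
    using keys_diff[of x y] by auto
  show ?thesis
    unfolding tensor_relations_def
    using A_closed B_closed KA KB by (intro Un_least subsetI; clarify; intro d) auto
qed

sublocale I: ideal "tensor_ideal R K A B" P
  unfolding tensor_ideal_def using P.genideal_ideal[OF tensor_relations_carrier] .

sublocale T: cring T
  unfolding tensor_ring_def using I.quotient_is_cring[OF pair_monoid_ring_cring] .

abbreviation proj where "proj x \<equiv> tensor_ideal R K A B +>\<^bsub>P\<^esub> x"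

lemma proj_hom: "(\<lambda>x. proj x) \<in> ring_hom P T"
  unfolding tensor_ring_def using I.rcos_ring_hom .

lemma proj_eqI:
  assumes "x \<in> carrier P" "y \<in> carrier P" "x - y \<in> tensor_ideal R K A B"
  shows "proj x = proj y"
proof -
  have "x \<ominus>\<^bsub>P\<^esub> y = x - y" using assms(1,2) P_uminus by (simp add: a_minus_def)
  then show ?thesis using P.quotient_eq_iff_same_a_r_cos[OF I.ideal_axioms assms(1,2)] assms(3) by simp
qed

lemma relation_in_ideal: "x \<in> tensor_relations R K A B \<Longrightarrow> x \<in> tensor_ideal R K A B"
  unfolding tensor_ideal_def using P.genideal_self[OF tensor_relations_carrier] by blast

lemma frag_of_carrier: "a \<in> A \<Longrightarrow> b \<in> B \<Longrightarrow> frag_of (a, b) \<in> carrier P"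
  by simp

lemma pt_closed: "a \<in> A \<Longrightarrow> b \<in> B \<Longrightarrow> pt a b \<in> carrier T"
  unfolding pure_tensor_def using ring_hom_closed[OF proj_hom frag_of_carrier] .

lemma pt_add_left:
  assumes "a \<in> A" "a' \<in> A" "b \<in> B"
  shows "pt (a \<oplus> a') b = pt a b \<oplus>\<^bsub>T\<^esub> pt a' b"
proof -
  have "proj (frag_of (a \<oplus> a', b)) = proj (frag_of (a, b) \<oplus>\<^bsub>P\<^esub> frag_of (a', b))"
  proof (rule proj_eqI)
    have "frag_of (a \<oplus> a', b) - frag_of (a, b) - frag_of (a', b) \<in> tensor_relations R K A B"
      unfolding tensor_relations_def using assms by blast
    then show "frag_of (a \<oplus> a', b) - (frag_of (a, b) \<oplus>\<^bsub>P\<^esub> frag_of (a', b)) \<in> tensor_ideal R K A B"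
      using relation_in_ideal by (simp add: diff_diff_eq)
  qed (use assms A_closed P.add.m_closed[OF frag_of_carrier frag_of_carrier] in auto)
  then show ?thesis
    unfolding pure_tensor_def using ring_hom_add[OF proj_hom frag_of_carrier frag_of_carrier] assms by simp
qed

lemma pt_add_right:
  assumes "a \<in> A" "b \<in> B" "b' \<in> B"
  shows "pt a (b \<oplus> b') = pt a b \<oplus>\<^bsub>T\<^esub> pt a b'"
proof -
  have "proj (frag_of (a, b \<oplus> b')) = proj (frag_of (a, b) \<oplus>\<^bsub>P\<^esub> frag_of (a, b'))"
  proof (rule proj_eqI)
    have "frag_of (a, b \<oplus> b') - frag_of (a, b) - frag_of (a, b') \<in> tensor_relations R K A B"
      unfolding tensor_relations_def using assms by blast
    then show "frag_of (a, b \<oplus> b') - (frag_of (a, b) \<oplus>\<^bsub>P\<^esub> frag_of (a, b')) \<in> tensor_ideal R K A B"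
      using relation_in_ideal by (simp add: diff_diff_eq)
  qed (use assms B_closed P.add.m_closed[OF frag_of_carrier frag_of_carrier] in auto)
  then show ?thesis
    unfolding pure_tensor_def using ring_hom_add[OF proj_hom frag_of_carrier frag_of_carrier] assms by simp
qed

lemma pt_middle:
  assumes "a \<in> A" "c \<in> K" "b \<in> B"
  shows "pt (a \<otimes> c) b = pt a (c \<otimes> b)"
  unfolding pure_tensor_def
proof (rule proj_eqI)
  have "frag_of (a \<otimes> c, b) - frag_of (a, c \<otimes> b) \<in> tensor_relations R K A B"
    unfolding tensor_relations_def using assms by blast
  then show "frag_of (a \<otimes> c, b) - frag_of (a, c \<otimes> b) \<in> tensor_ideal R K A B"
    using relation_in_ideal by simp
qed (use assms A_closed B_closed KA KB in auto)

lemma pt_zero: "a \<in> A \<Longrightarrow> pt a \<zero> = \<zero>\<^bsub>T\<^esub>" "b \<in> B \<Longrightarrow> pt \<zero> b = \<zero>\<^bsub>T\<^esub>"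
proof -
  assume a: "a \<in> A"
  have "pt a \<zero> = pt a \<zero> \<oplus>\<^bsub>T\<^esub> pt a \<zero>" using pt_add_right[OF a, of \<zero> \<zero>] B_closed(1) by simp
  then show "pt a \<zero> = \<zero>\<^bsub>T\<^esub>" using pt_closed[OF a B_closed(1)] by simp
next
  assume b: "b \<in> B"
  have "pt \<zero> b = pt \<zero> b \<oplus>\<^bsub>T\<^esub> pt \<zero> b" using pt_add_left[OF _ _ b, of \<zero> \<zero>] A_closed(1) by simp
  then show "pt \<zero> b = \<zero>\<^bsub>T\<^esub>" using pt_closed[OF A_closed(1) b] by simp
qed

lemma pt_uminus:
  assumes "a \<in> A" "b \<in> B"
  shows "\<ominus>\<^bsub>T\<^esub> pt a b = pt (\<ominus> a) b"
proof (rule T.minus_equality)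
  show "pt (\<ominus> a) b \<oplus>\<^bsub>T\<^esub> pt a b = \<zero>\<^bsub>T\<^esub>"
    using pt_add_left[of "\<ominus> a" a b] pt_zero(2)[OF assms(2)] assms A_closed(3) A_carrier
    by (simp add: l_neg)
qed (use pt_closed assms A_closed(3) in auto)

lemma pt_list_sum_left:
  assumes "\<And>x. x \<in> set xs \<Longrightarrow> f x \<in> A" "b \<in> B"
  shows "pt (list_sum R f xs) b = list_sum T (\<lambda>x. pt (f x) b) xs"
  using assms by (induction xs) (auto simp: pt_zero pt_add_left list_sum_subring[OF A])

lemma pt_list_sum_right:
  assumes "a \<in> A" "\<And>x. x \<in> set xs \<Longrightarrow> f x \<in> B"
  shows "pt a (list_sum R f xs) = list_sum T (\<lambda>x. pt a (f x)) xs"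
  using assms by (induction xs) (auto simp: pt_zero pt_add_right list_sum_subring[OF B])

text \<open>Integer coefficients disappear: repeated summands are allowed in a list, and a minus
  sign moves into the left factor, which gives the difference case of the induction.\<close>

lemma tensor_exists_sum:
  assumes "Z \<in> carrier T"
  shows "\<exists>xs. set xs \<subseteq> A \<times> B \<and> Z = list_sum T (\<lambda>(a, b). pt a b) xs"
proof -
  obtain x where x: "x \<in> carrier P" "Z = proj x"
    using assms unfolding tensor_ring_def FactRing_def A_RCOSETS_def' by auto
  have pcl: "(case p of (a, b) \<Rightarrow> pt a b) \<in> carrier T" if "p \<in> set xs" "set xs \<subseteq> A \<times> B" for p xs
    using that pt_closed by auto
  have neg: "\<exists>ys. set ys \<subseteq> A \<times> B \<and>
      \<ominus>\<^bsub>T\<^esub> list_sum T (\<lambda>(a, b). pt a b) xs = list_sum T (\<lambda>(a, b). pt a b) ys"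
    if "set xs \<subseteq> A \<times> B" for xs
  proof (intro exI conjI)
    show "set (map (\<lambda>(a, b). (\<ominus> a, b)) xs) \<subseteq> A \<times> B" using that A_closed(3) by auto
    show "\<ominus>\<^bsub>T\<^esub> list_sum T (\<lambda>(a, b). pt a b) xs
        = list_sum T (\<lambda>(a, b). pt a b) (map (\<lambda>(a, b). (\<ominus> a, b)) xs)"
      using that
    proof (induction xs)
      case (Cons p xs)
      obtain a b where p: "p = (a, b)" "a \<in> A" "b \<in> B" using Cons.prems by auto
      have "list_sum T (\<lambda>(a, b). pt a b) xs \<in> carrier T"
        using pcl Cons.prems by (intro T.list_sum_closed) auto
      then show ?case
        using Cons p pt_closed pt_uminus by (simp add: T.minus_add)
    qed simp
  qed
  have "Poly_Mapping.keys x \<subseteq> A \<times> B" using x(1) by simp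
  then have "\<exists>xs. set xs \<subseteq> A \<times> B \<and> proj x = list_sum T (\<lambda>(a, b). pt a b) xs"
  proof (induction x rule: frag_induct)
    case zero
    have "proj 0 = \<zero>\<^bsub>T\<^esub>"
    proof -
      interpret h: ring_hom_ring P T "\<lambda>x. proj x"
        using ring_hom_ringI2[OF P.ring_axioms T.ring_axioms proj_hom] .
      show ?thesis using h.hom_zero by simp
    qed
    then show ?case by (intro exI[of _ "[]"]) simp
  next
    case (diff x y)
    interpret h: ring_hom_ring P T "\<lambda>x. proj x"
      using ring_hom_ringI2[OF P.ring_axioms T.ring_axioms proj_hom] .
    have xy: "x \<in> carrier P" "y \<in> carrier P" using diff by auto
    obtain xs ys where xs: "set xs \<subseteq> A \<times> B" "proj x = list_sum T (\<lambda>(a, b). pt a b) xs"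
      and ys: "set ys \<subseteq> A \<times> B" "proj y = list_sum T (\<lambda>(a, b). pt a b) ys" using diff by blast
    obtain zs where zs: "set zs \<subseteq> A \<times> B"
      "\<ominus>\<^bsub>T\<^esub> list_sum T (\<lambda>(a, b). pt a b) ys = list_sum T (\<lambda>(a, b). pt a b) zs"
      using neg[OF ys(1)] by blast
    have eq: "x - y = x \<oplus>\<^bsub>P\<^esub> \<ominus>\<^bsub>P\<^esub> y" using xy P_uminus by simp
    have "proj (x - y) = proj x \<oplus>\<^bsub>T\<^esub> \<ominus>\<^bsub>T\<^esub> proj y"
      unfolding eq using h.hom_add[OF xy(1) P.a_inv_closed[OF xy(2)]] h.hom_a_inv[OF xy(2)]
      by (simp del: pair_monoid_ring_simps)
    also have "\<dots> = list_sum T (\<lambda>(a, b). pt a b) (xs @ zs)"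
      unfolding xs(2) ys(2) zs(2)
      using pcl xs(1) zs(1) by (intro T.list_sum_append[symmetric]) auto
    finally show ?case using xs(1) zs(1) by (intro exI[of _ "xs @ zs"]) auto
  next
    case (one p)
    have "set [p] \<subseteq> A \<times> B" "proj (frag_of p) = list_sum T (\<lambda>(a, b). pt a b) [p]"
      using one pt_closed by (auto simp: pure_tensor_def)
    then show ?case by blast
  qed
  then show ?thesis using x(2) by simp
qed

text \<open>The map on pairs extends additively to the free abelian group, is multiplicative because
  it is so on generators, and kills the bilinearity relations; hence it kills the ideal they
  generate and factors through the quotient. Agreement of \<open>f\<close> and \<open>g\<close> on
  \<open>K\<close> is what kills the relations that move \<open>c\<close> across.\<close>

lemma tensor_universal:
  assumes S: "cring S"
    and f: "f \<in> ring_hom (R\<lparr>carrier := A\<rparr>) S" and g: "g \<in> ring_hom (R\<lparr>carrier := B\<rparr>) S"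
    and fg: "\<And>c. c \<in> K \<Longrightarrow> f c = g c"
  shows "\<exists>\<phi>\<in>ring_hom T S. \<forall>a\<in>A. \<forall>b\<in>B. \<phi> (pt a b) = f a \<otimes>\<^bsub>S\<^esub> g b"
proof -
  interpret S: cring S by fact
  note fh = ring_hom_memE[OF f, simplified] and gh = ring_hom_memE[OF g, simplified]
  have "(\<lambda>(a, b). f a \<otimes>\<^bsub>S\<^esub> g b) ` (A \<times> B) \<subseteq> carrier (add_monoid S)"
    using fh(1) gh(1) by auto
  then obtain h where h: "h \<in> hom (free_Abelian_group (A \<times> B)) (add_monoid S)"
    "\<And>p. p \<in> A \<times> B \<Longrightarrow> h (frag_of p) = (case p of (a, b) \<Rightarrow> f a \<otimes>\<^bsub>S\<^esub> g b)"
    using comm_group.free_Abelian_group_universal[OF S.a_comm_group] by metis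
  have hc: "h x \<in> carrier S" if "Poly_Mapping.keys x \<subseteq> A \<times> B" for x
    using hom_in_carrier[OF h(1), of x] that by simp
  have hadd: "h (x + y) = h x \<oplus>\<^bsub>S\<^esub> h y"
    if "Poly_Mapping.keys x \<subseteq> A \<times> B" "Poly_Mapping.keys y \<subseteq> A \<times> B" for x y
    using hom_mult[OF h(1), of x y] that by simp
  have h0: "h 0 = \<zero>\<^bsub>S\<^esub>"
    using hadd[of 0 0] hc[of 0] by simp
  have keys_d: "Poly_Mapping.keys (x - y) \<subseteq> A \<times> B"
    if "Poly_Mapping.keys x \<subseteq> A \<times> B" "Poly_Mapping.keys y \<subseteq> A \<times> B" for x y :: "'a \<times> 'a \<Rightarrow>\<^sub>0 int"
    using that keys_diff[of x y] by blast
  have hdiff: "h (x - y) = h x \<ominus>\<^bsub>S\<^esub> h y"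
    if "Poly_Mapping.keys x \<subseteq> A \<times> B" "Poly_Mapping.keys y \<subseteq> A \<times> B" for x y
  proof -
    have "h x = h (x - y) \<oplus>\<^bsub>S\<^esub> h y" using hadd[OF keys_d[OF that] that(2)] by simp
    then show ?thesis using hc[OF that(1)] hc[OF that(2)] hc[OF keys_d[OF that]]
      by (simp add: S.minus_eq S.a_assoc S.r_neg)
  qed
  have hom: "h \<in> ring_hom P S"
  proof (rule ring_hom_memI)
    show "h \<one>\<^bsub>P\<^esub> = \<one>\<^bsub>S\<^esub>" using h(2)[of "(\<one>, \<one>)"] A_closed(2) B_closed(2) fh(4) gh(4) by simp
    fix x y assume "x \<in> carrier P" "y \<in> carrier P"
    then have x: "Poly_Mapping.keys x \<subseteq> A \<times> B" and y: "Poly_Mapping.keys y \<subseteq> A \<times> B" by auto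
    show "h (x \<oplus>\<^bsub>P\<^esub> y) = h x \<oplus>\<^bsub>S\<^esub> h y" using hadd[OF x y] by simp
    have cl: "Poly_Mapping.keys (u \<otimes>\<^bsub>P\<^esub> v) \<subseteq> A \<times> B"
      if "Poly_Mapping.keys u \<subseteq> A \<times> B" "Poly_Mapping.keys v \<subseteq> A \<times> B" for u v
      using P.m_closed[of u v] that by simp
    show "h (x \<otimes>\<^bsub>P\<^esub> y) = h x \<otimes>\<^bsub>S\<^esub> h y" using x
    proof (induction x rule: frag_induct)
      case zero
      then show ?case using h0 hc[OF y] by (simp add: pair_monoid_ring_mult)
    next
      case (diff u v)
      then show ?case using hdiff cl[OF _ y] hc y
        by (simp add: pair_monoid_ring_mult S.minus_eq S.l_distr S.l_minus)
    next
      case (one p)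
      show ?case using y
      proof (induction y rule: frag_induct)
        case zero
        then show ?case using h0 hc[of "frag_of p"] one by (simp add: pair_monoid_ring_mult)
      next
        case (diff u v)
        then show ?case using hdiff cl[of "frag_of p"] hc[of "frag_of p"] hc \<open>p \<in> A \<times> B\<close>
          by (simp add: pair_monoid_ring_mult S.minus_eq S.r_distr S.r_minus)
      next
        case (one q)
        obtain a b a' b' where pq: "p = (a, b)" "q = (a', b')" "a \<in> A" "b \<in> B" "a' \<in> A" "b' \<in> B"
          using one \<open>p \<in> A \<times> B\<close> by auto
        have "h (frag_of p \<otimes>\<^bsub>P\<^esub> frag_of q) = f (a \<otimes> a') \<otimes>\<^bsub>S\<^esub> g (b \<otimes> b')"
          using h(2)[of "(a \<otimes> a', b \<otimes> b')"] pq A_closed(4) B_closed(4)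
          by (simp add: pair_monoid_ring_mult)
        also have "\<dots> = (f a \<otimes>\<^bsub>S\<^esub> g b) \<otimes>\<^bsub>S\<^esub> (f a' \<otimes>\<^bsub>S\<^esub> g b')"
          using pq fh gh by (simp add: S.m_ac)
        finally show ?case using h(2) pq by simp
      qed
    qed
  qed (use hc in auto)
  interpret h: ring_hom_ring P S h
    using ring_hom_ringI2[OF P.ring_axioms S.ring_axioms hom] .
  have "tensor_relations R K A B \<subseteq> a_kernel P S h"
  proof
    fix r assume r: "r \<in> tensor_relations R K A B"
    have rP: "r \<in> carrier P" using r tensor_relations_carrier by blast
    have e: "h (frag_of (a, b)) = f a \<otimes>\<^bsub>S\<^esub> g b" if "a \<in> A" "b \<in> B" for a b using h(2) that by simp
    have k: "Poly_Mapping.keys (frag_of (a, b)) \<subseteq> A \<times> B" if "a \<in> A" "b \<in> B" for a b using that by simp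
    from r consider
        (l) a a' b where "a \<in> A" "a' \<in> A" "b \<in> B" "r = frag_of (a \<oplus> a', b) - frag_of (a, b) - frag_of (a', b)"
      | (r) a b b' where "a \<in> A" "b \<in> B" "b' \<in> B" "r = frag_of (a, b \<oplus> b') - frag_of (a, b) - frag_of (a, b')"
      | (m) a b c where "a \<in> A" "b \<in> B" "c \<in> K" "r = frag_of (a \<otimes> c, b) - frag_of (a, c \<otimes> b)"
      unfolding tensor_relations_def by blast
    then have "h r = \<zero>\<^bsub>S\<^esub>"
    proof cases
      case l
      have "h r = (f a \<oplus>\<^bsub>S\<^esub> f a') \<otimes>\<^bsub>S\<^esub> g b \<ominus>\<^bsub>S\<^esub> f a \<otimes>\<^bsub>S\<^esub> g b \<ominus>\<^bsub>S\<^esub> f a' \<otimes>\<^bsub>S\<^esub> g b"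
        using l A_closed(5) fh(3) by (simp add: hdiff keys_d k e)
      then show ?thesis using fh(1)[of a] fh(1)[of a'] gh(1)[of b] l by algebra
    next
      case r
      have "h r = f a \<otimes>\<^bsub>S\<^esub> (g b \<oplus>\<^bsub>S\<^esub> g b') \<ominus>\<^bsub>S\<^esub> f a \<otimes>\<^bsub>S\<^esub> g b \<ominus>\<^bsub>S\<^esub> f a \<otimes>\<^bsub>S\<^esub> g b'"
        using r B_closed(5) gh(3) by (simp add: hdiff keys_d k e)
      then show ?thesis using fh(1)[of a] gh(1)[of b] gh(1)[of b'] r by algebra
    next
      case m
      have c: "c \<in> A" "c \<in> B" using m(3) KA KB by auto
      have "h r = f a \<otimes>\<^bsub>S\<^esub> f c \<otimes>\<^bsub>S\<^esub> g b \<ominus>\<^bsub>S\<^esub> f a \<otimes>\<^bsub>S\<^esub> (g c \<otimes>\<^bsub>S\<^esub> g b)"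
        unfolding m(4) using m(1,2) c A_closed(4) B_closed(4) fh(2)[of a c] gh(2)[of c b]
        by (simp add: hdiff k e)
      then show ?thesis using fg[OF m(3)] fh(1)[of a] gh(1)[of c] gh(1)[of b] m(1,2) c
        by (simp add: S.m_assoc S.minus_eq S.r_neg)
    qed
    with rP show "r \<in> a_kernel P S h" unfolding a_kernel_def' by blast
  qed
  then have ker: "tensor_ideal R K A B \<subseteq> a_kernel P S h"
    unfolding tensor_ideal_def by (intro P.genideal_minimal h.kernel_is_ideal)
  \<comment> \<open>\<open>h\<close> is constant on every coset because the ideal lies in its
    kernel, so its image of a coset is a singleton.\<close>
  define \<phi> where "\<phi> Z = the_elem (h ` Z)" for Z
  have \<phi>: "\<phi> (proj x) = h x" if x: "x \<in> carrier P" for x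
  proof -
    have "h ` proj x = {h x}"
    proof -
      have "h y = h x" if "y \<in> proj x" for y
      proof -
        have "y \<in> (\<Union>i\<in>tensor_ideal R K A B. {i \<oplus>\<^bsub>P\<^esub> x})" using that unfolding a_r_coset_def' .
        then obtain i where i: "i \<in> tensor_ideal R K A B" "y = i \<oplus>\<^bsub>P\<^esub> x" by (elim UN_E singletonE)
        then have "i \<in> a_kernel P S h" using ker by blast
        then have i': "i \<in> carrier P" "h i = \<zero>\<^bsub>S\<^esub>" unfolding a_kernel_def' by blast+
        have "h (i \<oplus>\<^bsub>P\<^esub> x) = h i \<oplus>\<^bsub>S\<^esub> h x" using h.hom_add[OF i'(1) x] .
        then show ?thesis unfolding i(2) i'(2) using S.l_zero[OF h.hom_closed[OF x]] by (rule trans)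
      qed
      then have "h ` proj x \<subseteq> {h x}" by blast
      moreover have "h x \<in> h ` proj x" using I.a_rcos_self[OF x] by (rule imageI)
      ultimately show ?thesis by (meson empty_subsetI insert_subset subset_antisym)
    qed
    then show ?thesis unfolding \<phi>_def by (metis the_elem_eq)
  qed
  have ex: "\<exists>x\<in>carrier P. Z = proj x" if "Z \<in> carrier T" for Z
    using that unfolding tensor_ring_def FactRing_def A_RCOSETS_def' by auto
  have "\<phi> \<in> ring_hom T S"
  proof (rule ring_hom_memI)
    fix Z assume "Z \<in> carrier T"
    then show "\<phi> Z \<in> carrier S" using ex \<phi> h.hom_closed by metis
  next
    fix Z Y assume "Z \<in> carrier T" "Y \<in> carrier T"
    then obtain x y where xy: "x \<in> carrier P" "Z = proj x" "y \<in> carrier P" "Y = proj y" using ex by meson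
    show "\<phi> (Z \<otimes>\<^bsub>T\<^esub> Y) = \<phi> Z \<otimes>\<^bsub>S\<^esub> \<phi> Y"
      using ring_hom_mult[OF proj_hom xy(1,3)] \<phi> P.m_closed[OF xy(1,3)] h.hom_mult[OF xy(1,3)] xy
      by (metis (no_types, lifting))
    show "\<phi> (Z \<oplus>\<^bsub>T\<^esub> Y) = \<phi> Z \<oplus>\<^bsub>S\<^esub> \<phi> Y"
      using ring_hom_add[OF proj_hom xy(1,3)] \<phi> P.a_closed[OF xy(1,3)] h.hom_add[OF xy(1,3)] xy
      by (metis (no_types, lifting))
  next
    show "\<phi> \<one>\<^bsub>T\<^esub> = \<one>\<^bsub>S\<^esub>"
      using ring_hom_one[OF proj_hom] \<phi>[OF P.one_closed] h.hom_one by metis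
  qed
  moreover have "\<phi> (pt a b) = f a \<otimes>\<^bsub>S\<^esub> g b" if "a \<in> A" "b \<in> B" for a b
    using \<phi>[OF frag_of_carrier[OF that]] h(2) that by (simp add: pure_tensor_def)
  ultimately show ?thesis by blast
qed

end

section \<open>Tensor products of fields\<close>

text \<open>The source of injectivity of multiplication maps. Replace each \<open>x\<close> by
  \<open>\<Sum> Tr(a x) b\<close> and move the traces, which lie in \<open>K\<close>, across the
  tensor sign: the sum becomes \<open>\<Sum> b \<otimes> (\<Sum> Tr(a x) l)\<close> over the dual
  generators, and every right factor is 0 by \<open>list_sum_trace\<close>.\<close>

lemma (in finite_galois) tensor_sum_zero:
  assumes D: "subring D R" "D \<subseteq> F" "K \<subseteq> D" and L: "subring L R" "K \<subseteq> L"
    and xs: "set xs \<subseteq> D \<times> L"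
    and zero: "\<And>\<theta>. \<theta> \<in> G \<Longrightarrow> list_sum R (\<lambda>(x, l). \<theta> x \<otimes> l) xs = \<zero>"
  shows "list_sum (tensor_ring R K D L) (\<lambda>(x, l). pure_tensor R K D L x l) xs
    = \<zero>\<^bsub>tensor_ring R K D L\<^esub>"
proof -
  interpret T: tensor R K D L
    by (intro tensor.intro tensor_axioms.intro is_cring D L)
  obtain ys where ys: "set ys \<subseteq> F \<times> D"
    "\<forall>y\<in>D. y = list_sum R (\<lambda>q. trace (fst q \<otimes> y) \<otimes> snd q) ys"
    using dual_generators_subring[OF D(1,2)] by blast
  have xcl: "fst p \<in> D" "snd p \<in> L" if "p \<in> set xs" for p
    using that xs by (auto simp: mem_Times_iff dest!: subsetD)
  have ycl: "fst q \<in> F" "snd q \<in> D" if "q \<in> set ys" for q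
    using that ys(1) by (auto simp: mem_Times_iff dest!: subsetD)
  have trK: "trace (a \<otimes> m) \<in> K" if "a \<in> F" "m \<in> D" for a m
    using trace_in_K subringE(6)[OF F_ring] that D(2) by blast
  let ?tr = "\<lambda>p q. trace (fst q \<otimes> fst p)"
  have tr: "?tr p q \<in> K" if "p \<in> set xs" "q \<in> set ys" for p q
    using trK[OF ycl(1)[OF that(2)] xcl(1)[OF that(1)]] .
  have trL: "?tr p q \<otimes> snd p \<in> L" if "p \<in> set xs" "q \<in> set ys" for p q
    using subringE(6)[OF L(1) subsetD[OF L(2) tr[OF that]] xcl(2)[OF that(1)]] .
  have "list_sum T.T (\<lambda>(x, l). T.pt x l) xs
      = list_sum T.T (\<lambda>p. list_sum T.T (\<lambda>q. T.pt (snd q) (?tr p q \<otimes> snd p)) ys) xs"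
    unfolding case_prod_unfold
  proof (rule list_sum_cong)
    fix p assume p: "p \<in> set xs"
    have c: "?tr p q \<otimes> snd q \<in> D" if "q \<in> set ys" for q
      using subringE(6)[OF D(1) subsetD[OF D(3) tr[OF p that]] ycl(2)[OF that]] .
    have "T.pt (fst p) (snd p) = T.pt (list_sum R (\<lambda>q. ?tr p q \<otimes> snd q) ys) (snd p)"
      by (rule arg_cong[OF bspec[OF ys(2) xcl(1)[OF p]]])
    also have "\<dots> = list_sum T.T (\<lambda>q. T.pt (?tr p q \<otimes> snd q) (snd p)) ys"
      using c xcl(2)[OF p] by (intro T.pt_list_sum_left)
    also have "\<dots> = list_sum T.T (\<lambda>q. T.pt (snd q) (?tr p q \<otimes> snd p)) ys"
    proof (rule list_sum_cong)
      fix q assume q: "q \<in> set ys"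
      have "?tr p q \<otimes> snd q = snd q \<otimes> ?tr p q"
        using tr[OF p q] ycl(2)[OF q] KF D(2) F_carrier by (intro m_comm) blast+
      then show "T.pt (?tr p q \<otimes> snd q) (snd p) = T.pt (snd q) (?tr p q \<otimes> snd p)"
        using T.pt_middle[OF ycl(2)[OF q] tr[OF p q] xcl(2)[OF p]] by simp
    qed
    finally show "T.pt (fst p) (snd p) = list_sum T.T (\<lambda>q. T.pt (snd q) (?tr p q \<otimes> snd p)) ys" .
  qed
  also have "\<dots> = list_sum T.T (\<lambda>q. list_sum T.T (\<lambda>p. T.pt (snd q) (?tr p q \<otimes> snd p)) xs) ys"
    using T.pt_closed[OF ycl(2) trL] by (intro T.T.list_sum_swap)
  also have "\<dots> = list_sum T.T (\<lambda>q. \<zero>\<^bsub>T.T\<^esub>) ys"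
  proof (rule list_sum_cong)
    fix q assume q: "q \<in> set ys"
    have "list_sum R (\<lambda>(x, l). trace (fst q \<otimes> x) \<otimes> l) xs = \<zero>"
    proof (rule list_sum_trace[OF ycl(1)[OF q] _ zero])
      fix x l assume "(x, l) \<in> set xs"
      then show "x \<in> F \<and> l \<in> carrier R"
        using xcl[of "(x, l)"] D(2) subringE(1)[OF L(1)] by auto
    qed
    then have "list_sum R (\<lambda>p. ?tr p q \<otimes> snd p) xs = \<zero>" by (simp add: case_prod_unfold)
    then show "list_sum T.T (\<lambda>p. T.pt (snd q) (?tr p q \<otimes> snd p)) xs = \<zero>\<^bsub>T.T\<^esub>"
      using T.pt_list_sum_right[OF ycl(2)[OF q], of xs "\<lambda>p. ?tr p q \<otimes> snd p"] trL[OF _ q]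
        T.pt_zero(1)[OF ycl(2)[OF q]] by simp
  qed
  finally show ?thesis by simp
qed

text \<open>Used for \<open>E\<close> tensored with the fixed field of a complement, and for the
  base change of \<open>M\<close> to \<open>L\<close>. \<open>lift\<close> gives injectivity:
  applying a lift \<open>\<nu>\<close>, which fixes \<open>L\<close>, to
  \<open>\<Sum> x l = 0\<close> yields \<open>\<Sum> \<theta>(x) l = 0\<close> for each
  \<open>\<theta> \<in> G\<close>, as \<open>tensor_sum_zero\<close> needs. \<open>faithful\<close>
  gives surjectivity: every \<open>y \<in> M\<close> is then fixed by the stabilizer of
  \<open>D\<close> in \<open>N\<close>, so the dual generators of \<open>N\<close> write it as a sum
  of products from \<open>D\<close> and \<open>L\<close>.\<close>

lemma tensor_mult_iso:
  fixes R (structure)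
  assumes G: "finite_galois R K F G" and N: "finite_galois R L M N"
    and D: "subring D R" "K \<subseteq> D" "D \<subseteq> F" "D \<subseteq> M" and KL: "K \<subseteq> L"
    and lift: "\<And>\<theta>. \<theta> \<in> G \<Longrightarrow> \<exists>\<nu>\<in>N. \<forall>x\<in>D. \<nu> x = \<theta> x"
    and faithful: "\<And>\<nu> y. \<nu> \<in> N \<Longrightarrow> \<forall>x\<in>D. \<nu> x = x \<Longrightarrow> y \<in> M \<Longrightarrow> \<nu> y = y"
  shows "\<exists>\<phi>\<in>ring_iso (tensor_ring R K D L) (R\<lparr>carrier := M\<rparr>).
    \<forall>x\<in>D. \<forall>y\<in>L. \<phi> (pure_tensor R K D L x y) = x \<otimes> y"
proof -
  interpret G: finite_galois R K F G by fact
  interpret N: finite_galois R L M N by fact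
  have L: "subring L R" using N.K_subfield subfieldE(1) by blast
  note LM = N.KF and Mr = N.F_ring
  interpret T: tensor R K D L
    by (intro tensor.intro tensor_axioms.intro G.is_cring D L KL)
  have crM: "cring (R\<lparr>carrier := M\<rparr>)"
    using G.subfield_iff(2)[OF N.F] fieldE(1) by blast
  have "(\<lambda>x. x) \<in> ring_hom (R\<lparr>carrier := D\<rparr>) (R\<lparr>carrier := M\<rparr>)"
    "(\<lambda>x. x) \<in> ring_hom (R\<lparr>carrier := L\<rparr>) (R\<lparr>carrier := M\<rparr>)"
    using D(4) LM by (auto intro: subring_homI)
  from T.tensor_universal[OF crM this] obtain \<phi> where
    \<phi>: "\<phi> \<in> ring_hom T.T (R\<lparr>carrier := M\<rparr>)" "\<And>a b. a \<in> D \<Longrightarrow> b \<in> L \<Longrightarrow> \<phi> (T.pt a b) = a \<otimes> b"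
    by auto
  interpret h: ring_hom_ring T.T "R\<lparr>carrier := M\<rparr>" \<phi>
    using ring_hom_ringI2[OF T.T.ring_axioms _ \<phi>(1)] crM cring.axioms(1) by blast
  have pcl: "(case p of (a, b) \<Rightarrow> T.pt a b) \<in> carrier T.T" if "p \<in> D \<times> L" for p
    using that T.pt_closed by (cases p) simp
  have \<phi>_sum: "\<phi> (list_sum T.T (\<lambda>(a, b). T.pt a b) xs) = list_sum R (\<lambda>(a, b). a \<otimes> b) xs"
    if xs: "set xs \<subseteq> D \<times> L" for xs
  proof -
    have "\<phi> (list_sum T.T (\<lambda>(a, b). T.pt a b) xs)
        = list_sum R (\<lambda>p. \<phi> (case p of (a, b) \<Rightarrow> T.pt a b)) xs"
      using hom_list_sum[OF \<phi>(1) T.T.ring_axioms h.S.ring_axioms pcl[OF subsetD[OF xs]]] by simp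
    also have "\<dots> = list_sum R (\<lambda>(a, b). a \<otimes> b) xs"
    proof (rule list_sum_cong)
      fix p assume "p \<in> set xs"
      then have "p \<in> D \<times> L" using xs by blast
      then show "\<phi> (case p of (a, b) \<Rightarrow> T.pt a b) = (case p of (a, b) \<Rightarrow> a \<otimes> b)" using \<phi>(2) by auto
    qed
    finally show ?thesis .
  qed
  have "a_kernel T.T (R\<lparr>carrier := M\<rparr>) \<phi> = {\<zero>\<^bsub>T.T\<^esub>}"
  proof -
    have "z = \<zero>\<^bsub>T.T\<^esub>" if z: "z \<in> carrier T.T" "\<phi> z = \<zero>" for z
    proof -
      obtain xs where xs: "set xs \<subseteq> D \<times> L" "z = list_sum T.T (\<lambda>(a, b). T.pt a b) xs"
        using T.tensor_exists_sum[OF z(1)] by blast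
      have s0: "list_sum R (\<lambda>(a, b). a \<otimes> b) xs = \<zero>" using \<phi>_sum[OF xs(1)] xs(2) z(2) by simp
      have "list_sum R (\<lambda>(x, l). \<theta> x \<otimes> l) xs = \<zero>" if t: "\<theta> \<in> G" for \<theta>
      proof -
        obtain \<nu> where \<nu>: "\<nu> \<in> N" "\<forall>x\<in>D. \<nu> x = \<theta> x" using lift[OF t] by blast
        have cl: "p \<in> D \<times> L" if "p \<in> set xs" for p using that xs(1) by blast
        have "list_sum R (\<lambda>(x, l). \<theta> x \<otimes> l) xs = list_sum R (\<lambda>p. \<nu> (case p of (a, b) \<Rightarrow> a \<otimes> b)) xs"
        proof (rule list_sum_cong)
          fix p assume "p \<in> set xs"
          then obtain x l where p: "p = (x, l)" "x \<in> D" "l \<in> L" using cl by blast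
          have "\<nu> (x \<otimes> l) = \<nu> x \<otimes> \<nu> l" using N.G_mult[OF \<nu>(1)] p D(4) LM by blast
          then show "(case p of (x, l) \<Rightarrow> \<theta> x \<otimes> l) = \<nu> (case p of (a, b) \<Rightarrow> a \<otimes> b)"
            using p \<nu>(2) galois_groupD(5)[OF N.G_mem[OF \<nu>(1)]] by simp
        qed
        also have "\<dots> = \<nu> (list_sum R (\<lambda>(a, b). a \<otimes> b) xs)"
        proof (rule G.subring_hom_list_sum[OF N.G_hom[OF \<nu>(1)] Mr Mr, symmetric])
          fix p assume "p \<in> set xs"
          then have "p \<in> D \<times> L" using cl by blast
          then show "(case p of (a, b) \<Rightarrow> a \<otimes> b) \<in> M"
            using D(4) LM subringE(6)[OF Mr] by auto
        qed
        finally show ?thesis using s0 G.subring_hom_zero[OF N.G_hom[OF \<nu>(1)] Mr Mr] by simp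
      qed
      then show ?thesis
        using G.tensor_sum_zero[OF D(1,3,2) L KL xs(1)] xs(2) by simp
    qed
    moreover have "\<phi> \<zero>\<^bsub>T.T\<^esub> = \<zero>" using h.hom_zero by simp
    ultimately show ?thesis unfolding a_kernel_def' by auto
  qed
  then have inj: "inj_on \<phi> (carrier T.T)" by (rule h.trivial_ker_imp_inj)
  have "M \<subseteq> \<phi> ` carrier T.T"
  proof
    fix y assume y: "y \<in> M"
    obtain ys where ys: "set ys \<subseteq> M \<times> D"
      "\<forall>y\<in>M. (\<forall>\<theta>\<in>N. (\<forall>x\<in>D. \<theta> x = x) \<longrightarrow> \<theta> y = y) \<longrightarrow>
         y = list_sum R (\<lambda>(a, b). N.trace (a \<otimes> y) \<otimes> b) ys"
      using N.dual_generators[OF D(1,4)] by blast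
    have ysum: "y = list_sum R (\<lambda>(a, b). N.trace (a \<otimes> y) \<otimes> b) ys" using ys(2) y faithful by blast
    let ?zs = "map (\<lambda>(a, b). (b, N.trace (a \<otimes> y))) ys"
    have mem: "N.trace (a \<otimes> y) \<in> L" "b \<in> D" if "(a, b) \<in> set ys" for a b
    proof -
      have ab: "a \<in> M" "b \<in> D" using that ys(1) by blast+
      show "N.trace (a \<otimes> y) \<in> L" using N.trace_in_K[OF subringE(6)[OF Mr ab(1) y]] .
      show "b \<in> D" by fact
    qed
    have zs: "set ?zs \<subseteq> D \<times> L" using mem by auto
    have "list_sum R (\<lambda>(a, b). a \<otimes> b) ?zs = list_sum R (\<lambda>(a, b). N.trace (a \<otimes> y) \<otimes> b) ys"
      unfolding list_sum_map
    proof (rule list_sum_cong, clarify)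
      fix a b assume "(a, b) \<in> set ys"
      then have "N.trace (a \<otimes> y) \<in> carrier R" "b \<in> carrier R"
        using mem subringE(1)[OF L] subringE(1)[OF D(1)] by blast+
      then show "b \<otimes> N.trace (a \<otimes> y) = N.trace (a \<otimes> y) \<otimes> b" by (rule G.m_comm[rotated])
    qed
    then have "\<phi> (list_sum T.T (\<lambda>(a, b). T.pt a b) ?zs) = y" using \<phi>_sum[OF zs] ysum[symmetric] by simp
    moreover have "list_sum T.T (\<lambda>(a, b). T.pt a b) ?zs \<in> carrier T.T"
      using pcl[OF subsetD[OF zs]] by (rule T.T.list_sum_closed)
    ultimately show "y \<in> \<phi> ` carrier T.T" by (rule image_eqI[OF sym])
  qed
  moreover have "\<phi> ` carrier T.T \<subseteq> M" using h.hom_closed by auto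
  ultimately have "\<phi> \<in> ring_iso T.T (R\<lparr>carrier := M\<rparr>)"
    using inj \<phi>(1) by (auto simp: ring_iso_def bij_betw_def)
  then show ?thesis using \<phi>(2) by blast
qed

lemma (in field) compositum_subfield:
  assumes "subfield E R" "subfield L R"
  shows "subfield (compositum R E L) R" "E \<subseteq> compositum R E L" "L \<subseteq> compositum R E L"
    and "\<And>M. subfield M R \<Longrightarrow> E \<subseteq> M \<Longrightarrow> L \<subseteq> M \<Longrightarrow> compositum R E L \<subseteq> M"
proof -
  have c: "E \<union> L \<subseteq> carrier R" using subfieldE(3)[OF assms(1)] subfieldE(3)[OF assms(2)] by blast
  show "subfield (compositum R E L) R" "E \<subseteq> compositum R E L" "L \<subseteq> compositum R E L"
    unfolding compositum_def using generate_field_is_subfield[OF c] generate_field.incl[of _ "E \<union> L" R]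
    by auto
  show "compositum R E L \<subseteq> M" if "subfield M R" "E \<subseteq> M" "L \<subseteq> M" for M
    unfolding compositum_def using generate_field_min_subfield1[OF c that(1)] that(2,3) by blast
qed

text \<open>A homomorphism out of a field is injective with a subfield as image. That subfield
  contains \<open>E\<close> and \<open>L\<close> and consists of sums of products, so it is the
  compositum.\<close>

lemma (in field) tensor_field_iso_compositum:
  assumes E: "subfield E R" "K \<subseteq> E" and L: "subfield L R" "K \<subseteq> L"
    and T: "field (tensor_ring R K E L)"
  shows "\<exists>\<phi>\<in>ring_iso (tensor_ring R K E L) (R\<lparr>carrier := compositum R E L\<rparr>).
    \<forall>x\<in>E. \<forall>y\<in>L. \<phi> (pure_tensor R K E L x y) = x \<otimes> y"
proof -
  interpret T: tensor R K E L
    by (intro tensor.intro tensor_axioms.intro is_cring subfieldE(1) E L)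
  note C = compositum_subfield[OF E(1) L(1)]
  have Er: "E \<subseteq> carrier R" and Lr: "L \<subseteq> carrier R" using subfieldE(3) E(1) L(1) by auto
  have "(\<lambda>x. x) \<in> ring_hom (R\<lparr>carrier := E\<rparr>) R" "(\<lambda>x. x) \<in> ring_hom (R\<lparr>carrier := L\<rparr>) R"
    using Er Lr by (auto intro!: ring_hom_memI)
  from T.tensor_universal[OF is_cring this] obtain \<phi> where
    \<phi>: "\<phi> \<in> ring_hom T.T R" "\<And>a b. a \<in> E \<Longrightarrow> b \<in> L \<Longrightarrow> \<phi> (T.pt a b) = a \<otimes> b"
    by auto
  interpret h: ring_hom_ring T.T R \<phi>
    using ring_hom_ringI2[OF T.T.ring_axioms ring_axioms \<phi>(1)] .
  have Tc: "subfield (carrier T.T) T.T" using field.carrier_is_subfield[OF T] .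
  note im = h.img_is_subfield[OF Tc one_not_zero]
  have "\<phi> ` carrier T.T = compositum R E L"
  proof
    show "\<phi> ` carrier T.T \<subseteq> compositum R E L"
    proof
      fix y assume "y \<in> \<phi> ` carrier T.T"
      then obtain z where z: "z \<in> carrier T.T" "y = \<phi> z" by blast
      obtain xs where xs: "set xs \<subseteq> E \<times> L" "z = list_sum T.T (\<lambda>(a, b). T.pt a b) xs"
        using T.tensor_exists_sum[OF z(1)] by blast
      have cl: "p \<in> E \<times> L" if "p \<in> set xs" for p using that xs(1) by blast
      have "y = list_sum R (\<lambda>p. \<phi> (case p of (a, b) \<Rightarrow> T.pt a b)) xs"
        unfolding z(2) xs(2)
      proof (rule hom_list_sum[OF \<phi>(1) T.T.ring_axioms ring_axioms])
        fix p assume "p \<in> set xs"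
        then have "p \<in> E \<times> L" using cl by blast
        then show "(case p of (a, b) \<Rightarrow> T.pt a b) \<in> carrier T.T"
          using T.pt_closed by auto
      qed
      also have "\<dots> \<in> compositum R E L"
      proof (rule list_sum_subring[OF subfieldE(1)[OF C(1)]])
        fix p assume "p \<in> set xs"
        then obtain a b where "p = (a, b)" "a \<in> E" "b \<in> L" using cl by blast
        then show "\<phi> (case p of (a, b) \<Rightarrow> T.pt a b) \<in> compositum R E L"
          using \<phi>(2) subringE(6)[OF subfieldE(1)[OF C(1)] subsetD[OF C(2)] subsetD[OF C(3)], of a b]
          by simp
      qed
      finally show "y \<in> compositum R E L" .
    qed
    have "x \<in> \<phi> ` carrier T.T" if x: "x \<in> E" for x
    proof -
      have "\<phi> (T.pt x \<one>) = x" using \<phi>(2)[OF x T.B_closed(2)] x Er by auto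
      then show ?thesis using T.pt_closed[OF x T.B_closed(2)] by (metis imageI)
    qed
    moreover have "x \<in> \<phi> ` carrier T.T" if x: "x \<in> L" for x
    proof -
      have "\<phi> (T.pt \<one> x) = x" using \<phi>(2)[OF T.A_closed(2) x] x Lr by auto
      then show ?thesis using T.pt_closed[OF T.A_closed(2) x] by (metis imageI)
    qed
    ultimately show "compositum R E L \<subseteq> \<phi> ` carrier T.T"
      using C(4)[OF im(2)] by blast
  qed
  then have "\<phi> \<in> ring_iso T.T (R\<lparr>carrier := compositum R E L\<rparr>)"
    using im(1) ring_hom_memE[OF \<phi>(1)]
    by (auto simp: ring_iso_def bij_betw_def intro!: ring_hom_memI)
  then show ?thesis using \<phi>(2) by blast
qed

section \<open>Transport of Galois extensions along isomorphisms\<close>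

text \<open>Conjugation by an isomorphism. Both directions \<open>\<phi>\<close> and
  \<open>\<psi>\<close> are explicit, which makes the statement symmetric, so that it also yields
  the inverse map of Galois groups.\<close>

lemma galois_group_transport:
  assumes \<phi>: "\<phi> \<in> ring_hom (R\<lparr>carrier := F\<rparr>) (S\<lparr>carrier := F'\<rparr>)"
    and \<psi>: "\<psi> \<in> ring_hom (S\<lparr>carrier := F'\<rparr>) (R\<lparr>carrier := F\<rparr>)"
    and inv: "\<And>x. x \<in> F \<Longrightarrow> \<psi> (\<phi> x) = x" "\<And>y. y \<in> F' \<Longrightarrow> \<phi> (\<psi> y) = y"
    and K: "K \<subseteq> F" and F': "subring F' S" and \<theta>: "\<theta> \<in> carrier (galois_group R K F)"
  shows "(\<lambda>y\<in>F'. \<phi> (\<theta> (\<psi> y))) \<in> carrier (galois_group S (\<phi> ` K) F')"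
proof -
  note p = ring_hom_memE[OF \<phi>, simplified] and q = ring_hom_memE[OF \<psi>, simplified]
  note t = galois_groupD[OF \<theta>]
  have "bij_betw (\<lambda>y\<in>F'. \<phi> (\<theta> (\<psi> y))) F' F'"
  proof (intro bij_betw_imageI inj_onI)
    fix x y assume xy: "x \<in> F'" "y \<in> F'" "(\<lambda>y\<in>F'. \<phi> (\<theta> (\<psi> y))) x = (\<lambda>y\<in>F'. \<phi> (\<theta> (\<psi> y))) y"
    then have "\<theta> (\<psi> x) = \<theta> (\<psi> y)" using inv(1) t(1) q(1) by (metis restrict_apply')
    then have "\<psi> x = \<psi> y" using inj_onD[OF t(8)] q(1) xy by blast
    then show "x = y" using inv(2) xy by metis
  next
    show "(\<lambda>y\<in>F'. \<phi> (\<theta> (\<psi> y))) ` F' = F'"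
    proof (intro equalityI subsetI)
      fix y assume "y \<in> (\<lambda>y\<in>F'. \<phi> (\<theta> (\<psi> y))) ` F'"
      then show "y \<in> F'" using p(1) t(1) q(1) by auto
    next
      fix y assume y: "y \<in> F'"
      then obtain x where x: "x \<in> F" "\<psi> y = \<theta> x" using t(7) q(1) by blast
      then have "\<phi> (\<theta> (\<psi> (\<phi> x))) = y" using inv y by metis
      then show "y \<in> (\<lambda>y\<in>F'. \<phi> (\<theta> (\<psi> y))) ` F'" using p(1)[OF x(1)] by force
    qed
  qed
  moreover have "(\<lambda>y\<in>F'. \<phi> (\<theta> (\<psi> y))) \<in> ring_hom (S\<lparr>carrier := F'\<rparr>) (S\<lparr>carrier := F'\<rparr>)"
  proof (rule subring_homI)
    fix x y assume xy: "x \<in> F'" "y \<in> F'"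
    have cl: "\<psi> x \<in> F" "\<psi> y \<in> F" "\<theta> (\<psi> x) \<in> F" "\<theta> (\<psi> y) \<in> F"
      using q(1) t(1) xy by auto
    show "(\<lambda>y\<in>F'. \<phi> (\<theta> (\<psi> y))) (x \<otimes>\<^bsub>S\<^esub> y)
        = (\<lambda>y\<in>F'. \<phi> (\<theta> (\<psi> y))) x \<otimes>\<^bsub>S\<^esub> (\<lambda>y\<in>F'. \<phi> (\<theta> (\<psi> y))) y"
      using xy subringE(6)[OF F' xy] q(2)[OF xy] t(2)[OF cl(1,2)] p(2)[OF cl(3,4)] by simp
    show "(\<lambda>y\<in>F'. \<phi> (\<theta> (\<psi> y))) (x \<oplus>\<^bsub>S\<^esub> y)
        = (\<lambda>y\<in>F'. \<phi> (\<theta> (\<psi> y))) x \<oplus>\<^bsub>S\<^esub> (\<lambda>y\<in>F'. \<phi> (\<theta> (\<psi> y))) y"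
      using xy subringE(7)[OF F' xy] q(3)[OF xy] t(3)[OF cl(1,2)] p(3)[OF cl(3,4)] by simp
    show "(\<lambda>y\<in>F'. \<phi> (\<theta> (\<psi> y))) x \<in> F'" using xy cl p(1) by simp
  next
    show "(\<lambda>y\<in>F'. \<phi> (\<theta> (\<psi> y))) \<one>\<^bsub>S\<^esub> = \<one>\<^bsub>S\<^esub>"
      using subringE(3)[OF F'] q(4) t(4) p(4) by simp
  qed
  moreover have "\<forall>y\<in>\<phi> ` K. (\<lambda>y\<in>F'. \<phi> (\<theta> (\<psi> y))) y = y"
    using K p(1) inv(1) t(5) by auto
  ultimately show ?thesis by (simp add: galois_group_iff)
qed

lemma (in field) subfield_of_subfield:
  assumes "subfield F R" "subfield K R" "K \<subseteq> F"
  shows "subfield K (R\<lparr>carrier := F\<rparr>)"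
  using ring.subfield_iff(1)[OF subring_is_ring[OF subfieldE(1)[OF assms(1)]], of K]
    subfield_iff(2)[OF assms(2)] assms(3) by simp

lemma algebraic_carrier_update:
  assumes "field R" "subfield F R"
  shows "ring.algebraic (R\<lparr>carrier := F\<rparr>) K x \<longleftrightarrow> ring.algebraic R K x"
  using ring.transcendental_consistent[OF field.is_ring[OF assms(1)] subfieldE(1)[OF assms(2)]] by simp

text \<open>Each side is a subfield with its own ambient ring, so one statement covers transport
  from the tensor ring, where the subfield is the whole carrier, to a subfield of
  \<open>\<Omega>\<close>, and transport back.\<close>

lemma galois_extension_transport:
  assumes R: "field R" and S: "field S"
    and F: "subfield F R" and F': "subfield F' S"
    and \<phi>: "\<phi> \<in> ring_iso (R\<lparr>carrier := F\<rparr>) (S\<lparr>carrier := F'\<rparr>)"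
    and gal: "galois_extension R K F"
  shows "galois_extension S (\<phi> ` K) F'" "galois_group R K F \<cong> galois_group S (\<phi> ` K) F'"
proof -
  interpret R: field R by fact
  interpret S: field S by fact
  have KF: "K \<subseteq> F" "subfield K R" and alg: "\<And>x. x \<in> F \<Longrightarrow> ring.algebraic R K x"
    and fx: "fixed_field F (carrier (galois_group R K F)) = K"
    using gal unfolding galois_extension_def algebraic_extension_def field_extension_def by blast+
  have Rf: "field (R\<lparr>carrier := F\<rparr>)" and Sf: "field (S\<lparr>carrier := F'\<rparr>)"
    using R.subfield_iff(2)[OF F] S.subfield_iff(2)[OF F'] .
  define \<psi> where "\<psi> = inv_into F \<phi>"
  have bij: "bij_betw \<phi> F F'" and \<phi>h: "\<phi> \<in> ring_hom (R\<lparr>carrier := F\<rparr>) (S\<lparr>carrier := F'\<rparr>)"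
    using \<phi> unfolding ring_iso_def by simp_all
  have \<psi>h: "\<psi> \<in> ring_hom (S\<lparr>carrier := F'\<rparr>) (R\<lparr>carrier := F\<rparr>)"
    using ring_iso_set_sym[OF field.is_ring[OF Rf] \<phi>] by (simp add: ring_iso_def \<psi>_def)
  have inv1: "\<psi> (\<phi> x) = x" if "x \<in> F" for x
    unfolding \<psi>_def using bij_betw_inv_into_left[OF bij that] .
  have inv2: "\<phi> (\<psi> y) = y" if "y \<in> F'" for y
    unfolding \<psi>_def using bij_betw_inv_into_right[OF bij that] .
  have \<phi>F: "\<phi> x \<in> F'" if "x \<in> F" for x using ring_hom_closed[OF \<phi>h] that by simp
  have \<psi>F: "\<psi> y \<in> F" if "y \<in> F'" for y using ring_hom_closed[OF \<psi>h] that by simp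
  let ?K' = "\<phi> ` K"
  have K': "?K' \<subseteq> F'" using \<phi>F KF by blast
  have "\<psi> (\<phi> x) = x" if "x \<in> K" for x using inv1 KF(1) that by blast
  then have \<psi>K': "\<psi> ` ?K' = K" unfolding image_image by simp
  note F1 = subfieldE(1)[OF F] and F1' = subfieldE(1)[OF F']
  let ?G = "galois_group R K F" and ?G' = "galois_group S ?K' F'"
  let ?c = "\<lambda>\<theta>. \<lambda>y\<in>F'. \<phi> (\<theta> (\<psi> y))" and ?d = "\<lambda>\<theta>. \<lambda>x\<in>F. \<psi> (\<theta> (\<phi> x))"
  have c: "?c \<theta> \<in> carrier ?G'" if "\<theta> \<in> carrier ?G" for \<theta>
    using galois_group_transport[OF \<phi>h \<psi>h inv1 inv2 KF(1) F1' that] .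
  have d: "?d \<theta> \<in> carrier ?G" if "\<theta> \<in> carrier ?G'" for \<theta>
    using galois_group_transport[OF \<psi>h \<phi>h inv2 inv1 K' F1 that] \<psi>K' by simp
  have "fixed_field F' (carrier ?G') = ?K'"
  proof
    show "fixed_field F' (carrier ?G') \<subseteq> ?K'"
    proof
      fix y assume y: "y \<in> fixed_field F' (carrier ?G')"
      have yF: "y \<in> F'" using y by (simp add: fixed_field_def)
      have "\<theta> (\<psi> y) = \<psi> y" if t: "\<theta> \<in> carrier ?G" for \<theta>
      proof -
        have "?c \<theta> y = y" using fixed_fieldD(2)[OF y c[OF t]] .
        then have "\<phi> (\<theta> (\<psi> y)) = y" using yF by simp
        then show ?thesis using inv1[OF galois_groupD(1)[OF t \<psi>F[OF yF]]] by simp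
      qed
      then have "\<psi> y \<in> K" using fixed_fieldI[OF \<psi>F[OF yF]] fx by blast
      then have "\<phi> (\<psi> y) \<in> ?K'" by (rule imageI)
      then show "y \<in> ?K'" using inv2[OF yF] by simp
    qed
    show "?K' \<subseteq> fixed_field F' (carrier ?G')"
      by (intro subsetI fixed_fieldI galois_groupD(5) subsetD[OF K'])
  qed
  moreover have "subfield ?K' S"
  proof -
    interpret h: ring_hom_ring "R\<lparr>carrier := F\<rparr>" "S\<lparr>carrier := F'\<rparr>" \<phi>
      using ring_hom_ringI2[OF field.is_ring[OF Rf] field.is_ring[OF Sf] \<phi>h] .
    have "subfield ?K' (S\<lparr>carrier := F'\<rparr>)"
      using h.img_is_subfield(2)[OF R.subfield_of_subfield[OF F KF(2,1)]] S.one_not_zero by simp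
    then have "field (S\<lparr>carrier := ?K'\<rparr>)" using h.S.subfield_iff(2) by simp
    then show ?thesis using S.subfield_iff(1) K' subfieldE(3)[OF F'] by blast
  qed
  moreover have "ring.algebraic S ?K' y" if y: "y \<in> F'" for y
  proof -
    have "((ring.algebraic (S\<lparr>carrier := F'\<rparr>)) over ?K') (\<phi> (\<psi> y))"
      using algebraic_hom[OF \<phi>h Rf Sf R.subfield_of_subfield[OF F KF(2,1)], of "\<psi> y"] \<psi>F[OF y]
        algebraic_carrier_update[OF R F] alg[OF \<psi>F[OF y]] by (simp add: over_def)
    then show ?thesis using algebraic_carrier_update[OF S F'] inv2[OF y] by (simp add: over_def)
  qed
  ultimately show "galois_extension S ?K' F'"
    using F' K' by (simp add: galois_extension_def algebraic_extension_def field_extension_def)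
  have "?c \<in> hom ?G ?G'"
  proof (rule homI)
    fix \<theta> \<tau> assume t: "\<theta> \<in> carrier ?G" "\<tau> \<in> carrier ?G"
    show "?c (\<theta> \<otimes>\<^bsub>?G\<^esub> \<tau>) = ?c \<theta> \<otimes>\<^bsub>?G'\<^esub> ?c \<tau>"
      unfolding galois_group_mult[OF t] galois_group_mult[OF c[OF t(1)] c[OF t(2)]]
      using inv1[OF galois_groupD(1)[OF t(2) \<psi>F]] \<phi>F[OF galois_groupD(1)[OF t(2) \<psi>F]] \<psi>F
      by (auto simp: compose_def fun_eq_iff)
  qed (use c in auto)
  moreover have "bij_betw ?c (carrier ?G) (carrier ?G')"
  proof (rule bij_betw_byWitness[where f' = ?d])
    show "\<forall>\<theta>\<in>carrier ?G. ?d (?c \<theta>) = \<theta>"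
    proof
      fix \<theta> assume t: "\<theta> \<in> carrier ?G"
      show "?d (?c \<theta>) = \<theta>"
        using inv1 \<phi>F galois_groupD(1)[OF t] by (intro galois_group_ext[OF d[OF c[OF t]] t]) simp
    qed
    show "\<forall>\<theta>\<in>carrier ?G'. ?c (?d \<theta>) = \<theta>"
    proof
      fix \<theta> assume t: "\<theta> \<in> carrier ?G'"
      show "?c (?d \<theta>) = \<theta>"
        using inv2 \<psi>F galois_groupD(1)[OF t] by (intro galois_group_ext[OF c[OF d[OF t]] t]) simp
    qed
  qed (use c d in auto)
  ultimately show "?G \<cong> ?G'" unfolding is_iso_def iso_def by blast
qed

section \<open>Finite Galois subextensions\<close>

lemma galois_extensionD:
  assumes "galois_extension R K F"
  shows "subfield K R" "subfield F R" "K \<subseteq> F"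
    and "\<And>x. x \<in> F \<Longrightarrow> ring.algebraic R K x"
    and "fixed_field F (carrier (galois_group R K F)) = K"
  using assms unfolding galois_extension_def algebraic_extension_def field_extension_def by blast+

lemma galois_extensionI:
  assumes "subfield K R" "subfield F R" "K \<subseteq> F"
    and "\<And>x. x \<in> F \<Longrightarrow> ring.algebraic R K x"
    and "\<And>x. x \<in> F \<Longrightarrow> (\<And>\<theta>. \<theta> \<in> carrier (galois_group R K F) \<Longrightarrow> \<theta> x = x) \<Longrightarrow> x \<in> K"
  shows "galois_extension R K F"
proof -
  have "fixed_field F (carrier (galois_group R K F)) \<subseteq> K"
  proof
    fix x assume x: "x \<in> fixed_field F (carrier (galois_group R K F))"
    show "x \<in> K"
    proof (rule assms(5))
      show "\<theta> x = x" if t: "\<theta> \<in> carrier (galois_group R K F)" for \<theta> using fixed_fieldD(2)[OF x t] .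
    qed (rule fixed_fieldD(1)[OF x])
  qed
  moreover have "K \<subseteq> fixed_field F (carrier (galois_group R K F))"
    by (intro subsetI fixed_fieldI galois_groupD(5) subsetD[OF assms(3)])
  ultimately show ?thesis
    using assms(1-4) unfolding galois_extension_def algebraic_extension_def field_extension_def by blast
qed

lemma (in field) finite_galoisI:
  assumes "galois_extension R K F" "finite (carrier (galois_group R K F))"
  shows "finite_galois R K F (carrier (galois_group R K F))"
proof -
  note g = galois_extensionD[OF assms(1)]
  interpret G: group "galois_group R K F" using group_galois_group[OF subfieldE(1)[OF g(2)] g(3)] .
  show ?thesis
    by (intro finite_galois.intro finite_galois_axioms.intro field_axioms g assms(2) G.subgroup_self)
qed

context field begin

text \<open>Reduces stability of a generated field under \<open>\<theta>\<close> to a check on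
  generators.\<close>

lemma hom_vimage_subfield:
  assumes \<theta>: "\<theta> \<in> ring_hom (R\<lparr>carrier := D\<rparr>) (R\<lparr>carrier := F\<rparr>)"
    and D: "subfield D R" and F: "subfield F R" and M: "subfield M R"
  shows "subfield {x \<in> D. \<theta> x \<in> M} R"
proof (rule subfieldI')
  note Dr = subfieldE(1)[OF D] and Fr = subfieldE(1)[OF F] and Mr = subfieldE(1)[OF M]
  note h = subring_homD[OF \<theta>]
  interpret h: ring_hom_ring "R\<lparr>carrier := D\<rparr>" "R\<lparr>carrier := F\<rparr>" \<theta>
    using subring_hom_ring[OF \<theta> Dr Fr] .
  show "subring {x \<in> D. \<theta> x \<in> M} R"
  proof (rule subringI)
    fix x assume x: "x \<in> {x \<in> D. \<theta> x \<in> M}"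
    then have xD: "x \<in> D" "\<theta> x \<in> M" by auto
    have "\<theta> (\<ominus> x) \<oplus> \<theta> x = \<zero>"
      using h(3)[OF subringE(5)[OF Dr xD(1)] xD(1)] xD subfieldE(3)[OF D]
        subring_hom_zero[OF \<theta> Dr Fr] by (simp add: l_neg subsetD)
    moreover have "\<theta> x \<in> carrier R" "\<theta> (\<ominus> x) \<in> carrier R"
      using h(1) xD(1) subringE(5)[OF Dr xD(1)] subfieldE(3)[OF F] by auto
    ultimately have "\<theta> (\<ominus> x) = \<ominus> \<theta> x" by (metis minus_equality)
    then show "\<ominus> x \<in> {x \<in> D. \<theta> x \<in> M}" using xD subringE(5)[OF Dr] subringE(5)[OF Mr] by simp
  next
    show "\<one> \<in> {x \<in> D. \<theta> x \<in> M}" using subringE(3)[OF Dr] subringE(3)[OF Mr] h(4) by simp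
    show "{x \<in> D. \<theta> x \<in> M} \<subseteq> carrier R" using subfieldE(3)[OF D] by blast
    fix x y assume "x \<in> {x \<in> D. \<theta> x \<in> M}" "y \<in> {x \<in> D. \<theta> x \<in> M}"
    then have xy: "x \<in> D" "y \<in> D" "\<theta> x \<in> M" "\<theta> y \<in> M" by auto
    show "x \<otimes> y \<in> {x \<in> D. \<theta> x \<in> M}"
      using subringE(6)[OF Dr xy(1,2)] subringE(6)[OF Mr xy(3,4)] h(2)[OF xy(1,2)] by simp
    show "x \<oplus> y \<in> {x \<in> D. \<theta> x \<in> M}"
      using subringE(7)[OF Dr xy(1,2)] subringE(7)[OF Mr xy(3,4)] h(3)[OF xy(1,2)] by simp
  qed
  fix x assume "x \<in> {x \<in> D. \<theta> x \<in> M} - {\<zero>}"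
  then have x: "x \<in> D" "x \<noteq> \<zero>" "\<theta> x \<in> M" by auto
  have "inv x \<in> D" using subfield_m_inv(1)[OF D] x by simp
  moreover have "\<theta> (inv x) \<in> M"
    using hom_subfield_inv[OF \<theta> D F x(1,2)] subfield_m_inv(1)[OF M] x(3) by simp
  ultimately show "inv x \<in> {x \<in> D. \<theta> x \<in> M}" by simp
qed

lemma galois_group_restrict:
  assumes F: "subfield F R" "K \<subseteq> F" and F': "K \<subseteq> F'" "F' \<subseteq> F"
    and stable: "\<forall>\<theta>\<in>carrier (galois_group R K F). \<forall>x\<in>F'. \<theta> x \<in> F'"
    and \<theta>: "\<theta> \<in> carrier (galois_group R K F)" and F'r: "subfield F' R"
  shows "restrict \<theta> F' \<in> carrier (galois_group R K F')"
proof -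
  interpret G: group "galois_group R K F" using group_galois_group[OF subfieldE(1)[OF F(1)] F(2)] .
  note t = galois_groupD[OF \<theta>]
  have st: "\<tau> x \<in> F'" if "\<tau> \<in> carrier (galois_group R K F)" "x \<in> F'" for \<tau> x
    using bspec[OF bspec[OF stable that(1)] that(2)] .
  have "bij_betw (restrict \<theta> F') F' F'"
  proof (intro bij_betw_imageI inj_onI equalityI subsetI)
    fix x y assume "x \<in> F'" "y \<in> F'" "restrict \<theta> F' x = restrict \<theta> F' y"
    then show "x = y" using inj_onD[OF t(8), of x y] F'(2) by auto
  next
    fix y assume "y \<in> restrict \<theta> F' ` F'"
    then obtain x where "x \<in> F'" "y = \<theta> x" by auto
    then show "y \<in> F'" using st[OF \<theta>] by simp
  next
    fix y assume y: "y \<in> F'"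
    \<comment> \<open>Surjectivity of the restriction: stability is assumed for every group element,
      hence also for the inverse, which provides the preimage inside \<open>F'\<close>.\<close>
    let ?i = "inv\<^bsub>galois_group R K F\<^esub> \<theta>"
    have i: "?i y \<in> F'" using st[OF G.inv_closed[OF \<theta>] y] .
    have "restrict \<theta> F' (?i y) = y"
      using galois_group_inv_apply(1)[OF subfieldE(1)[OF F(1)] F(2) \<theta> subsetD[OF F'(2) y]] i by simp
    then show "y \<in> restrict \<theta> F' ` F'" using imageI[OF i, of "restrict \<theta> F'"] by simp
  qed
  moreover have "restrict \<theta> F' \<in> ring_hom (R\<lparr>carrier := F'\<rparr>) (R\<lparr>carrier := F'\<rparr>)"
  proof (rule subring_homI)
    note r = subringE[OF subfieldE(1)[OF F'r]]
    fix x y assume xy: "x \<in> F'" "y \<in> F'"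
    then have xyF: "x \<in> F" "y \<in> F" using F'(2) by auto
    show "restrict \<theta> F' (x \<otimes> y) = restrict \<theta> F' x \<otimes> restrict \<theta> F' y"
      using xy r(6)[OF xy] t(2)[OF xyF] by simp
    show "restrict \<theta> F' (x \<oplus> y) = restrict \<theta> F' x \<oplus> restrict \<theta> F' y"
      using xy r(7)[OF xy] t(3)[OF xyF] by simp
    show "restrict \<theta> F' x \<in> F'" using xy st[OF \<theta>] by simp
  next
    show "restrict \<theta> F' \<one> = \<one>" using subringE(3)[OF subfieldE(1)[OF F'r]] t(4) by simp
  qed
  moreover have "\<forall>x\<in>K. restrict \<theta> F' x = x" using t(5) F'(1) by auto
  ultimately show ?thesis by (simp add: galois_group_iff)
qed

text \<open>By stability, automorphisms of \<open>F\<close> restrict to automorphisms of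
  \<open>F'\<close>; an element fixed by all of \<open>Gal(F'/K)\<close> is thus fixed by
  \<open>Gal(F/K)\<close> and lies in \<open>K\<close>.\<close>

lemma galois_extension_stable:
  assumes gal: "galois_extension R K F" and F': "subfield F' R" "K \<subseteq> F'" "F' \<subseteq> F"
    and stable: "\<forall>\<theta>\<in>carrier (galois_group R K F). \<forall>x\<in>F'. \<theta> x \<in> F'"
  shows "galois_extension R K F'"
proof (rule galois_extensionI)
  note g = galois_extensionD[OF gal]
  fix x assume x: "x \<in> F'"
    and fx: "\<And>\<theta>. \<theta> \<in> carrier (galois_group R K F') \<Longrightarrow> \<theta> x = x"
  have "\<theta> x = x" if t: "\<theta> \<in> carrier (galois_group R K F)" for \<theta>
    using fx[OF galois_group_restrict[OF g(2,3) F'(2,3) stable t F'(1)]] x by simp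
  then have "x \<in> fixed_field F (carrier (galois_group R K F))"
    by (intro fixed_fieldI subsetD[OF F'(3) x])
  then show "x \<in> K" using g(5) by simp
next
  fix x assume "x \<in> F'" then show "ring.algebraic R K x" using galois_extensionD(4)[OF gal] F'(3) by blast
qed (use galois_extensionD(1)[OF gal] F' in auto)

text \<open>Every conjugate of \<open>x\<close> is a root of one nonzero polynomial over
  \<open>K\<close> that annihilates \<open>x\<close>.\<close>

lemma finite_orbit:
  assumes "algebraic_extension R K F" "x \<in> F"
  shows "finite ((\<lambda>\<theta>. \<theta> x) ` carrier (galois_group R K F))"
proof -
  have K: "subfield K R" and F: "subfield F R" and KF: "K \<subseteq> F"
    and alg: "(algebraic over K) x"
    using assms unfolding algebraic_extension_def field_extension_def over_def by blast+
  have Fc: "F \<subseteq> carrier R" using subfieldE(3)[OF F] .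
  have xc: "x \<in> carrier R" using Fc assms(2) by blast
  obtain p where p: "p \<in> carrier (K[X])" "p \<noteq> []" "eval p x = \<zero>"
    using algebraicE[OF subfieldE(1)[OF K] xc alg] by blast
  have setp: "set p \<subseteq> K" using p(1,2) unfolding univ_poly_def polynomial_def by auto
  have pc: "p \<in> carrier (poly_ring R)"
    using carrier_polynomial[OF subfieldE(1)[OF K]] p(1) unfolding univ_poly_carrier[symmetric] by blast
  have "is_root p (\<theta> x)" if t: "\<theta> \<in> carrier (galois_group R K F)" for \<theta>
  proof -
    note h = galois_groupD[OF t]
    have hom: "\<theta> \<in> ring_hom (R\<lparr>carrier := F\<rparr>) R"
      using subring_hom_mono[OF h(6) order_refl Fc] by simp
    interpret h: ring_hom_ring "R\<lparr>carrier := F\<rparr>" R \<theta>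
      using ring_hom_ringI2[OF subring_is_ring[OF subfieldE(1)[OF F]] ring_axioms hom] .
    have "map \<theta> p = p" using setp h(5) by (intro map_idI) blast
    moreover have "\<theta> (ring.eval (R\<lparr>carrier := F\<rparr>) p x) = eval (map \<theta> p) (\<theta> x)"
      using assms(2) setp KF by (intro h.eval_hom') auto
    ultimately have "eval p (\<theta> x) = \<zero>"
      using eval_consistent[OF subfieldE(1)[OF F]] p(3) h.hom_zero by simp
    then show ?thesis using p(2) h(1)[OF assms(2)] Fc unfolding is_root_def by blast
  qed
  then have "(\<lambda>\<theta>. \<theta> x) ` carrier (galois_group R K F) \<subseteq> {y. is_root p y}" by blast
  then show ?thesis using finite_number_of_roots[OF pc] by (rule finite_subset)
qed

text \<open>Lets equality of homomorphisms on a generated field be checked on generators.\<close>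

lemma hom_equalizer_subfield:
  assumes \<theta>: "\<theta> \<in> ring_hom (R\<lparr>carrier := F\<rparr>) (R\<lparr>carrier := F\<rparr>)"
    and \<tau>: "\<tau> \<in> ring_hom (R\<lparr>carrier := F\<rparr>) (R\<lparr>carrier := F\<rparr>)" and F: "subfield F R"
  shows "subfield {x \<in> F. \<theta> x = \<tau> x} R"
proof (rule subfieldI')
  note Fr = subfieldE(1)[OF F]
  note h = subring_homD[OF \<theta>] and k = subring_homD[OF \<tau>]
  interpret h: ring_hom_ring "R\<lparr>carrier := F\<rparr>" "R\<lparr>carrier := F\<rparr>" \<theta>
    using subring_hom_ring[OF \<theta> Fr Fr] .
  show "subring {x \<in> F. \<theta> x = \<tau> x} R"
  proof (rule subringI)
    fix x assume "x \<in> {x \<in> F. \<theta> x = \<tau> x}"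
    then have x: "x \<in> F" "\<theta> x = \<tau> x" by auto
    have n: "\<ominus> x \<in> F" using subringE(5)[OF Fr x(1)] .
    have z: "\<ominus> x \<oplus> x = \<zero>" using x(1) subfieldE(3)[OF F] by (simp add: l_neg subsetD)
    have c: "\<theta> (\<ominus> x) \<in> carrier R" "\<tau> (\<ominus> x) \<in> carrier R" "\<tau> x \<in> carrier R"
      using h(1) k(1) n x(1) subfieldE(3)[OF F] by auto
    have "\<theta> (\<ominus> x) \<oplus> \<tau> x = \<tau> (\<ominus> x) \<oplus> \<tau> x"
      using h(3)[OF n x(1)] k(3)[OF n x(1)] z x(2)
        subring_hom_zero[OF \<theta> Fr Fr] subring_hom_zero[OF \<tau> Fr Fr] by simp
    then have "\<theta> (\<ominus> x) = \<tau> (\<ominus> x)" using c by simp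
    then show "\<ominus> x \<in> {x \<in> F. \<theta> x = \<tau> x}" using n by simp
  next
    show "\<one> \<in> {x \<in> F. \<theta> x = \<tau> x}" using subringE(3)[OF Fr] h(4) k(4) by simp
    show "{x \<in> F. \<theta> x = \<tau> x} \<subseteq> carrier R" using subfieldE(3)[OF F] by blast
    fix x y assume "x \<in> {x \<in> F. \<theta> x = \<tau> x}" "y \<in> {x \<in> F. \<theta> x = \<tau> x}"
    then have xy: "x \<in> F" "y \<in> F" "\<theta> x = \<tau> x" "\<theta> y = \<tau> y" by auto
    show "x \<otimes> y \<in> {x \<in> F. \<theta> x = \<tau> x}"
      using subringE(6)[OF Fr xy(1,2)] h(2)[OF xy(1,2)] k(2)[OF xy(1,2)] xy(3,4) by simp
    show "x \<oplus> y \<in> {x \<in> F. \<theta> x = \<tau> x}"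
      using subringE(7)[OF Fr xy(1,2)] h(3)[OF xy(1,2)] k(3)[OF xy(1,2)] xy(3,4) by simp
  qed
  fix x assume "x \<in> {x \<in> F. \<theta> x = \<tau> x} - {\<zero>}"
  then have x: "x \<in> F" "x \<noteq> \<zero>" "\<theta> x = \<tau> x" by auto
  then show "inv x \<in> {x \<in> F. \<theta> x = \<tau> x}"
    using hom_subfield_inv(2)[OF \<theta> F F x(1,2)] hom_subfield_inv(2)[OF \<tau> F F x(1,2)]
      subfield_m_inv(1)[OF F] by simp
qed

text \<open>Adjoining whole orbits makes the generating set stable under the group, hence
  \<open>F'\<close> too, so \<open>F'\<close> is Galois over \<open>K\<close>. Besides bounding
  groups, this reduces questions about an infinite Galois extension to the finite case.\<close>

lemma finite_galois_subextension:
  assumes gal: "galois_extension R K F" and Y: "finite Y" "Y \<subseteq> F"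
  defines "F' \<equiv> generate_field R (K \<union> (\<Union>x\<in>Y. (\<lambda>\<theta>. \<theta> x) ` carrier (galois_group R K F)))"
  shows "galois_extension R K F'" "finite (carrier (galois_group R K F'))" "Y \<subseteq> F'" "F' \<subseteq> F"
proof -
  note g = galois_extensionD[OF gal]
  interpret G: group "galois_group R K F" using group_galois_group[OF subfieldE(1)[OF g(2)] g(3)] .
  let ?G = "carrier (galois_group R K F)"
  define S where "S = (\<Union>x\<in>Y. (\<lambda>\<theta>. \<theta> x) ` ?G)"
  have F'_eq: "F' = generate_field R (K \<union> S)" by (simp add: F'_def S_def)
  have alg: "algebraic_extension R K F" using gal by (simp add: galois_extension_def)
  have SF: "S \<subseteq> F"
  proof
    fix s assume "s \<in> S"
    then obtain x \<theta> where x: "x \<in> Y" "\<theta> \<in> ?G" "s = \<theta> x" unfolding S_def by blast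
    show "s \<in> F" unfolding x(3) using galois_groupD(1)[OF x(2) subsetD[OF Y(2) x(1)]] .
  qed
  have finS: "finite S" unfolding S_def by (intro finite_UN_I Y(1) finite_orbit[OF alg] subsetD[OF Y(2)])
  have gen: "K \<union> S \<subseteq> carrier R" using g(3) SF subfieldE(3)[OF g(2)] by blast
  have F': "subfield F' R" unfolding F'_eq using generate_field_is_subfield[OF gen] .
  have genF': "K \<union> S \<subseteq> F'" unfolding F'_eq by (intro subsetI generate_field.incl)
  have minF': "F' \<subseteq> M" if "subfield M R" "K \<union> S \<subseteq> M" for M
    unfolding F'_eq using generate_field_min_subfield1[OF gen that] .
  show F'F: "F' \<subseteq> F" using minF'[OF g(2)] g(3) SF by blast
  have KF': "K \<subseteq> F'" using genF' by blast
  show "Y \<subseteq> F'"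
  proof
    fix y assume y: "y \<in> Y"
    have "(\<one>\<^bsub>galois_group R K F\<^esub>) y = y" using y Y(2) by (simp add: galois_group_one subsetD)
    moreover have "(\<one>\<^bsub>galois_group R K F\<^esub>) y \<in> S"
      unfolding S_def using y G.one_closed by (intro UN_I[of y] imageI)
    ultimately have "y \<in> S" by simp
    then show "y \<in> F'" using genF' by blast
  qed
  have Sstable: "\<theta> s \<in> S" if t: "\<theta> \<in> ?G" and s: "s \<in> S" for \<theta> s
  proof -
    obtain x \<tau> where x: "x \<in> Y" "\<tau> \<in> ?G" "s = \<tau> x" using s unfolding S_def by blast
    have "(\<theta> \<otimes>\<^bsub>galois_group R K F\<^esub> \<tau>) x = \<theta> s"
      using x Y(2) galois_group_mult[OF t x(2)] by (simp add: compose_def subsetD)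
    moreover have "(\<theta> \<otimes>\<^bsub>galois_group R K F\<^esub> \<tau>) x \<in> S"
      unfolding S_def using x(1) G.m_closed[OF t x(2)] by (intro UN_I[of x] imageI)
    ultimately show ?thesis by simp
  qed
  have stable: "\<forall>\<theta>\<in>?G. \<forall>x\<in>F'. \<theta> x \<in> F'"
  proof (intro ballI)
    fix \<theta> x assume t: "\<theta> \<in> ?G" and x: "x \<in> F'" 
    have "K \<union> S \<subseteq> {x \<in> F. \<theta> x \<in> F'}"
    proof
      fix s assume s: "s \<in> K \<union> S"
      have "\<theta> s \<in> K \<union> S"
      proof (cases "s \<in> S")
        case False
        then show ?thesis using s galois_groupD(5)[OF t, of s] by simp
      qed (use Sstable[OF t] in simp)
      then have "s \<in> F" "\<theta> s \<in> F'" using s genF' F'F by blast+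
      then show "s \<in> {x \<in> F. \<theta> x \<in> F'}" by simp
    qed
    then have "F' \<subseteq> {x \<in> F. \<theta> x \<in> F'}"
      using minF' hom_vimage_subfield[OF galois_groupD(6)[OF t] g(2) g(2) F'] by blast
    then show "\<theta> x \<in> F'" using x by blast
  qed
  show gal': "galois_extension R K F'"
    using galois_extension_stable[OF gal F' KF' F'F stable] .
  let ?G' = "carrier (galois_group R K F')"
  have alg': "algebraic_extension R K F'" using gal' by (simp add: galois_extension_def)
  \<comment> \<open>An automorphism of \<open>F'\<close> over \<open>K\<close> is determined by its
    restriction to the finite set \<open>S\<close>, and each value on \<open>S\<close> ranges over a
    finite orbit; the extensional product collects all candidates.\<close>
  have fin: "finite (PiE S (\<lambda>s. (\<lambda>\<theta>. \<theta> s) ` ?G'))"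
    by (intro finite_PiE finS finite_orbit[OF alg'] subsetD[OF genF'] UnI2)
  have "inj_on (\<lambda>\<theta>. restrict \<theta> S) ?G'"
  proof (rule inj_onI)
    fix \<theta> \<tau> assume t: "\<theta> \<in> ?G'" "\<tau> \<in> ?G'" "restrict \<theta> S = restrict \<tau> S"
    have "\<theta> s = \<tau> s" if "s \<in> K \<union> S" for s
    proof (cases "s \<in> S")
      case True
      then show ?thesis using fun_cong[OF t(3), of s] by simp
    next
      case False
      then show ?thesis using that galois_groupD(5)[OF t(1), of s] galois_groupD(5)[OF t(2), of s] by simp
    qed
    then have "K \<union> S \<subseteq> {x \<in> F'. \<theta> x = \<tau> x}" using genF' by blast
    then have "F' \<subseteq> {x \<in> F'. \<theta> x = \<tau> x}"
      using minF' hom_equalizer_subfield[OF galois_groupD(6)[OF t(1)] galois_groupD(6)[OF t(2)] F'] by blast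
    then show "\<theta> = \<tau>" using galois_group_ext[OF t(1,2)] by blast
  qed
  moreover have "(\<lambda>\<theta>. restrict \<theta> S) ` ?G' \<subseteq> PiE S (\<lambda>s. (\<lambda>\<theta>. \<theta> s) ` ?G')" by auto
  ultimately show "finite ?G'" using finite_imageD[OF finite_subset[OF _ fin]] by blast
qed

end

section \<open>Complements and potentially Galois fields\<close>

text \<open>A basis serves: a field containing \<open>K\<close> and the basis is a
  \<open>K\<close>-subalgebra, so it contains the span. Of the degree, only this finite generation
  is carried forward.\<close>

lemma (in field) finite_dimension_generators:
  assumes "subfield K R" "dimension n K E"
  shows "\<exists>Y. finite Y \<and> Y \<subseteq> E \<and> (\<forall>F. subfield F R \<longrightarrow> K \<subseteq> F \<longrightarrow> Y \<subseteq> F \<longrightarrow> E \<subseteq> F)"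
proof -
  obtain Us where Us: "set Us \<subseteq> carrier R" "Span K Us = E"
    using exists_base[OF assms] by blast
  have "E \<subseteq> F" if F: "subfield F R" "K \<subseteq> F" "set Us \<subseteq> F" for F
  proof -
    have "subalgebra K F R"
      using subring.axioms(1)[OF subfieldE(1)[OF F(1)]] subringE(6)[OF subfieldE(1)[OF F(1)]] F(2)
      by (intro subalgebra.intro subalgebra_axioms.intro) blast+
    then show ?thesis using subalgebra_Span_incl[OF assms(1) _ F(3)] Us(2) by simp
  qed
  moreover have "set Us \<subseteq> E" using Span_base_incl[OF assms(1) Us(1)] Us(2) by simp
  ultimately show ?thesis by (intro exI[of _ "set Us"]) simp
qed

text \<open>The Galois groups over \<open>K\<close> and over the larger base share composition and
  identity, so \<open>U\<close> is a subgroup of the second one as well; this re-enters the locale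
  over the fixed field of \<open>U\<close>.\<close>

lemma (in finite_galois) subgroup_fixed_field:
  assumes U: "subgroup U (galois_group R K F)" "U \<subseteq> G"
  shows "finite_galois R (fixed_field F U) F U"
proof -
  let ?L = "fixed_field F U"
  have LF: "?L \<subseteq> F" by (rule subsetI) (rule fixed_fieldD(1))
  interpret L: group "galois_group R ?L F" using group_galois_group[OF F_ring LF] .
  have KL: "K \<subseteq> ?L"
  proof
    fix x assume x: "x \<in> K"
    show "x \<in> ?L"
    proof (rule fixed_fieldI)
      fix \<theta> assume t: "\<theta> \<in> U"
      show "\<theta> x = x" using galois_groupD(5)[OF G_mem[OF subsetD[OF U(2) t]] x] .
    qed (rule subsetD[OF KF x])
  qed
  have UL: "\<theta> \<in> carrier (galois_group R ?L F)" if t: "\<theta> \<in> U" for \<theta>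
  proof -
    have "\<forall>x\<in>?L. \<theta> x = x" by (intro ballI fixed_fieldD(2)[OF _ t])
    then show ?thesis using G_mem[OF subsetD[OF U(2) t]] unfolding galois_group_iff by simp
  qed
  have "subgroup U (galois_group R ?L F)"
  proof (rule L.subgroupI)
    show "U \<subseteq> carrier (galois_group R ?L F)" using UL by blast
    show "U \<noteq> {}" using subgroup.one_closed[OF U(1)] by blast
    fix \<theta> assume t: "\<theta> \<in> U"
    let ?i = "inv\<^bsub>galois_group R K F\<^esub> \<theta>"
    have i: "?i \<in> U" using subgroup.m_inv_closed[OF U(1) t] .
    have "?i \<otimes>\<^bsub>galois_group R ?L F\<^esub> \<theta> = \<one>\<^bsub>galois_group R ?L F\<^esub>"
      using Gal.l_inv[OF G_mem[OF subsetD[OF U(2) t]]]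
      unfolding galois_group_mult[OF UL[OF i] UL[OF t]] galois_group_one
        galois_group_mult[OF G_mem[OF subsetD[OF U(2) i]] G_mem[OF subsetD[OF U(2) t]]] .
    then have "inv\<^bsub>galois_group R ?L F\<^esub> \<theta> = ?i" by (rule L.inv_equality[OF _ UL[OF t] UL[OF i]])
    then show "inv\<^bsub>galois_group R ?L F\<^esub> \<theta> \<in> U" using i by simp
  next
    fix \<theta> \<tau> assume t: "\<theta> \<in> U" "\<tau> \<in> U"
    show "\<theta> \<otimes>\<^bsub>galois_group R ?L F\<^esub> \<tau> \<in> U"
      using subgroup.m_closed[OF U(1) t]
      unfolding galois_group_mult[OF UL[OF t(1)] UL[OF t(2)]]
        galois_group_mult[OF G_mem[OF subsetD[OF U(2) t(1)]] G_mem[OF subsetD[OF U(2) t(2)]]] .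
  qed
  then show ?thesis
    by (intro finite_galois.intro finite_galois_axioms.intro field_axioms F LF
        finite_subset[OF U(2) fin] refl)
qed

lemma (in finite_galois) galois_extension:
  assumes "\<And>x. x \<in> F \<Longrightarrow> ring.algebraic R K x"
  shows "galois_extension R K F"
  using F KF K_subfield assms fixed group_eq_galois_group
  unfolding galois_extension_def algebraic_extension_def field_extension_def by metis

section \<open>The extension \<open>E/k\<close>, its Galois closure \<open>M\<close>, and finiteness
  of \<open>Gal(M/k)\<close>\<close>

locale galois_closed_extension = field R for R (structure) +
  fixes k E M :: "'a set" and n :: nat
  assumes kE: "field_extension R k E" and dim: "dimension n k E"
    and closure: "galois_closure R k E M"
begin

abbreviation (input) "\<Gamma> \<equiv> galois_group R k M"
abbreviation (input) "\<G> \<equiv> galois_complements R k E M"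
abbreviation (input) "\<L> \<equiv> pot_galois_fields R k E"
abbreviation (input) "res \<equiv> restricted_galois R E M"

lemma k: "subfield k R" and E: "subfield E R" and k_E: "k \<subseteq> E"
  using kE unfolding field_extension_def by blast+

lemma galois_M: "galois_extension R k M" and E_M: "E \<subseteq> M"
  using closure unfolding galois_closure_def by blast+

lemma M: "subfield M R" and k_M: "k \<subseteq> M"
  using galois_extensionD[OF galois_M] by blast+

lemma E_carrier: "x \<in> E \<Longrightarrow> x \<in> carrier R" and M_carrier: "x \<in> M \<Longrightarrow> x \<in> carrier R"
  using subfieldE(3)[OF E] subfieldE(3)[OF M] by blast+

text \<open>A single choice of finite field generators of \<open>E/k\<close>, fixed so that
  \<open>M\<close> and later \<open>EL\<close> can be described by the same finite set.\<close>

definition gens :: "'a set" where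
  "gens = (SOME Y. finite Y \<and> Y \<subseteq> E \<and> (\<forall>F. subfield F R \<longrightarrow> k \<subseteq> F \<longrightarrow> Y \<subseteq> F \<longrightarrow> E \<subseteq> F))"

lemma gens: "finite gens" "gens \<subseteq> E"
  "\<And>F. subfield F R \<Longrightarrow> k \<subseteq> F \<Longrightarrow> gens \<subseteq> F \<Longrightarrow> E \<subseteq> F"
  using someI_ex[OF finite_dimension_generators[OF k dim]] unfolding gens_def by blast+

text \<open>The field generated over \<open>k\<close> by all conjugates of \<open>gens\<close> is
  Galois over \<open>k\<close>, contains \<open>E\<close> and lies in \<open>M\<close>; minimality
  of the closure makes it equal to \<open>M\<close>, which thereby inherits a finite group.\<close>

lemma M_generated:
  "M = generate_field R (k \<union> (\<Union>x\<in>gens. (\<lambda>\<theta>. \<theta> x) ` carrier \<Gamma>))" (is "_ = ?F")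
  and finite_\<Gamma>: "finite (carrier \<Gamma>)"
proof -
  have gM: "gens \<subseteq> M" using gens(2) E_M by blast
  note f = finite_galois_subextension[OF galois_M gens(1) gM]
  have "E \<subseteq> ?F" using gens(3) galois_extensionD(2,3)[OF f(1)] f(3) by blast
  then show eq: "M = ?F" using closure f(1,4) unfolding galois_closure_def by blast
  show "finite (carrier \<Gamma>)" using f(2) unfolding eq[symmetric] .
qed

sublocale \<Gamma>: finite_galois R k M "carrier \<Gamma>"
  using finite_galoisI[OF galois_M finite_\<Gamma>] .

section \<open>From a potentially Galois field to a complement\<close>

lemma pot_galois_fieldsD:
  assumes "L \<in> \<L>"
  shows "subfield L R" "k \<subseteq> L" "potentially_galois R k E L"
  using assms unfolding pot_galois_fields_def field_extension_def by blast+

lemma tensor_locale: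
  assumes "subfield L R" "k \<subseteq> L"
  shows "tensor R k E L"
  by (intro tensor.intro tensor_axioms.intro is_cring subfieldE(1) E assms k_E)

text \<open>Identifies the base field of the tensor extension with \<open>L\<close>, so that
  transport along the multiplication map produces an extension of \<open>L\<close> itself.\<close>

lemma tensor_base_image:
  assumes "subfield L R" "k \<subseteq> L"
    and "\<And>x y. x \<in> E \<Longrightarrow> y \<in> L \<Longrightarrow> \<phi> (pure_tensor R k E L x y) = x \<otimes> y"
  shows "\<phi> ` tensor_base R k E L = L"
proof -
  have "\<phi> (pure_tensor R k E L \<one> y) = y" if "y \<in> L" for y
    using assms(3)[OF subringE(3)[OF subfieldE(1)[OF E]] that] subfieldE(3)[OF assms(1)] that by auto
  then show ?thesis unfolding tensor_base_def image_image by simp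
qed

lemma tensor_iso_compositum:
  assumes "L \<in> \<L>"
  shows "\<exists>\<phi>\<in>ring_iso (tensor_ring R k E L) (R\<lparr>carrier := compositum R E L\<rparr>).
    \<forall>x\<in>E. \<forall>y\<in>L. \<phi> (pure_tensor R k E L x y) = x \<otimes> y"
  using tensor_field_iso_compositum[OF E k_E pot_galois_fieldsD(1,2)[OF assms]]
    pot_galois_fieldsD(3)[OF assms] unfolding potentially_galois_def by blast

text \<open>The Galois property is carried over from the tensor product. Finiteness follows since
  \<open>EL\<close> is generated over \<open>L\<close> by \<open>gens\<close>: the finite Galois
  subextension of \<open>EL/L\<close> containing \<open>gens\<close> is already all of
  \<open>EL\<close>.\<close>

lemma compositum_finite_galois:
  assumes L: "L \<in> \<L>"
  shows "finite_galois R L (compositum R E L) (carrier (galois_group R L (compositum R E L)))"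
    "galois_extension R L (compositum R E L)"
proof -
  let ?C = "compositum R E L" and ?T = "tensor_ring R k E L"
  note Ld = pot_galois_fieldsD[OF L] and C = compositum_subfield[OF E pot_galois_fieldsD(1)[OF L]]
  obtain \<phi> where \<phi>: "\<phi> \<in> ring_iso ?T (R\<lparr>carrier := ?C\<rparr>)"
    "\<And>x y. x \<in> E \<Longrightarrow> y \<in> L \<Longrightarrow> \<phi> (pure_tensor R k E L x y) = x \<otimes> y"
    using tensor_iso_compositum[OF L] by blast
  have T: "field ?T" "galois_extension ?T (tensor_base R k E L) (carrier ?T)"
    using Ld(3) unfolding potentially_galois_def by blast+
  have "\<phi> \<in> ring_iso (?T\<lparr>carrier := carrier ?T\<rparr>) (R\<lparr>carrier := ?C\<rparr>)" using \<phi>(1) by simp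
  from galois_extension_transport(1)[OF T(1) field_axioms field.carrier_is_subfield[OF T(1)] C(1) this T(2)]
  show gal: "galois_extension R L ?C"
    using tensor_base_image[OF Ld(1,2) \<phi>(2)] by simp
  have gC: "gens \<subseteq> ?C" using gens(2) C(2) by blast
  note f = finite_galois_subextension[OF gal gens(1) gC]
  let ?F = "generate_field R (L \<union> (\<Union>x\<in>gens. (\<lambda>\<theta>. \<theta> x) ` carrier (galois_group R L ?C)))"
  have F: "subfield ?F R" "L \<subseteq> ?F" using galois_extensionD(2,3)[OF f(1)] .
  have "E \<subseteq> ?F" using gens(3)[OF F(1) subset_trans[OF Ld(2) F(2)] f(3)] .
  then have "?F = ?C" using C(4)[OF F(1) _ F(2)] f(4) by blast
  then show "finite_galois R L ?C (carrier (galois_group R L ?C))"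
    using finite_galoisI[OF gal] f(2) by simp
qed

text \<open>The tensor product carries an embedding of \<open>E\<close> over \<open>k\<close> to an \<open>L\<close>-homomorphism on \<open>EL\<close>,
  which is an automorphism as \<open>EL/L\<close> is Galois.\<close>

lemma lift_to_compositum:
  assumes L: "L \<in> \<L>" and \<gamma>: "\<gamma> \<in> carrier \<Gamma>"
  shows "\<exists>\<theta>\<in>carrier (galois_group R L (compositum R E L)). \<forall>x\<in>E. \<theta> x = \<gamma> x"
proof -
  let ?C = "compositum R E L" and ?T = "tensor_ring R k E L"
  note Ld = pot_galois_fieldsD[OF L] and C = compositum_subfield[OF E pot_galois_fieldsD(1)[OF L]]
  interpret N: finite_galois R L ?C "carrier (galois_group R L ?C)"
    using compositum_finite_galois(1)[OF L] .
  interpret T: tensor R k E L using tensor_locale[OF Ld(1,2)] .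
  obtain \<phi> where \<phi>: "\<phi> \<in> ring_iso ?T (R\<lparr>carrier := ?C\<rparr>)"
    "\<And>x y. x \<in> E \<Longrightarrow> y \<in> L \<Longrightarrow> \<phi> (pure_tensor R k E L x y) = x \<otimes> y"
    using tensor_iso_compositum[OF L] by blast
  let ?\<psi> = "inv_into (carrier ?T) \<phi>"
  have \<psi>: "?\<psi> \<in> ring_hom (R\<lparr>carrier := ?C\<rparr>) ?T"
    using ring_iso_set_sym[OF T.T.ring_axioms \<phi>(1)] unfolding ring_iso_def by simp
  have \<psi>\<phi>: "?\<psi> (\<phi> z) = z" if "z \<in> carrier ?T" for z
    using \<phi>(1) bij_betw_inv_into_left[OF _ that, of \<phi>] unfolding ring_iso_def by auto
  have \<gamma>E: "\<gamma> \<in> ring_hom (R\<lparr>carrier := E\<rparr>) R"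
    using subring_hom_mono[OF galois_groupD(6)[OF \<gamma>] E_M subfieldE(3)[OF M]] by simp
  have idL: "(\<lambda>y. y) \<in> ring_hom (R\<lparr>carrier := L\<rparr>) R"
    using subfieldE(3)[OF Ld(1)] by (auto intro!: ring_hom_memI)
  obtain \<tau> where \<tau>: "\<tau> \<in> ring_hom ?T R" "\<And>x y. x \<in> E \<Longrightarrow> y \<in> L \<Longrightarrow> \<tau> (T.pt x y) = \<gamma> x \<otimes> y"
    using T.tensor_universal[OF is_cring \<gamma>E idL] galois_groupD(5)[OF \<gamma>] by blast
  have "\<tau> \<circ> ?\<psi> \<in> ring_hom (R\<lparr>carrier := ?C\<rparr>) R" using ring_hom_trans[OF \<psi> \<tau>(1)] .
  moreover have "(\<tau> \<circ> ?\<psi>) y = y" if y: "y \<in> L" for y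
  proof -
    have yc: "y \<in> carrier R" using y subfieldE(3)[OF Ld(1)] by blast
    have "\<phi> (T.pt \<one> y) = y" using \<phi>(2)[OF T.A_closed(2) y] yc by simp
    then have "?\<psi> y = T.pt \<one> y" using \<psi>\<phi>[OF T.pt_closed[OF T.A_closed(2) y]] by simp
    then show ?thesis using \<tau>(2)[OF T.A_closed(2) y] galois_groupD(4)[OF \<gamma>] yc by simp
  qed
  ultimately obtain \<theta> where \<theta>: "\<theta> \<in> carrier (galois_group R L ?C)" "\<forall>x\<in>?C. \<theta> x = (\<tau> \<circ> ?\<psi>) x"
    using N.hom_extends_to_group[OF N.F_ring order_refl C(3)] by blast
  have "\<theta> x = \<gamma> x" if x: "x \<in> E" for x
  proof -
    have \<gamma>x: "\<gamma> x \<in> carrier R" using M_carrier galois_groupD(1)[OF \<gamma>] E_M x by blast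
    have "\<phi> (T.pt x \<one>) = x" using \<phi>(2)[OF x T.B_closed(2)] E_carrier[OF x] by simp
    then have "?\<psi> x = T.pt x \<one>" using \<psi>\<phi>[OF T.pt_closed[OF x T.B_closed(2)]] by simp
    then show ?thesis using \<tau>(2)[OF x T.B_closed(2)] \<gamma>x \<theta>(2) C(2) x by auto
  qed
  then show ?thesis using \<theta>(1) by blast
qed

text \<open>Each conjugate of a generator of \<open>E\<close> is its image under some automorphism
  of \<open>EL\<close>, hence lies in \<open>EL\<close>; these conjugates generate \<open>M\<close>
  over \<open>k\<close>.\<close>

lemma M_subset_compositum:
  assumes L: "L \<in> \<L>"
  shows "M \<subseteq> compositum R E L"
proof -
  note Ld = pot_galois_fieldsD[OF L] and C = compositum_subfield[OF E pot_galois_fieldsD(1)[OF L]]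
  have "\<theta> x \<in> compositum R E L" if t: "\<theta> \<in> carrier \<Gamma>" and x: "x \<in> gens" for \<theta> x
  proof -
    have xE: "x \<in> E" using x gens(2) by blast
    obtain \<tau> where \<tau>: "\<tau> \<in> carrier (galois_group R L (compositum R E L))" "\<forall>x\<in>E. \<tau> x = \<theta> x"
      using lift_to_compositum[OF L t] by blast
    show ?thesis using galois_groupD(1)[OF \<tau>(1) subsetD[OF C(2) xE]] \<tau>(2) xE by simp
  qed
  then have sub: "k \<union> (\<Union>x\<in>gens. (\<lambda>\<theta>. \<theta> x) ` carrier \<Gamma>) \<subseteq> compositum R E L"
    using Ld(2) C(3) by blast
  show ?thesis
    using generate_field_min_subfield1[OF subset_trans[OF sub subfieldE(3)[OF C(1)]] C(1) sub]
    unfolding M_generated[symmetric] .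
qed

text \<open>A priori the restriction only maps \<open>M\<close> into \<open>\<Omega>\<close>. It
  fixes \<open>k\<close>, so \<open>hom_extends_to_group\<close> for \<open>M/k\<close> identifies
  it with a member of the group.\<close>

lemma restrict_in_\<Gamma>:
  assumes L: "L \<in> \<L>" and t: "\<theta> \<in> carrier (galois_group R L (compositum R E L))"
  shows "restrict \<theta> M \<in> carrier \<Gamma>"
proof -
  have "\<theta> \<in> ring_hom (R\<lparr>carrier := M\<rparr>) (R\<lparr>carrier := carrier R\<rparr>)"
    using subring_hom_mono[OF galois_groupD(6)[OF t] M_subset_compositum[OF L]]
      subfieldE(3)[OF compositum_subfield(1)[OF E pot_galois_fieldsD(1)[OF L]]] by blast
  moreover have "\<theta> x = x" if "x \<in> k" for x
    using galois_groupD(5)[OF t] pot_galois_fieldsD(2)[OF L] that by blast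
  ultimately obtain \<tau> where \<tau>: "\<tau> \<in> carrier \<Gamma>" "\<forall>x\<in>M. \<tau> x = \<theta> x"
    using \<Gamma>.hom_extends_to_group[OF \<Gamma>.F_ring order_refl k_M, of \<theta>] by auto
  then have "restrict \<theta> M = \<tau>"
    unfolding galois_group_iff by (intro extensionalityI[of _ M]) auto
  then show ?thesis using \<tau>(1) by simp
qed

lemma res_memE:
  assumes "u \<in> res L"
  obtains \<theta> where "\<theta> \<in> carrier (galois_group R L (compositum R E L))" "u = restrict \<theta> M"
  using assms unfolding restricted_galois_def by blast

lemma agree_on_compositum:
  assumes L: "subfield L R" and t: "\<theta> \<in> carrier (galois_group R L (compositum R E L))"
    "\<tau> \<in> carrier (galois_group R L (compositum R E L))" and eq: "\<forall>x\<in>E. \<theta> x = \<tau> x"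
  shows "\<theta> = \<tau>"
proof -
  note C = compositum_subfield[OF E L]
  let ?Q = "{x \<in> compositum R E L. \<theta> x = \<tau> x}"
  have "subfield ?Q R"
    using hom_equalizer_subfield[OF galois_groupD(6)[OF t(1)] galois_groupD(6)[OF t(2)] C(1)] .
  moreover have "E \<subseteq> ?Q" using C(2) eq by blast
  moreover have "L \<subseteq> ?Q"
  proof
    fix x assume "x \<in> L"
    then show "x \<in> ?Q" using C(3) galois_groupD(5)[OF t(1)] galois_groupD(5)[OF t(2)] by auto
  qed
  ultimately have "compositum R E L \<subseteq> ?Q" by (rule C(4))
  then show ?thesis using galois_group_ext[OF t] by blast
qed

text \<open>Lift \<open>\<gamma>\<close> from \<open>E\<close> to an automorphism of
  \<open>EL\<close> and let \<open>u\<close> be its restriction to \<open>M\<close>; then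
  \<open>inv u\<close> times \<open>\<gamma>\<close> fixes \<open>E\<close>. For uniqueness, in any
  factorization the second factor fixes \<open>E\<close>, so the first comes from an automorphism of
  \<open>EL/L\<close> agreeing with \<open>\<gamma>\<close> on \<open>E\<close>, and
  \<open>agree_on_compositum\<close> leaves only one.\<close>

lemma res_complement:
  assumes L: "L \<in> \<L>"
  shows "res L \<in> \<G>"
proof -
  let ?C = "compositum R E L"
  let ?N = "galois_group R L ?C"
  note Ld = pot_galois_fieldsD[OF L] and C = compositum_subfield[OF E pot_galois_fieldsD(1)[OF L]]
  note MC = M_subset_compositum[OF L]
  interpret N: finite_galois R L ?C "carrier ?N" using compositum_finite_galois(1)[OF L] .
  have "(\<lambda>\<theta>. restrict \<theta> M) \<in> hom ?N \<Gamma>"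
  proof (rule homI)
    fix \<theta> \<tau> assume t: "\<theta> \<in> carrier ?N" "\<tau> \<in> carrier ?N"
    note r = restrict_in_\<Gamma>[OF L t(1)] restrict_in_\<Gamma>[OF L t(2)]
    have "restrict (compose ?C \<theta> \<tau>) M x = compose M (restrict \<theta> M) (restrict \<tau> M) x" for x
    proof (cases "x \<in> M")
      case True
      then have "\<tau> x \<in> M" using galois_groupD(1)[OF r(2) True] by simp
      then show ?thesis using True MC by (auto simp: compose_def)
    qed (simp add: compose_def)
    then show "restrict (\<theta> \<otimes>\<^bsub>?N\<^esub> \<tau>) M = restrict \<theta> M \<otimes>\<^bsub>\<Gamma>\<^esub> restrict \<tau> M"
      unfolding galois_group_mult[OF t] galois_group_mult[OF r] by (rule ext)
  qed (rule restrict_in_\<Gamma>[OF L])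
  then interpret h: group_hom ?N \<Gamma> "\<lambda>\<theta>. restrict \<theta> M"
    by (intro group_hom.intro group_hom_axioms.intro N.Gal.group_axioms \<Gamma>.Gal.group_axioms)
  have sub: "subgroup (res L) \<Gamma>"
    unfolding restricted_galois_def using h.img_is_subgroup .
  have "\<exists>!p. p \<in> res L \<times> carrier (galois_group R E M) \<and> \<gamma> = fst p \<otimes>\<^bsub>\<Gamma>\<^esub> snd p"
    if \<gamma>: "\<gamma> \<in> carrier \<Gamma>" for \<gamma>
  proof -
    obtain \<theta> where \<theta>: "\<theta> \<in> carrier ?N" "\<forall>x\<in>E. \<theta> x = \<gamma> x" using lift_to_compositum[OF L \<gamma>] by blast
    define u where "u = restrict \<theta> M"
    have u: "u \<in> res L" "u \<in> carrier \<Gamma>" "\<forall>x\<in>E. u x = \<gamma> x"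
      using \<theta> restrict_in_\<Gamma>[OF L \<theta>(1)] E_M unfolding u_def restricted_galois_def by auto
    define v where "v = inv\<^bsub>\<Gamma>\<^esub> u \<otimes>\<^bsub>\<Gamma>\<^esub> \<gamma>"
    have v: "v \<in> carrier \<Gamma>" unfolding v_def using u(2) \<gamma> by simp
    have "v x = x" if x: "x \<in> E" for x
    proof -
      have "v x = (inv\<^bsub>\<Gamma>\<^esub> u) (u x)"
        unfolding v_def galois_group_mult[OF \<Gamma>.Gal.inv_closed[OF u(2)] \<gamma>]
        using x E_M u(3) by (auto simp: compose_def)
      then show ?thesis
        using galois_group_inv_apply(2)[OF \<Gamma>.F_ring k_M u(2) subsetD[OF E_M x]] by simp
    qed
    then have vE: "v \<in> carrier (galois_group R E M)" using v unfolding galois_group_iff by simp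
    have "u \<otimes>\<^bsub>\<Gamma>\<^esub> v = \<gamma>" unfolding v_def using u(2) \<gamma> by (simp add: \<Gamma>.Gal.m_assoc[symmetric])
    then have ex: "(u, v) \<in> res L \<times> carrier (galois_group R E M) \<and> \<gamma> = fst (u, v) \<otimes>\<^bsub>\<Gamma>\<^esub> snd (u, v)"
      using u(1) vE by simp
    moreover have "p = (u, v)"
      if p: "p \<in> res L \<times> carrier (galois_group R E M) \<and> \<gamma> = fst p \<otimes>\<^bsub>\<Gamma>\<^esub> snd p" for p
    proof -
      obtain u' v' where uv: "p = (u', v')" "u' \<in> res L" "v' \<in> carrier (galois_group R E M)"
        "\<gamma> = u' \<otimes>\<^bsub>\<Gamma>\<^esub> v'" using p by (cases p) auto
      obtain \<theta>' where \<theta>': "\<theta>' \<in> carrier ?N" "u' = restrict \<theta>' M" using res_memE[OF uv(2)] by blast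
      have u': "u' \<in> carrier \<Gamma>" using restrict_in_\<Gamma>[OF L \<theta>'(1)] \<theta>'(2) by simp
      have v': "v' \<in> carrier \<Gamma>" using uv(3) galois_group_anti_mono[OF k_E] by blast
      have "\<theta>' x = \<theta> x" if x: "x \<in> E" for x
      proof -
        have xM: "x \<in> M" using x E_M by blast
        have "\<gamma> x = u' (v' x)" unfolding uv(4) galois_group_mult[OF u' v'] using xM by (simp add: compose_def)
        also have "\<dots> = \<theta>' x" using galois_groupD(5)[OF uv(3) x] \<theta>'(2) xM by simp
        finally show ?thesis using \<theta>(2) x by simp
      qed
      then have "\<theta>' = \<theta>" using agree_on_compositum[OF Ld(1) \<theta>'(1) \<theta>(1)] by blast
      then have "u' = u" using \<theta>'(2) u_def by simp
      moreover have "v' = v" using \<open>u \<otimes>\<^bsub>\<Gamma>\<^esub> v = \<gamma>\<close> uv(4) \<open>u' = u\<close> u(2) v v' by simp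
      ultimately show ?thesis using uv(1) by simp
    qed
    ultimately show ?thesis by (intro ex1I[of _ "(u, v)"])
  qed
  then show ?thesis
    using sub unfolding galois_complements_def complements_def by blast
qed

end

text \<open>\<open>ring_iso_imp_img_field\<close> speaks of \<open>S\<close> with its zero replaced
  by the image of zero. As \<open>S\<close> is already a ring and \<open>\<psi>\<close> preserves
  zero, that record is \<open>S\<close> itself.\<close>

lemma (in field) field_iso_image:
  assumes "subfield F R" "ring S" "\<psi> \<in> ring_iso (R\<lparr>carrier := F\<rparr>) S"
  shows "field S"
proof -
  interpret F: field "R\<lparr>carrier := F\<rparr>" using subfield_iff(2)[OF assms(1)] .
  have "\<psi> \<in> ring_hom (R\<lparr>carrier := F\<rparr>) S" using assms(3) unfolding ring_iso_def by blast
  then interpret h: ring_hom_ring "R\<lparr>carrier := F\<rparr>" S \<psi> by (rule ring_hom_ringI2[OF F.ring_axioms assms(2)])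
  have z: "\<psi> \<zero>\<^bsub>R\<lparr>carrier := F\<rparr>\<^esub> = \<zero>\<^bsub>S\<^esub>" by (rule h.hom_zero)
  have "S\<lparr>zero := \<zero>\<^bsub>S\<^esub>\<rparr> = S" by simp
  then show ?thesis using F.ring_iso_imp_img_field[OF assms(3)] unfolding z by (rule subst)
qed

section \<open>From a complement to a potentially Galois field\<close>

context galois_closed_extension begin

lemma complementD:
  assumes "U \<in> \<G>"
  shows "subgroup U \<Gamma>" "U \<subseteq> carrier \<Gamma>"
    and "\<And>\<gamma>. \<gamma> \<in> carrier \<Gamma> \<Longrightarrow> \<exists>u\<in>U. \<exists>v\<in>carrier (galois_group R E M). \<gamma> = u \<otimes>\<^bsub>\<Gamma>\<^esub> v"
    and "\<And>u v u' v'. u \<in> U \<Longrightarrow> v \<in> carrier (galois_group R E M) \<Longrightarrow> u' \<in> U \<Longrightarrow>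
      v' \<in> carrier (galois_group R E M) \<Longrightarrow> u \<otimes>\<^bsub>\<Gamma>\<^esub> v = u' \<otimes>\<^bsub>\<Gamma>\<^esub> v' \<Longrightarrow> u = u' \<and> v = v'"
proof -
  have U: "subgroup U \<Gamma>"
    and ex1: "\<And>\<gamma>. \<gamma> \<in> carrier \<Gamma> \<Longrightarrow>
      \<exists>!p. p \<in> U \<times> carrier (galois_group R E M) \<and> \<gamma> = fst p \<otimes>\<^bsub>\<Gamma>\<^esub> snd p"
    using assms unfolding galois_complements_def complements_def by blast+
  show "subgroup U \<Gamma>" by fact
  show sub: "U \<subseteq> carrier \<Gamma>" using subgroup.subset[OF U] .
  show "\<exists>u\<in>U. \<exists>v\<in>carrier (galois_group R E M). \<gamma> = u \<otimes>\<^bsub>\<Gamma>\<^esub> v" if \<gamma>: "\<gamma> \<in> carrier \<Gamma>" for \<gamma>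
  proof -
    obtain p where "p \<in> U \<times> carrier (galois_group R E M)" "\<gamma> = fst p \<otimes>\<^bsub>\<Gamma>\<^esub> snd p"
      using ex1_implies_ex[OF ex1[OF \<gamma>]] by blast
    then show ?thesis by (cases p) auto
  qed
  show "u = u' \<and> v = v'"
    if uv: "u \<in> U" "v \<in> carrier (galois_group R E M)" "u' \<in> U" "v' \<in> carrier (galois_group R E M)"
      and eq: "u \<otimes>\<^bsub>\<Gamma>\<^esub> v = u' \<otimes>\<^bsub>\<Gamma>\<^esub> v'" for u v u' v'
  proof -
    have "u \<otimes>\<^bsub>\<Gamma>\<^esub> v \<in> carrier \<Gamma>"
      using uv sub galois_group_anti_mono[OF k_E] by (intro \<Gamma>.Gal.m_closed) blast+
    from ex1[OF this] have "(u, v) = (u', v')" using uv eq by (elim ex1E) (metis SigmaI fst_conv snd_conv)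
    then show ?thesis by simp
  qed
qed

lemma one_in_galois_group_E: "\<one>\<^bsub>\<Gamma>\<^esub> \<in> carrier (galois_group R E M)"
  using monoid.one_closed[OF group.is_monoid[OF group_galois_group[OF \<Gamma>.F_ring E_M]]]
  by (simp add: galois_group_one)

text \<open>\<open>u\<close> times 1 and 1 times \<open>u\<close> are two factorizations of the same
  element.\<close>

lemma complement_trivial_inter:
  assumes "U \<in> \<G>" "u \<in> U" "u \<in> carrier (galois_group R E M)"
  shows "u = \<one>\<^bsub>\<Gamma>\<^esub>"
proof -
  note U = complementD[OF assms(1)]
  note 1 = one_in_galois_group_E
  have "u \<otimes>\<^bsub>\<Gamma>\<^esub> \<one>\<^bsub>\<Gamma>\<^esub> = \<one>\<^bsub>\<Gamma>\<^esub> \<otimes>\<^bsub>\<Gamma>\<^esub> u" using assms(2) U(2) by auto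
  then show ?thesis using U(4)[OF assms(2) 1 subgroup.one_closed[OF U(1)] assms(3)] by blast
qed

text \<open>Factor \<open>u' \<in> U'\<close> as \<open>u v\<close> with \<open>u \<in> U\<close>.
  Since \<open>u\<close> also lies in \<open>U'\<close>, this and \<open>u'\<close> times 1 are two
  factorizations with respect to \<open>U'\<close>, so \<open>u' = u\<close>. Minimality of fixed
  fields rests on this.\<close>

lemma complement_maximal:
  assumes "U \<in> \<G>" "U' \<in> \<G>" "U \<subseteq> U'"
  shows "U = U'"
proof
  show "U' \<subseteq> U"
  proof
    fix u' assume u': "u' \<in> U'"
    note U = complementD[OF assms(1)] and U' = complementD[OF assms(2)]
    have c: "u' \<in> carrier \<Gamma>" using u' U'(2) by blast
    note 1 = one_in_galois_group_E
    obtain u v where uv: "u \<in> U" "v \<in> carrier (galois_group R E M)" "u' = u \<otimes>\<^bsub>\<Gamma>\<^esub> v"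
      using U(3)[OF c] by blast
    have "u' \<otimes>\<^bsub>\<Gamma>\<^esub> \<one>\<^bsub>\<Gamma>\<^esub> = u \<otimes>\<^bsub>\<Gamma>\<^esub> v" using c uv(3) by simp
    then have "u' = u" using U'(4)[OF u' 1 subsetD[OF assms(3) uv(1)] uv(2)] by blast
    then show "u' \<in> U" using uv(1) by simp
  qed
qed fact

lemma complement_finite_galois:
  assumes "U \<in> \<G>"
  shows "finite_galois R (fixed_field M U) M U"
  using \<Gamma>.subgroup_fixed_field complementD(1,2)[OF assms] by blast

lemma fixed_field_subset: "fixed_field M U \<subseteq> M"
  by (rule subsetI) (rule fixed_fieldD(1))

lemma complement_fixed_field:
  assumes U: "U \<in> \<G>"
  shows "subfield (fixed_field M U) R" "k \<subseteq> fixed_field M U"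
    and "galois_extension R (fixed_field M U) M"
    and "U = carrier (galois_group R (fixed_field M U) M)"
proof -
  interpret U: finite_galois R "fixed_field M U" M U using complement_finite_galois[OF U] .
  show "subfield (fixed_field M U) R" using U.K_subfield .
  show kL: "k \<subseteq> fixed_field M U"
  proof
    fix x assume x: "x \<in> k"
    show "x \<in> fixed_field M U"
    proof (rule fixed_fieldI[OF subsetD[OF k_M x]])
      fix \<theta> assume "\<theta> \<in> U"
      then have "\<theta> \<in> carrier \<Gamma>" using complementD(2)[OF U] by blast
      then show "\<theta> x = x" using x by (rule galois_groupD(5))
    qed
  qed
  show "U = carrier (galois_group R (fixed_field M U) M)" using U.group_eq_galois_group .
  show "galois_extension R (fixed_field M U) M"
  proof (rule U.galois_extension)
    fix x assume "x \<in> M"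
    then have "ring.algebraic R k x" using galois_extensionD(4)[OF galois_M] by blast
    then show "ring.algebraic R (fixed_field M U) x" using algebraic_mono[OF kL] by (simp add: over_def)
  qed
qed

text \<open>Both conditions of \<open>tensor_mult_iso\<close> translate the complement property. In
  a factorization \<open>u v\<close> the factor \<open>v\<close> fixes \<open>E\<close>, so every
  \<open>\<gamma>\<close> acts on \<open>E\<close> like an element of \<open>U\<close>; and an
  element of \<open>U\<close> fixing \<open>E\<close> is trivial.\<close>

lemma complement_tensor_iso:
  assumes U: "U \<in> \<G>"
  shows "\<exists>\<phi>\<in>ring_iso (tensor_ring R k E (fixed_field M U)) (R\<lparr>carrier := M\<rparr>).
    \<forall>x\<in>E. \<forall>y\<in>fixed_field M U. \<phi> (pure_tensor R k E (fixed_field M U) x y) = x \<otimes> y"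
proof (rule tensor_mult_iso[OF \<Gamma>.finite_galois_axioms complement_finite_galois[OF U]
      subfieldE(1)[OF E] k_E E_M E_M complement_fixed_field(2)[OF U]])
  fix \<gamma> assume g: "\<gamma> \<in> carrier \<Gamma>"
  obtain u v where uv: "u \<in> U" "v \<in> carrier (galois_group R E M)" "\<gamma> = u \<otimes>\<^bsub>\<Gamma>\<^esub> v"
    using complementD(3)[OF U g] by blast
  have c: "u \<in> carrier \<Gamma>" "v \<in> carrier \<Gamma>"
    using uv(1,2) complementD(2)[OF U] galois_group_anti_mono[OF k_E] by blast+
  have "u x = \<gamma> x" if x: "x \<in> E" for x
    unfolding uv(3) galois_group_mult[OF c] using galois_groupD(5)[OF uv(2) x] x E_M
    by (auto simp: compose_def)
  then show "\<exists>\<nu>\<in>U. \<forall>x\<in>E. \<nu> x = \<gamma> x" using uv(1) by blast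
next
  fix \<nu> y assume n: "\<nu> \<in> U" "\<forall>x\<in>E. \<nu> x = x" and y: "y \<in> M"
  have "\<nu> \<in> carrier (galois_group R E M)"
    using subsetD[OF complementD(2)[OF U] n(1)] n(2) unfolding galois_group_iff by simp
  then have "\<nu> = (\<lambda>x\<in>M. x)" using complement_trivial_inter[OF U n(1)] by (simp add: galois_group_one)
  then show "\<nu> y = y" using y by simp
qed

text \<open>The Galois extension \<open>M\<close> of the fixed field is transported backwards along
  the multiplication isomorphism, whose inverse maps the fixed field onto the base of the tensor
  product.\<close>

lemma complement_potentially_galois:
  assumes U: "U \<in> \<G>"
  shows "potentially_galois_with_group R k E (fixed_field M U) (galois_group R (fixed_field M U) M)"
proof -
  let ?L = "fixed_field M U"
  let ?T = "tensor_ring R k E ?L"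
  note L = complement_fixed_field[OF U]
  interpret T: tensor R k E ?L using tensor_locale[OF L(1,2)] .
  obtain \<phi> where \<phi>: "\<phi> \<in> ring_iso ?T (R\<lparr>carrier := M\<rparr>)"
    "\<And>x y. x \<in> E \<Longrightarrow> y \<in> ?L \<Longrightarrow> \<phi> (pure_tensor R k E ?L x y) = x \<otimes> y"
    using complement_tensor_iso[OF U] by blast
  let ?\<psi> = "inv_into (carrier ?T) \<phi>"
  have \<psi>: "?\<psi> \<in> ring_iso (R\<lparr>carrier := M\<rparr>) ?T"
    using ring_iso_set_sym[OF T.T.ring_axioms \<phi>(1)] .
  have fT: "field ?T" using field_iso_image[OF M T.T.ring_axioms \<psi>] .
  have "?\<psi> ` ?L = tensor_base R k E ?L"
  proof -
    have "inj_on \<phi> (carrier ?T)" using \<phi>(1) by (simp add: ring_iso_def bij_betw_def)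
    moreover have "tensor_base R k E ?L \<subseteq> carrier ?T"
      unfolding tensor_base_def using T.pt_closed[OF T.A_closed(2)] by blast
    ultimately have "?\<psi> ` (\<phi> ` tensor_base R k E ?L) = tensor_base R k E ?L"
      by (rule inv_into_image_cancel)
    then show ?thesis using tensor_base_image[OF L(1,2) \<phi>(2)] by simp
  qed
  moreover have "?\<psi> \<in> ring_iso (R\<lparr>carrier := M\<rparr>) (?T\<lparr>carrier := carrier ?T\<rparr>)" using \<psi> by simp
  note t = galois_extension_transport[OF field_axioms fT M field.carrier_is_subfield[OF fT] this L(3)]
  ultimately have g: "galois_extension ?T (tensor_base R k E ?L) (carrier ?T)"
    and i: "galois_group R ?L M \<cong> galois_group ?T (tensor_base R k E ?L) (carrier ?T)"
    using t by simp_all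
  have "galois_group ?T (tensor_base R k E ?L) (carrier ?T) \<cong> galois_group R ?L M"
    using group.iso_sym[OF group_galois_group[OF \<Gamma>.F_ring fixed_field_subset] i] .
  then show ?thesis
    using fT g unfolding potentially_galois_with_group_def potentially_galois_def by blast
qed

section \<open>The two maps and the minimal fields\<close>

lemma fixed_field_pot_galois:
  assumes "U \<in> \<G>"
  shows "fixed_field M U \<in> \<L>"
  using complement_potentially_galois[OF assms] complement_fixed_field(1,2)[OF assms] k
  unfolding pot_galois_fields_def potentially_galois_with_group_def field_extension_def by blast

lemma compositum_fixed_field:
  assumes U: "U \<in> \<G>"
  shows "compositum R E (fixed_field M U) = M"
  using M_subset_compositum[OF fixed_field_pot_galois[OF U]]
    compositum_subfield(4)[OF E complement_fixed_field(1)[OF U] M E_M fixed_field_subset] by blast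

text \<open>Here \<open>EL\<close> is \<open>M\<close>, so restricting to \<open>M\<close> changes
  nothing.\<close>

lemma res_fixed_field:
  assumes U: "U \<in> \<G>"
  shows "res (fixed_field M U) = U"
proof -
  have "restrict \<theta> M = \<theta>" if "\<theta> \<in> carrier (galois_group R (fixed_field M U) M)" for \<theta>
    using that unfolding galois_group_iff by (simp add: extensional_restrict)
  then have "res (fixed_field M U) = carrier (galois_group R (fixed_field M U) M)"
    unfolding restricted_galois_def compositum_fixed_field[OF U] by simp
  then show ?thesis using complement_fixed_field(4)[OF U] by simp
qed

text \<open>Being fixed by the restrictions means being fixed by \<open>Gal(EL/L)\<close>, whose
  fixed field is \<open>L\<close>. This exhibits the candidate minimal field as a subset of
  \<open>L\<close>.\<close>

lemma fixed_field_res: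
  assumes L: "L \<in> \<L>"
  shows "fixed_field M (res L) = M \<inter> L"
proof
  let ?C = "compositum R E L"
  note Ld = pot_galois_fieldsD[OF L] and C = compositum_subfield[OF E pot_galois_fieldsD(1)[OF L]]
  show "fixed_field M (res L) \<subseteq> M \<inter> L"
  proof
    fix x assume x: "x \<in> fixed_field M (res L)"
    have xM: "x \<in> M" using fixed_fieldD(1)[OF x] .
    have "\<theta> x = x" if t: "\<theta> \<in> carrier (galois_group R L ?C)" for \<theta>
    proof -
      have "restrict \<theta> M \<in> res L" using t unfolding restricted_galois_def by blast
      then show ?thesis using fixed_fieldD(2)[OF x] xM by (metis restrict_apply')
    qed
    then have "x \<in> fixed_field ?C (carrier (galois_group R L ?C))"
      by (intro fixed_fieldI subsetD[OF M_subset_compositum[OF L] xM])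
    then show "x \<in> M \<inter> L"
      using galois_extensionD(5)[OF compositum_finite_galois(2)[OF L]] xM by blast
  qed
  show "M \<inter> L \<subseteq> fixed_field M (res L)"
  proof
    fix x assume x: "x \<in> M \<inter> L"
    show "x \<in> fixed_field M (res L)"
    proof (rule fixed_fieldI)
      fix u assume "u \<in> res L"
      then obtain \<theta> where "\<theta> \<in> carrier (galois_group R L ?C)" "u = restrict \<theta> M" by (rule res_memE)
      then show "u x = x" using galois_groupD(5)[of \<theta> R L ?C x] x by simp
    qed (use x in blast)
  qed
qed

abbreviation (input) "\<L>m \<equiv> min_pot_galois_fields R k E"

text \<open>For \<open>L'\<close> in \<open>\<L>\<close> inside the fixed field of \<open>U\<close>,
  the complement attached to \<open>L'\<close> has fixed field \<open>M \<inter> L'\<close>, which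
  is smaller, so it contains \<open>U\<close>. Complements do not nest properly, so the two agree,
  and the fixed field of \<open>U\<close> lies in \<open>L'\<close>.\<close>

lemma fixed_field_minimal:
  assumes U: "U \<in> \<G>"
  shows "fixed_field M U \<in> \<L>m"
proof -
  have "L' = fixed_field M U" if L': "L' \<in> \<L>" "L' \<subseteq> fixed_field M U" for L'
  proof -
    note U' = res_complement[OF L'(1)]
    have sub: "fixed_field M (res L') \<subseteq> L'" using fixed_field_res[OF L'(1)] by blast
    have "U \<subseteq> res L'"
      using galois_group_anti_mono[OF subset_trans[OF sub L'(2)], of R M]
      unfolding complement_fixed_field(4)[OF U, symmetric] complement_fixed_field(4)[OF U', symmetric] .
    then have "U = res L'" using complement_maximal[OF U U'] by blast
    then show ?thesis using sub L'(2) by blast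
  qed
  then show ?thesis
    using fixed_field_pot_galois[OF U] unfolding min_pot_galois_fields_def by blast
qed

lemma minimal_fixed_field:
  assumes "L \<in> \<L>m"
  shows "L \<in> \<L>" "fixed_field M (res L) = L"
proof -
  show L: "L \<in> \<L>" using assms unfolding min_pot_galois_fields_def by blast
  show "fixed_field M (res L) = L"
    using assms fixed_field_pot_galois[OF res_complement[OF L]] fixed_field_res[OF L]
    unfolding min_pot_galois_fields_def by blast
qed

text \<open>A minimal field lies in \<open>M\<close>, so \<open>L0\<close> is contained in
  \<open>M \<inter> L\<close>, the fixed field of \<open>res L\<close>; that field is itself
  minimal, which forces equality.\<close>

lemma minimal_below:
  assumes L: "L \<in> \<L>" and L0: "L0 \<in> \<L>m" "L0 \<subseteq> L"
  shows "L0 = fixed_field M (res L)"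
proof -
  have "L0 \<subseteq> M" using minimal_fixed_field(2)[OF L0(1)] fixed_field_subset by metis
  then have "L0 \<subseteq> fixed_field M (res L)" using L0(2) fixed_field_res[OF L] by blast
  then show ?thesis
    using fixed_field_minimal[OF res_complement[OF L]] minimal_fixed_field(1)[OF L0(1)]
    unfolding min_pot_galois_fields_def by blast
qed

text \<open>The second use of \<open>tensor_mult_iso\<close>, now with \<open>D = M\<close>. Lifts
  exist because \<open>res L\<close> consists of restrictions, and an automorphism of
  \<open>EL/L\<close> trivial on \<open>M\<close> is trivial on \<open>E\<close>, hence on
  \<open>EL\<close>.\<close>

lemma base_change_fixed_field:
  assumes L: "L \<in> \<L>"
  shows "base_change R (fixed_field M (res L)) M L (compositum R E L)"
proof -
  let ?L0 = "fixed_field M (res L)" and ?C = "compositum R E L"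
  note U = res_complement[OF L] and MC = M_subset_compositum[OF L]
  note Ld = pot_galois_fieldsD[OF L] and C = compositum_subfield[OF E pot_galois_fieldsD(1)[OF L]]
  have L0L: "?L0 \<subseteq> L" using fixed_field_res[OF L] by blast
  have "\<exists>\<phi>\<in>ring_iso (tensor_ring R ?L0 M L) (R\<lparr>carrier := ?C\<rparr>).
    \<forall>x\<in>M. \<forall>y\<in>L. \<phi> (pure_tensor R ?L0 M L x y) = x \<otimes> y"
  proof (rule tensor_mult_iso[OF complement_finite_galois[OF U] compositum_finite_galois(1)[OF L]
        \<Gamma>.F_ring fixed_field_subset order_refl MC L0L])
    fix u assume "u \<in> res L"
    then obtain \<theta> where "\<theta> \<in> carrier (galois_group R L ?C)" "u = restrict \<theta> M" by (rule res_memE)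
    then show "\<exists>\<nu>\<in>carrier (galois_group R L ?C). \<forall>x\<in>M. \<nu> x = u x" by auto
  next
    fix \<nu> y assume n: "\<nu> \<in> carrier (galois_group R L ?C)" "\<forall>x\<in>M. \<nu> x = x" and y: "y \<in> ?C"
    interpret N: group "galois_group R L ?C"
      using group_galois_group[OF subfieldE(1)[OF C(1)] C(3)] .
    have "\<forall>x\<in>E. \<nu> x = (\<one>\<^bsub>galois_group R L ?C\<^esub>) x"
      using n(2) E_M C(2) by (auto simp: galois_group_one)
    then have "\<nu> = \<one>\<^bsub>galois_group R L ?C\<^esub>"
      using agree_on_compositum[OF Ld(1) n(1) N.one_closed] by blast
    then show "\<nu> y = y" using y by (simp add: galois_group_one)
  qed
  then show ?thesis
    using complement_fixed_field(1)[OF U] fixed_field_subset M Ld(1) C(1,3) L0L MC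
    unfolding base_change_def field_extension_def by blast
qed

text \<open>The point is that \<open>M \<inter> L\<close> is stable under \<open>Gal(M/k)\<close>.
  Then it is Galois over \<open>k\<close>, and a conjugate of an element of \<open>res L\<close>
  again fixes it pointwise, hence belongs to \<open>res L\<close>, the full Galois group of
  \<open>M\<close> over it.\<close>

lemma galois_over_base:
  assumes L: "L \<in> \<L>" and gal: "galois_extension R k L"
  shows "galois_extension R k (fixed_field M (res L))" "res L \<lhd> \<Gamma>"
proof -
  let ?L0 = "fixed_field M (res L)"
  note U = res_complement[OF L]
  have stable: "\<forall>\<gamma>\<in>carrier \<Gamma>. \<forall>x\<in>?L0. \<gamma> x \<in> ?L0"
  proof (intro ballI)
    fix \<gamma> x assume \<gamma>: "\<gamma> \<in> carrier \<Gamma>" and "x \<in> ?L0"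
    then have x: "x \<in> M" "x \<in> L" using fixed_field_res[OF L] by blast+
    have xs: "finite {x}" "{x} \<subseteq> L" using x by auto
    \<comment> \<open>\<open>L/k\<close> may be infinite, whereas
      \<open>hom_extends_to_group\<close> needs a finite group; a finite Galois subextension
      containing \<open>x\<close> suffices.\<close>
    note f = finite_galois_subextension[OF gal xs]
    let ?F = "generate_field R (k \<union> (\<Union>y\<in>{x}. (\<lambda>\<theta>. \<theta> y) ` carrier (galois_group R k L)))"
    interpret F: finite_galois R k ?F "carrier (galois_group R k ?F)"
      using finite_galoisI[OF f(1,2)] .
    \<comment> \<open>\<open>\<gamma>\<close> is available only on \<open>M\<close>, so it is
      extended from \<open>?F \<inter> M\<close> to an automorphism of \<open>?F\<close>; this
      places \<open>\<gamma> x\<close> in \<open>?F\<close>, hence in \<open>L\<close>.\<close>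
    have D: "subring (?F \<inter> M) R" using subring_inter[OF F.F_ring \<Gamma>.F_ring] .
    have "\<gamma> \<in> ring_hom (R\<lparr>carrier := ?F \<inter> M\<rparr>) R"
      using subring_hom_mono[OF galois_groupD(6)[OF \<gamma>] Int_lower2 subfieldE(3)[OF M], of ?F] by simp
    then obtain \<theta> where \<theta>: "\<theta> \<in> carrier (galois_group R k ?F)" "\<forall>y\<in>?F \<inter> M. \<theta> y = \<gamma> y"
      using F.hom_extends_to_group[OF D Int_lower1] F.KF k_M galois_groupD(5)[OF \<gamma>] by blast
    have xF: "x \<in> ?F" using f(3) by simp
    have "\<gamma> x \<in> L" using galois_groupD(1)[OF \<theta>(1) xF] \<theta>(2) xF x(1) f(4) by auto
    then show "\<gamma> x \<in> ?L0" using galois_groupD(1)[OF \<gamma> x(1)] fixed_field_res[OF L] by blast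
  qed
  show "galois_extension R k ?L0"
    using galois_extension_stable[OF galois_M complement_fixed_field(1,2)[OF U] fixed_field_subset stable] .
  have "\<gamma> \<otimes>\<^bsub>\<Gamma>\<^esub> h \<otimes>\<^bsub>\<Gamma>\<^esub> inv\<^bsub>\<Gamma>\<^esub> \<gamma> \<in> res L" if \<gamma>: "\<gamma> \<in> carrier \<Gamma>" and h: "h \<in> res L" for \<gamma> h
  proof -
    let ?i = "inv\<^bsub>\<Gamma>\<^esub> \<gamma>" and ?g = "\<gamma> \<otimes>\<^bsub>\<Gamma>\<^esub> h \<otimes>\<^bsub>\<Gamma>\<^esub> inv\<^bsub>\<Gamma>\<^esub> \<gamma>"
    have hc: "h \<in> carrier \<Gamma>" using complementD(2)[OF U] h by blast
    have i: "?i \<in> carrier \<Gamma>" and gh: "\<gamma> \<otimes>\<^bsub>\<Gamma>\<^esub> h \<in> carrier \<Gamma>" using \<gamma> hc by simp_all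
    have g: "?g \<in> carrier \<Gamma>" using gh i by simp
    have "?g y = y" if y: "y \<in> ?L0" for y
    proof -
      have yM: "y \<in> M" using fixed_fieldD(1)[OF y] .
      have iy: "?i y \<in> ?L0" using bspec[OF bspec[OF stable i] y] .
      have "?g y = (\<gamma> \<otimes>\<^bsub>\<Gamma>\<^esub> h) (?i y)"
        unfolding galois_group_mult[OF gh i] using yM by (simp add: compose_def)
      also have "\<dots> = \<gamma> (h (?i y))"
        unfolding galois_group_mult[OF \<gamma> hc] using fixed_fieldD(1)[OF iy] by (simp add: compose_def)
      also have "h (?i y) = ?i y" using fixed_fieldD(2)[OF iy h] .
      also have "\<gamma> (?i y) = y" using galois_group_inv_apply(1)[OF \<Gamma>.F_ring k_M \<gamma> yM] .
      finally show ?thesis .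
    qed
    then have "?g \<in> carrier (galois_group R ?L0 M)" using g unfolding galois_group_iff by simp
    then show ?thesis using complement_fixed_field(4)[OF U] by simp
  qed
  then show "res L \<lhd> \<Gamma>" using \<Gamma>.Gal.normal_inv_iff complementD(1)[OF U] by blast
qed

end

theorem theorem2p5:
  fixes \<Omega> :: "('a, 'b) ring_scheme"
    and k E Ehat :: "'a set"
    and d :: nat
  assumes "field \<Omega>"
    and "field_extension \<Omega> k E"
    and "ring.dimension \<Omega> d k E"
    and "separable_extension \<Omega> k E"
    and "galois_closure \<Omega> k E Ehat"
  shows
    \<comment> \<open>\<open>\<bbbG>\<close> is well defined\<close>
    "(\<forall>L \<in> pot_galois_fields \<Omega> k E.
        Ehat \<subseteq> compositum \<Omega> E L \<and>
        restricted_galois \<Omega> E Ehat L \<in> galois_complements \<Omega> k E Ehat)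
   \<and> \<comment> \<open>(a)\<close>
     bij_betw (restricted_galois \<Omega> E Ehat)
       (min_pot_galois_fields \<Omega> k E) (galois_complements \<Omega> k E Ehat)
   \<and> fixed_field Ehat \<in> galois_complements \<Omega> k E Ehat \<rightarrow> min_pot_galois_fields \<Omega> k E
   \<and> (\<forall>L \<in> min_pot_galois_fields \<Omega> k E.
        fixed_field Ehat (restricted_galois \<Omega> E Ehat L) = L)
   \<and> (\<forall>G \<in> galois_complements \<Omega> k E Ehat.
        restricted_galois \<Omega> E Ehat (fixed_field Ehat G) = G)
   \<and> \<comment> \<open>(b)\<close>
     (\<forall>L \<in> min_pot_galois_fields \<Omega> k E.
        L \<subseteq> Ehat \<and>
        compositum \<Omega> E L = Ehat \<and>
        restricted_galois \<Omega> E Ehat L = carrier (galois_group \<Omega> L Ehat) \<and>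
        potentially_galois_with_group \<Omega> k E L (galois_group \<Omega> L Ehat))
   \<and> \<comment> \<open>(c)\<close>
     (\<forall>L \<in> pot_galois_fields \<Omega> k E.
        (\<exists>!L0. L0 \<in> min_pot_galois_fields \<Omega> k E \<and> L0 \<subseteq> L) \<and>
        (\<forall>L0 \<in> min_pot_galois_fields \<Omega> k E. L0 \<subseteq> L \<longrightarrow>
           L0 = fixed_field Ehat (restricted_galois \<Omega> E Ehat L) \<and>
           base_change \<Omega> L0 (compositum \<Omega> E L0) L (compositum \<Omega> E L) \<and>
           restricted_galois \<Omega> E Ehat L = restricted_galois \<Omega> E Ehat L0 \<and>
           (galois_extension \<Omega> k L \<longrightarrow>
              galois_extension \<Omega> k L0 \<and>
              restricted_galois \<Omega> E Ehat L \<lhd> galois_group \<Omega> k Ehat)))"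
proof -
  interpret galois_closed_extension \<Omega> k E Ehat d
    by (intro galois_closed_extension.intro galois_closed_extension_axioms.intro assms)
  note min = minimal_fixed_field
  \<comment> \<open>A minimal \<open>L\<close> is the fixed field of the complement
    \<open>res L\<close>, so the facts about fixed fields of complements apply after
    rewriting.\<close>
  have b: "L \<subseteq> Ehat \<and> compositum \<Omega> E L = Ehat \<and> res L = carrier (galois_group \<Omega> L Ehat) \<and>
      potentially_galois_with_group \<Omega> k E L (galois_group \<Omega> L Ehat)" if L: "L \<in> \<L>m" for L
  proof -
    note U = res_complement[OF min(1)[OF L]]
    show ?thesis
      using fixed_field_subset[of "res L"] compositum_fixed_field[OF U] complement_fixed_field(4)[OF U]
        complement_potentially_galois[OF U]
      unfolding min(2)[OF L] by blast
  qed
  have c: "(\<exists>!L0. L0 \<in> \<L>m \<and> L0 \<subseteq> L) \<and>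
        (\<forall>L0 \<in> \<L>m. L0 \<subseteq> L \<longrightarrow>
           L0 = fixed_field Ehat (res L) \<and>
           base_change \<Omega> L0 (compositum \<Omega> E L0) L (compositum \<Omega> E L) \<and>
           res L = res L0 \<and>
           (galois_extension \<Omega> k L \<longrightarrow> galois_extension \<Omega> k L0 \<and> res L \<lhd> galois_group \<Omega> k Ehat))"
    if L: "L \<in> \<L>" for L
  proof (intro conjI ballI impI)
    note U = res_complement[OF L]
    show "\<exists>!L0. L0 \<in> \<L>m \<and> L0 \<subseteq> L"
    proof (rule ex1I)
      show "fixed_field Ehat (res L) \<in> \<L>m \<and> fixed_field Ehat (res L) \<subseteq> L"
        using fixed_field_minimal[OF U] fixed_field_res[OF L] by blast
    qed (use minimal_below[OF L] in blast)
    fix L0 assume L0: "L0 \<in> \<L>m" "L0 \<subseteq> L"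
    show eq: "L0 = fixed_field Ehat (res L)" using minimal_below[OF L L0] .
    show "base_change \<Omega> L0 (compositum \<Omega> E L0) L (compositum \<Omega> E L)"
      unfolding eq compositum_fixed_field[OF U] using base_change_fixed_field[OF L] .
    show "res L = res L0" unfolding eq res_fixed_field[OF U] ..
    assume g: "galois_extension \<Omega> k L"
    show "galois_extension \<Omega> k L0" unfolding eq using galois_over_base(1)[OF L g] .
    show "res L \<lhd> galois_group \<Omega> k Ehat" using galois_over_base(2)[OF L g] .
  qed
  have "bij_betw res \<L>m \<G>"
  proof (rule bij_betw_byWitness[where f' = "fixed_field Ehat"])
    show "\<forall>L\<in>\<L>m. fixed_field Ehat (res L) = L" using min(2) by blast
    show "\<forall>U\<in>\<G>. res (fixed_field Ehat U) = U" using res_fixed_field by blast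
    show "res ` \<L>m \<subseteq> \<G>" using res_complement[OF min(1)] by blast
    show "fixed_field Ehat ` \<G> \<subseteq> \<L>m" using fixed_field_minimal by blast
  qed
  moreover have "fixed_field Ehat \<in> \<G> \<rightarrow> \<L>m" by (rule Pi_I) (rule fixed_field_minimal)
  moreover have "\<forall>L\<in>\<L>. Ehat \<subseteq> compositum \<Omega> E L \<and> res L \<in> \<G>"
    by (intro ballI conjI M_subset_compositum res_complement)
  moreover have "\<forall>L\<in>\<L>m. fixed_field Ehat (res L) = L" by (intro ballI min(2))
  moreover have "\<forall>U\<in>\<G>. res (fixed_field Ehat U) = U" by (intro ballI res_fixed_field)
  moreover note ballI[where A = \<L>m, OF b] ballI[where A = \<L>, OF c]
  ultimately show ?thesis by (intro conjI)
qed

end
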